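(* Assume the Hardy--Littlewood prime-pair conjecture in the form stated in the context. Then for every fixed real $\alpha\ge -1$, as $X\to+\infty$, $$\sum_{2\le n\le X}\frac{(\log d_n)^{\alpha}}{d_n}\sim\begin{cases}\dfrac{X}{\log X}\,\dfrac{(\log\log X)^{1+\alpha}}{1+\alpha} & \text{if } \alpha>-1,\\[2mm] \dfrac{X\log\log\log X}{\log X} & \text{if } \alpha=-1.\end{cases}$$
   Context: $p_n$ denotes the $n$-th prime number and $d_n=p_{n+1}-p_n$. For a natural number $d$, let $\pi(X;\{0,d\})=\#\{n\in\mathbb{N}: n+d\le X,\ n \text{ and } n+d \text{ are both prime}\}$, and for even $d\ge 2$ let $$\mathfrak{S}(\{0,d\})=2\prod_{p>2}\left(1-\frac{1}{(p-1)^2}\right)\prod_{p\mid d,\ p>2}\frac{p-1}{p-2},$$ the products being over primes $p$. Hardy--Littlewood prime-pair conjecture (the hypothesis): $\pi(X;\{0,d\})=\mathfrak{S}(\{0,d\})\frac{X}{\log^2 X}(1+o(1))$ as $X\to+\infty$, uniformly for even natural numbers $d\ll\log X$; that is, for every constant $C>0$, $$\sup_{\substack{2\le d\le C\log X\\ d\text{ even}}}\left|\frac{\pi(X;\{0,d\})}{\mathfrak{S}(\{0,d\})X/\log^2X}-1\right|\to 0\quad\text{as } X\to+\infty.$$ *)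

theory Defs
  imports Complex_Main "HOL-Library.Infinite_Set" "HOL-Library.Landau_Symbols"
    "HOL-Computational_Algebra.Primes" "HOL-Analysis.Infinite_Products"
begin

(* The primes are numbered from 1, so nth_prime 1 = 2, whereas enumerate starts at 0.
   The value at n = 0 is irrelevant. *)
definition nth_prime :: "nat \<Rightarrow> nat" where
  "nth_prime n = enumerate {p. prime p} (n - 1)"

definition prime_gap :: "nat \<Rightarrow> nat" where
  "prime_gap n = nth_prime (n + 1) - nth_prime n"

definition prime_pair_count :: "nat \<Rightarrow> real \<Rightarrow> nat" where
  "prime_pair_count d X = card {n::nat. real (n + d) \<le> X \<and> prime n \<and> prime (n + d)}"

(* The infinite product over the primes p > 2 is taken in increasing order of p;
   indices that are not such primes contribute the factor 1. *)
definition singular_series :: "nat \<Rightarrow> real" where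
  "singular_series d =
     2 * (\<Prod>p::nat. if prime p \<and> p > 2 then 1 - 1 / (real p - 1)\<^sup>2 else 1)
       * (\<Prod>p\<in>{p::nat. prime p \<and> p dvd d \<and> p > 2}. (real p - 1) / (real p - 2))"

lemma singular_series_factors_convergent:
  "convergent_prod (\<lambda>p::nat. if prime p \<and> p > 2 then 1 - 1 / (real p - 1)\<^sup>2 else 1)"
proof -
  have "summable (\<lambda>n. inverse (real n ^ 2))"
    using inverse_power_summable[of 2, where 'a = real] by simp
  then have s: "summable (\<lambda>p. 1 / (real p - 1)\<^sup>2)"
    using summable_Suc_iff[of "\<lambda>p. 1 / (real p - 1)\<^sup>2"] by (simp add: inverse_eq_divide)
  have "summable (\<lambda>p::nat. norm ((if prime p \<and> p > 2 then 1 - 1 / (real p - 1)\<^sup>2 else 1) - 1))"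
    by (rule summable_comparison_test'[OF s, of 0]) auto
  then have "abs_convergent_prod (\<lambda>p::nat. if prime p \<and> p > 2 then 1 - 1 / (real p - 1)\<^sup>2 else 1)"
    by (simp add: summable_imp_abs_convergent_prod)
  then show ?thesis
    by (rule abs_convergent_prod_imp_convergent_prod)
qed

(* For large X the index set is finite and nonempty, so SUP is then a genuine maximum. *)
definition hardy_littlewood_prime_pairs :: bool where
  "hardy_littlewood_prime_pairs \<longleftrightarrow>
     (\<forall>C>0. ((\<lambda>X::real. SUP d\<in>{d::nat. even d \<and> 2 \<le> d \<and> real d \<le> C * ln X}.
                \<bar>real (prime_pair_count d X) / (singular_series d * X / (ln X)\<^sup>2) - 1\<bar>)
              \<longlongrightarrow> 0) at_top)"

end

theory Submission
  imports Defs "HOL-Analysis.Analysis" "HOL-Number_Theory.Number_Theory" "HOL-Real_Asymp.Real_Asymp"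
    "HOL-Computational_Algebra.Squarefree"
begin

text \<open>
  Write \<open>L = log Y\<close> for \<open>Y = p\<^bsub>n+1\<^esub>\<close> and \<open>S(d)\<close> for the singular series, put
  equal to 0 at odd \<open>d\<close>.  Since \<open>S\<close> has mean value 1, the conjecture shows that the gaps \<open>d \<le> L\<close> contribute at most about
  \<open>Y / L\<^sup>2 \<cdot> \<Sum>d\<le>L. S(d) (log d)\<^sup>\<alpha> / d\<close>, and by partial summation the sum over \<open>d\<close> is asymptotic to the
  primitive of \<open>(log t)\<^sup>\<alpha> / t\<close> at \<open>L\<close>.  Larger gaps are negligible because there are only about
  \<open>Y / L\<close> of them.  For the lower bound one keeps only \<open>d \<le> L\<^sup>c\<close> with \<open>c < 1\<close> close to 1, which costs
  almost nothing on the logarithmic scale; the pairs \<open>p, p + d\<close> with a prime in between then number at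
  most \<open>Y L powr (c - 3 + o(1))\<close> for each \<open>d\<close>, by Brun's pure sieve applied with primes above \<open>L\<close> only.

  Passing from \<open>Y\<close> to \<open>n\<close> needs the prime number theorem, which the conjecture provides cheaply:
  the second moment of the number of primes in intervals of length \<open>C L\<close> and the Cauchy--Schwarz
  inequality give \<open>\<pi>(Y) \<le> (1 + o(1)) Y / L\<close>, and Selberg's symmetry formula turns this upper bound
  into the matching lower bound.
\<close>

section \<open>Partial summation\<close>

text \<open>The cut at L^c is forced: for d of order L a positive proportion of the prime pairs is
  expected to have a prime in between, so pair counts alone cannot detect consecutive primes there.
  The sum tolerates the cut because the range from L^c to L carries a share of the integral of (log
  t)^\<alpha> / t that tends to 0 as c tends to 1. Below the cut a whole power of L is saved, so the
  sieve may lose any factor L^o(1), and this freedom shapes it. Sieving by primes p > L \<ge> d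
  makes the classes 0, -a, -d distinct modulo every p, so the bound is uniform in a and d. The level
  z = exp(L / (60 log L)), within reach of the pure sieve, serves as well as a power of Y, since log
  log z is still asymptotic to log L. And the sum of 1/p is required only up to a factor 1 + o(1),
  which the partial summation used for the singular series also yields.

  In the second moment the diagonal pairs p = q contribute about 1 / C of the main term. Hence C
  must be arbitrarily large, which is why the conjecture is applied with every multiple of log X
  there and only with C = 1 for the gaps.\<close>

lemma Abel_sum_bounded_below:
  fixes b f :: "nat \<Rightarrow> real"
  assumes nonneg: "\<And>n. n \<ge> m \<Longrightarrow> (\<Sum>k\<le>n. b k) \<ge> 0"
    and f_nonneg: "\<And>n. n \<ge> m \<Longrightarrow> f n \<ge> 0"
    and f_decr: "\<And>n. n \<ge> m \<Longrightarrow> f (Suc n) \<le> f n"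
    and "n \<ge> m"
  shows "(\<Sum>k\<le>n. b k * f k) \<ge> (\<Sum>k\<le>m. b k * f k) - (\<Sum>k\<le>m. b k) * f m"
proof -
  \<comment> \<open>After removal of the boundary term the sum is nondecreasing from
    \<open>m\<close> on: passing from \<open>n\<close> to \<open>n + 1\<close> adds the nonnegative
    partial sum times \<open>f n - f (Suc n)\<close>.\<close>
  have "(\<Sum>k\<le>n. b k * f k) - (\<Sum>k\<le>n. b k) * f n
          \<ge> (\<Sum>k\<le>m. b k * f k) - (\<Sum>k\<le>m. b k) * f m"
    using \<open>n \<ge> m\<close>
  proof (induction n rule: dec_induct)
    case (step n)
    have "(\<Sum>k\<le>n. b k) * f (Suc n) \<le> (\<Sum>k\<le>n. b k) * f n"
      using step by (intro mult_left_mono nonneg f_decr) auto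
    with step.IH show ?case by (simp add: algebra_simps)
  qed simp
  moreover have "(\<Sum>k\<le>n. b k) * f n \<ge> 0"
    using assms by simp
  ultimately show ?thesis by linarith
qed

text \<open>Testing only e < 1 keeps 1 - e positive when several such bounds are multiplied.\<close>

lemma asymp_equiv_at_top_iff:
  fixes f g :: "'a \<Rightarrow> real"
  assumes "eventually (\<lambda>x. g x > 0) F"
  shows "f \<sim>[F] g \<longleftrightarrow>
    (\<forall>e>0. e < 1 \<longrightarrow> (\<forall>\<^sub>F x in F. (1 - e) * g x \<le> f x \<and> f x \<le> (1 + e) * g x))"
proof
  assume "f \<sim>[F] g"
  then have lim: "((\<lambda>x. f x / g x) \<longlongrightarrow> 1) F"
    by (rule asymp_equivD_strong) (use assms in \<open>auto elim: eventually_mono\<close>)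
  show "\<forall>e>0. e < 1 \<longrightarrow> (\<forall>\<^sub>F x in F. (1 - e) * g x \<le> f x \<and> f x \<le> (1 + e) * g x)"
  proof (intro allI impI)
    fix e :: real assume "e > 0"
    with lim have "eventually (\<lambda>x. dist (f x / g x) 1 < e) F"
      by (rule tendstoD)
    with assms show "\<forall>\<^sub>F x in F. (1 - e) * g x \<le> f x \<and> f x \<le> (1 + e) * g x"
    proof eventually_elim
      case (elim x)
      then have "1 - e \<le> f x / g x" "f x / g x \<le> 1 + e"
        by (auto simp: dist_real_def)
      with elim(1) show ?case
        by (simp add: field_simps)
    qed
  qed
next
  assume bounds: "\<forall>e>0. e < 1 \<longrightarrow> (\<forall>\<^sub>F x in F. (1 - e) * g x \<le> f x \<and> f x \<le> (1 + e) * g x)"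
  have "((\<lambda>x. f x / g x) \<longlongrightarrow> 1) F"
  proof (rule tendstoI)
    fix e :: real assume "e > 0"
    define e' where "e' = min e 1 / 2"
    have e': "e' > 0" "e' < 1" "e' < e"
      using \<open>e > 0\<close> by (auto simp: e'_def min_def)
    with bounds have "\<forall>\<^sub>F x in F. (1 - e') * g x \<le> f x \<and> f x \<le> (1 + e') * g x"
      by blast
    with assms show "\<forall>\<^sub>F x in F. dist (f x / g x) 1 < e"
    proof eventually_elim
      case (elim x)
      then have "1 - e' \<le> f x / g x" "f x / g x \<le> 1 + e'"
        by (simp_all add: field_simps)
      then show ?case
        using e' by (auto simp: dist_real_def abs_if)
    qed
  qed
  then show "f \<sim>[F] g"
    by (rule asymp_equivI')
qed

text \<open>Applied to the singular series and to ln p at primes. The sequences (1 + e) - a and a -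
  (1 - e) have nonnegative partial sums from some point on, so the one-sided Abel bound compares the
  weighted sum with 1 + e and 1 - e times the plain sum of f, which the mean value theorem compares
  with F. The initial terms only contribute constants, absorbed because F tends to infinity.\<close>

lemma weighted_sum_asymp_equiv:
  fixes a :: "nat \<Rightarrow> real" and f F :: "real \<Rightarrow> real"
  assumes a: "(\<lambda>n. \<Sum>k\<le>n. a k) \<sim>[sequentially] real"
    and deriv: "\<And>x. x \<ge> x0 \<Longrightarrow> (F has_real_derivative f x) (at x)"
    and f_nonneg: "\<And>x. x \<ge> x0 \<Longrightarrow> f x \<ge> 0"
    and f_antimono: "\<And>x y. x0 \<le> x \<Longrightarrow> x \<le> y \<Longrightarrow> f y \<le> f x"
    and F: "filterlim F at_top at_top"
  shows "(\<lambda>n. \<Sum>k\<le>n. a k * f (real k)) \<sim>[sequentially] (\<lambda>n. F (real n))"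
proof -
  have F_seq: "filterlim (\<lambda>n. F (real n)) at_top sequentially"
    by (rule filterlim_compose[OF F filterlim_real_sequentially])
  define m0 where "m0 = nat \<lceil>x0\<rceil>"
  have m0: "real n \<ge> x0" if "n \<ge> m0" for n
    using that by (simp add: m0_def nat_le_iff le_ceiling_iff ceiling_le_iff)
  have mvt: "f (real (Suc n)) \<le> F (real (Suc n)) - F (real n)"
            "F (real (Suc n)) - F (real n) \<le> f (real n)" if n: "n \<ge> m0" for n
  proof -
    obtain z where "z > real n" "z < real (Suc n)"
      "F (real (Suc n)) - F (real n) = (real (Suc n) - real n) * f z"
      using MVT2[of "real n" "real (Suc n)" F f] deriv m0[OF n] by force
    then show "f (real (Suc n)) \<le> F (real (Suc n)) - F (real n)"
              "F (real (Suc n)) - F (real n) \<le> f (real n)"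
      using f_antimono[of "real n" z] f_antimono[of z "real (Suc n)"] m0[OF n] by auto
  qed
  define s where "s n = (\<Sum>k\<le>n. f (real k))" for n
  have s_upper: "s n \<le> s m0 + (F n - F m0)" if "n \<ge> m0" for n
    using that by (induction n rule: dec_induct) (use mvt(1) in \<open>force simp: s_def\<close>)+
  have s_lower: "s n \<ge> s m0 - f m0 + (F n - F m0) + f n" if "n \<ge> m0" for n
    using that
  proof (induction n rule: dec_induct)
    case (step n)
    then show ?case using mvt(2)[of n] by (simp add: s_def)
  qed simp
  show ?thesis
  proof (subst asymp_equiv_at_top_iff)
    show "\<forall>\<^sub>F n in sequentially. F (real n) > 0"
      using F_seq by (simp add: filterlim_at_top_dense)
    show "\<forall>e>0. e < 1 \<longrightarrow> (\<forall>\<^sub>F n in sequentially.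
            (1 - e) * F (real n) \<le> (\<Sum>k\<le>n. a k * f (real k)) \<and>
            (\<Sum>k\<le>n. a k * f (real k)) \<le> (1 + e) * F (real n))"
    proof (intro allI impI)
      fix e :: real assume e: "e > 0" "e < 1"
      define e' where "e' = e / 2"
      have e': "e' > 0" "e' < 1" using e by (auto simp: e'_def)
      \<comment> \<open>The constant 1 - e' summed over k \<le> n gives (1 - e') (n + 1); the spare
        half of e' pays for the extra term.\<close>
      have "\<forall>\<^sub>F n in sequentially. (1 - e'/2) * real n \<le> (\<Sum>k\<le>n. a k) \<and> (\<Sum>k\<le>n. a k) \<le> (1 + e') * real n"
      proof -
        have pos: "\<forall>\<^sub>F n in sequentially. real n > 0"
          using eventually_gt_at_top[of 0] by eventually_elim simp
        have "\<forall>\<^sub>F n in sequentially. (1 - e'/2) * real n \<le> (\<Sum>k\<le>n. a k) \<and> (\<Sum>k\<le>n. a k) \<le> (1 + e'/2) * real n"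
          using a[unfolded asymp_equiv_at_top_iff[OF pos], rule_format, of "e'/2"] e' by simp
        then show ?thesis
        proof eventually_elim
          case (elim n)
          have "(1 + e'/2) * real n \<le> (1 + e') * real n"
            using e' by (intro mult_right_mono) auto
          with elim show ?case by linarith
        qed
      qed
      moreover have "\<forall>\<^sub>F n in sequentially. (1 - e') * real (Suc n) \<le> (1 - e'/2) * real n"
        using e' by real_asymp
      ultimately have "\<forall>\<^sub>F n in sequentially. (1 - e') * real (Suc n) \<le> (\<Sum>k\<le>n. a k) \<and> (\<Sum>k\<le>n. a k) \<le> (1 + e') * real n"
        by eventually_elim linarith
      then obtain m1 where m1: "\<And>n. n \<ge> m1 \<Longrightarrow> (1 - e') * real (Suc n) \<le> (\<Sum>k\<le>n. a k)"
        "\<And>n. n \<ge> m1 \<Longrightarrow> (\<Sum>k\<le>n. a k) \<le> (1 + e') * real n"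
        unfolding eventually_sequentially by blast
      define m where "m = max m0 m1"
      have m: "m \<ge> m0" "m \<ge> m1" by (auto simp: m_def)
      define u where "u k = (1 + e') - a k" for k
      define v where "v k = a k - (1 - e')" for k
      define K1 where "K1 = (\<Sum>k\<le>m. u k * f k) - (\<Sum>k\<le>m. u k) * f m"
      define K2 where "K2 = (\<Sum>k\<le>m. v k * f k) - (\<Sum>k\<le>m. v k) * f m"
      have decr: "f (real (Suc n)) \<le> f (real n)" if "n \<ge> m" for n
        using that m m0[of n] by (intro f_antimono) auto
      have K1: "(\<Sum>k\<le>n. u k * f k) \<ge> K1" if "n \<ge> m" for n
        unfolding K1_def
      proof (rule Abel_sum_bounded_below[where m = m and n = n and f = "\<lambda>k. f (real k)"])
        fix n assume "n \<ge> m"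
        then have "(\<Sum>k\<le>n. a k) \<le> (1 + e') * real n" using m m1(2)[of n] by auto
        also have "\<dots> \<le> (1 + e') * real (Suc n)" using e' by (intro mult_left_mono) auto
        finally show "(\<Sum>k\<le>n. u k) \<ge> 0"
          unfolding u_def sum_subtractf by (simp add: algebra_simps)
      qed (use that f_nonneg m0 m decr in auto)
      have K2: "(\<Sum>k\<le>n. v k * f k) \<ge> K2" if "n \<ge> m" for n
        unfolding K2_def
      proof (rule Abel_sum_bounded_below[where m = m and n = n and f = "\<lambda>k. f (real k)"])
        fix n assume "n \<ge> m"
        then show "(\<Sum>k\<le>n. v k) \<ge> 0" using m m1(1)[of n]
          unfolding v_def sum_subtractf by (simp add: algebra_simps)
      qed (use that f_nonneg m0 m decr in auto)
      define K3 where "K3 = s m0 - F m0"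
      define K4 where "K4 = s m0 - f m0 - F m0"
      have ev1: "\<forall>\<^sub>F n in sequentially. e' * F n \<ge> (1 + e') * K3 - K1"
        and ev2: "\<forall>\<^sub>F n in sequentially. e' * F n \<ge> - K2 - (1 - e') * K4"
        using filterlim_tendsto_pos_mult_at_top[OF tendsto_const e'(1) F_seq]
        by (auto simp: filterlim_at_top)
      show "\<forall>\<^sub>F n in sequentially.
            (1 - e) * F (real n) \<le> (\<Sum>k\<le>n. a k * f (real k)) \<and>
            (\<Sum>k\<le>n. a k * f (real k)) \<le> (1 + e) * F (real n)"
        using ev1 ev2 eventually_ge_at_top[of m]
      proof eventually_elim
        case (elim n)
        have n0: "n \<ge> m0" using elim m by simp
        have su: "s n \<le> F n + K3" using s_upper[OF n0] by (simp add: K3_def)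
        have sl: "s n \<ge> F n + K4"
          using s_lower[OF n0] f_nonneg[OF m0[OF n0]] by (simp add: K4_def)
        have "(\<Sum>k\<le>n. u k * f k) = (1 + e') * s n - (\<Sum>k\<le>n. a k * f k)"
          unfolding u_def s_def by (simp add: left_diff_distrib sum_subtractf sum_distrib_left)
        moreover have "(\<Sum>k\<le>n. v k * f k) = (\<Sum>k\<le>n. a k * f k) - (1 - e') * s n"
          unfolding v_def s_def by (simp add: left_diff_distrib sum_subtractf sum_distrib_left)
        moreover have "(1 + e') * s n \<le> (1 + e') * (F n + K3)"
          using su e' by (intro mult_left_mono) auto
        moreover have "(1 - e') * s n \<ge> (1 - e') * (F n + K4)"
          using sl e' by (intro mult_left_mono) auto
        ultimately have
            "(\<Sum>k\<le>n. a k * f k) \<le> (1 + e') * (F n + K3) - K1"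
            "(\<Sum>k\<le>n. a k * f k) \<ge> (1 - e') * (F n + K4) + K2"
          using K1[of n] K2[of n] elim by linarith+
        moreover have "(1 + e') * (F n + K3) - K1 \<le> (1 + e') * F n + e' * F n"
          using elim by (simp add: ring_distribs)
        moreover have "(1 - e') * (F n + K4) + K2 \<ge> (1 - e') * F n - e' * F n"
          using elim by (simp add: ring_distribs)
        moreover have "(1 + e') * F n + e' * F n = (1 + e) * F n"
                      "(1 - e') * F n - e' * F n = (1 - e) * F n"
          by (simp_all add: e'_def field_simps)
        ultimately show ?case by linarith
      qed
    qed
  qed
qed

section \<open>The mean value of the singular series\<close>

lemma prod_primes_dvd_iff:
  fixes n :: nat
  assumes "finite D" "\<And>p. p \<in> D \<Longrightarrow> prime p"
  shows "\<Prod>D dvd n \<longleftrightarrow> (\<forall>p\<in>D. p dvd n)"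
  using assms
proof (induction D rule: finite_induct)
  case (insert p D)
  have "coprime p (\<Prod>D)"
    using insert by (intro prod_coprime_right primes_coprime) auto
  then have "p * \<Prod>D dvd n \<longleftrightarrow> p dvd n \<and> \<Prod>D dvd n"
    by (auto intro: divides_mult dest: dvd_mult_left dvd_mult_right)
  with insert show ?case by simp
qed simp

lemma card_multiples_nat:
  fixes M q :: nat
  assumes "q > 0"
  shows "card {e\<in>{1..M}. q dvd e} = M div q"
proof -
  have "{e\<in>{1..M}. q dvd e} = (\<lambda>k. q * k) ` {1..M div q}"
  proof (intro equalityI subsetI)
    fix e assume "e \<in> {e\<in>{1..M}. q dvd e}"
    then obtain k where k: "e = q * k" "1 \<le> e" "e \<le> M" by (auto elim: dvdE)
    then have "k \<le> M div q" using assms by (simp add: less_eq_div_iff_mult_less_eq mult.commute)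
    with k show "e \<in> (\<lambda>k. q * k) ` {1..M div q}" by (auto simp: Suc_le_eq)
  next
    fix e assume "e \<in> (\<lambda>k. q * k) ` {1..M div q}"
    then show "e \<in> {e\<in>{1..M}. q dvd e}"
      using assms by (auto simp: less_eq_div_iff_mult_less_eq mult.commute Suc_le_eq)
  qed
  then show ?thesis
    using assms by (simp add: card_image inj_on_def)
qed

section \<open>The twin prime constant\<close>

definition twin_prime_factor :: "nat \<Rightarrow> real" where
  "twin_prime_factor p = (if prime p \<and> p > 2 then 1 - 1 / (real p - 1)\<^sup>2 else 1)"

definition twin_prime_const :: real where
  "twin_prime_const = prodinf twin_prime_factor"

lemma convergent_prod_twin_prime_factor: "convergent_prod twin_prime_factor"
  using singular_series_factors_convergent by (simp add: twin_prime_factor_def [abs_def])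

lemma singular_series_altdef:
  "singular_series d = 2 * twin_prime_const *
     (\<Prod>p\<in>{p. prime p \<and> p dvd d \<and> p > 2}. (real p - 1) / (real p - 2))"
  by (simp add: singular_series_def twin_prime_const_def twin_prime_factor_def [abs_def])

lemma twin_prime_factor_bounds: "0 < twin_prime_factor p" "twin_prime_factor p \<le> 1"
proof -
  have "1 / (real p - 1)\<^sup>2 < 1" if "p > 2"
  proof -
    have "(real p - 1)\<^sup>2 > 1\<^sup>2" using that by (intro power_strict_mono) auto
    then show ?thesis by (subst divide_less_eq_1) auto
  qed
  then show "0 < twin_prime_factor p" by (simp add: twin_prime_factor_def)
  show "twin_prime_factor p \<le> 1" by (simp add: twin_prime_factor_def)
qed

lemma twin_prime_partial_products_LIMSEQ:
  "(\<lambda>n. \<Prod>p\<le>n. twin_prime_factor p) \<longlonglongrightarrow> twin_prime_const"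
  unfolding twin_prime_const_def
  by (rule convergent_prod_LIMSEQ[OF convergent_prod_twin_prime_factor])

lemma twin_prime_const_le: "twin_prime_const \<le> (\<Prod>p\<le>n. twin_prime_factor p)"
proof (rule decseq_ge[OF _ twin_prime_partial_products_LIMSEQ])
  show "decseq (\<lambda>n. \<Prod>p\<le>n. twin_prime_factor p)"
  proof (rule decseq_SucI)
    fix n
    have "(\<Prod>p\<le>n. twin_prime_factor p) \<ge> 0"
      by (intro prod_nonneg) (auto intro: less_imp_le twin_prime_factor_bounds)
    then show "(\<Prod>p\<le>Suc n. twin_prime_factor p) \<le> (\<Prod>p\<le>n. twin_prime_factor p)"
      using twin_prime_factor_bounds[of "Suc n"] by (simp add: mult_left_le)
  qed
qed

lemma twin_prime_const_pos: "twin_prime_const > 0"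
proof -
  have "twin_prime_const \<ge> 0"
    by (rule LIMSEQ_le_const[OF twin_prime_partial_products_LIMSEQ])
       (auto intro!: prod_nonneg intro: less_imp_le twin_prime_factor_bounds)
  moreover have "twin_prime_const \<noteq> 0"
    unfolding twin_prime_const_def
    by (rule prodinf_nonzero[OF convergent_prod_twin_prime_factor])
       (use twin_prime_factor_bounds(1) in \<open>simp add: less_imp_neq[symmetric]\<close>)
  ultimately show ?thesis by simp
qed

lemma singular_series_pos: "singular_series d > 0"
proof -
  have "(\<Prod>p\<in>{p. prime p \<and> p dvd d \<and> p > 2}. (real p - 1) / (real p - 2)) > 0"
    by (intro prod_pos) auto
  then show ?thesis by (simp add: singular_series_altdef twin_prime_const_pos)
qed

section \<open>Truncation of the singular series at a fixed prime bound\<close>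

definition odd_primes_upto :: "nat \<Rightarrow> nat set" where
  "odd_primes_upto N = {p. prime p \<and> 2 < p \<and> p \<le> N}"

lemma finite_odd_primes_upto [simp]: "finite (odd_primes_upto N)"
  by (rule finite_subset[of _ "{..N}"]) (auto simp: odd_primes_upto_def)

text \<open>The singular series at 2 * e without the factor 2 * \<open>twin_prime_const\<close> and
  with primes up to N only. Writing (p - 1) / (p - 2) as 1 + 1 / (p - 2) prepares the expansion over
  sets of primes.\<close>

definition truncated_series :: "nat \<Rightarrow> nat \<Rightarrow> real" where
  "truncated_series N e = (\<Prod>p\<in>odd_primes_upto N. 1 + (if p dvd e then 1 / (real p - 2) else 0))"

text \<open>From (p - 1)^2 - 1 = p (p - 2). This is where the mean value 1 comes from: the average
  of the expanded product is exactly the inverse of the constant in front of it.\<close>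

lemma prod_inverse_twin_prime_factor:
  "(\<Prod>p\<in>odd_primes_upto N. 1 + 1 / (real p * (real p - 2))) = 1 / (\<Prod>p\<le>N. twin_prime_factor p)"
proof -
  have "(\<Prod>p\<le>N. twin_prime_factor p) = (\<Prod>p\<in>odd_primes_upto N. twin_prime_factor p)"
    by (rule prod.mono_neutral_right) (auto simp: odd_primes_upto_def twin_prime_factor_def)
  moreover have "(\<Prod>p\<in>odd_primes_upto N. 1 + 1 / (real p * (real p - 2))) =
                 (\<Prod>p\<in>odd_primes_upto N. 1 / twin_prime_factor p)"
  proof (rule prod.cong)
    fix p assume "p \<in> odd_primes_upto N"
    then have p: "prime p" "p > 2" by (auto simp: odd_primes_upto_def)
    then have "real p > 2" by simp
    have "(real p - 1)\<^sup>2 - 1 = real p * (real p - 2)"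
      by (simp add: power2_eq_square algebra_simps)
    then have eq: "1 - 1 / (real p - 1)\<^sup>2 = real p * (real p - 2) / (real p - 1)\<^sup>2"
      using \<open>real p > 2\<close> by (simp add: diff_divide_distrib [symmetric] field_simps)
    have inv: "1 + 1 / (x * (x - 2)) = 1 / (x * (x - 2) / (x - 1)\<^sup>2)" if "x > 2" for x :: real
    proof -
      have "x * (x - 2) + 1 = (x - 1)\<^sup>2" by (simp add: power2_eq_square algebra_simps)
      then show ?thesis using that by (simp add: add_divide_distrib [symmetric] field_simps)
    qed
    show "1 + 1 / (real p * (real p - 2)) = 1 / twin_prime_factor p"
      unfolding twin_prime_factor_def eq using p inv by simp
  qed simp
  ultimately show ?thesis by (simp add: prod_dividef)
qed

text \<open>Expanding the product, the term of a set D survives at e exactly when every prime of D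
  divides e, that is, when their product does; summing over e counts the multiples of that
  product.\<close>

lemma truncated_series_sum:
  "(\<Sum>e=1..M. truncated_series N e) =
     (\<Sum>D\<in>Pow (odd_primes_upto N). (\<Prod>p\<in>D. 1 / (real p - 2)) * real (M div \<Prod>D))"
proof -
  let ?Q = "odd_primes_upto N"
  have fin: "finite D" if "D \<in> Pow ?Q" for D
    using that by (auto intro: finite_subset)
  have "truncated_series N e =
      (\<Sum>D\<in>Pow ?Q. (\<Prod>p\<in>D. 1 / (real p - 2)) * (if \<Prod>D dvd e then 1 else 0))" for e
  proof -
    have "truncated_series N e =
        (\<Sum>D\<in>Pow ?Q. \<Prod>p\<in>D. if p dvd e then 1 / (real p - 2) else 0)"
      unfolding truncated_series_def
      by (subst add.commute, subst prod_add) auto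
    also have "\<dots> = (\<Sum>D\<in>Pow ?Q. (\<Prod>p\<in>D. 1 / (real p - 2)) * (if \<Prod>D dvd e then 1 else 0))"
    proof (rule sum.cong)
      fix D assume D: "D \<in> Pow ?Q"
      have "\<Prod>D dvd e \<longleftrightarrow> (\<forall>p\<in>D. p dvd e)"
        using D by (intro prod_primes_dvd_iff fin) (auto simp: odd_primes_upto_def)
      then show "(\<Prod>p\<in>D. if p dvd e then 1 / (real p - 2) else 0) =
          (\<Prod>p\<in>D. 1 / (real p - 2)) * (if \<Prod>D dvd e then 1 else 0)"
        using fin[OF D] by (auto intro!: prod_zero prod.cong)
    qed simp
    finally show ?thesis .
  qed
  then have "(\<Sum>e=1..M. truncated_series N e) =
      (\<Sum>e=1..M. \<Sum>D\<in>Pow ?Q. (\<Prod>p\<in>D. 1 / (real p - 2)) * (if \<Prod>D dvd e then 1 else 0))"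
    by simp
  also have "\<dots> = (\<Sum>D\<in>Pow ?Q. (\<Prod>p\<in>D. 1 / (real p - 2)) * (\<Sum>e=1..M. if \<Prod>D dvd e then 1 else 0))"
    by (subst sum.swap) (simp add: sum_distrib_left)
  also have "\<dots> = (\<Sum>D\<in>Pow ?Q. (\<Prod>p\<in>D. 1 / (real p - 2)) * real (M div \<Prod>D))"
  proof (intro sum.cong refl arg_cong2[where f = "(*)"])
    fix D assume D: "D \<in> Pow ?Q"
    have "\<Prod>D > 0"
      using D by (intro prod_pos) (auto simp: odd_primes_upto_def)
    then show "(\<Sum>e=1..M. if \<Prod>D dvd e then 1 else 0) = real (M div \<Prod>D)"
      using card_multiples_nat[of "\<Prod>D" M] by (simp add: sum.If_cases Int_def)
  qed
  finally show ?thesis .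
qed

lemma sum_Pow_twin_prime:
  "(\<Sum>D\<in>Pow (odd_primes_upto N). (\<Prod>p\<in>D. 1 / (real p - 2)) * (x / real (\<Prod>D))) =
     x / (\<Prod>p\<le>N. twin_prime_factor p)"
proof -
  have "(\<Prod>p\<in>odd_primes_upto N. 1 + 1 / (real p * (real p - 2))) =
      (\<Sum>D\<in>Pow (odd_primes_upto N). \<Prod>p\<in>D. 1 / (real p * (real p - 2)))"
    by (subst add.commute, subst prod_add) auto
  also have "\<dots> = (\<Sum>D\<in>Pow (odd_primes_upto N). (\<Prod>p\<in>D. 1 / (real p - 2)) * (1 / real (\<Prod>D)))"
    by (intro sum.cong refl) (simp add: prod_dividef prod.distrib mult.commute)
  finally have "x * (1 / (\<Prod>p\<le>N. twin_prime_factor p)) =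
      x * (\<Sum>D\<in>Pow (odd_primes_upto N). (\<Prod>p\<in>D. 1 / (real p - 2)) * (1 / real (\<Prod>D)))"
    by (simp add: prod_inverse_twin_prime_factor)
  then show ?thesis by (simp add: sum_distrib_left mult_ac)
qed

lemma truncated_series_sum_upper:
  "(\<Sum>e=1..M. truncated_series N e) \<le> real M / (\<Prod>p\<le>N. twin_prime_factor p)"
  unfolding truncated_series_sum sum_Pow_twin_prime [symmetric]
proof (intro sum_mono mult_left_mono prod_nonneg)
  fix D
  show "real (M div \<Prod>D) \<le> real M / real (\<Prod>D)" by (rule of_nat_div_le_of_nat)
qed (auto simp: odd_primes_upto_def)

text \<open>Each of the finitely many floors loses at most 1, so the loss depends on N but not on
  M.\<close>

lemma truncated_series_sum_lower:
  "\<exists>K. \<forall>M. (\<Sum>e=1..M. truncated_series N e) \<ge> real M / (\<Prod>p\<le>N. twin_prime_factor p) - K"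
proof (intro exI allI)
  fix M
  let ?K = "\<Sum>D\<in>Pow (odd_primes_upto N). \<Prod>p\<in>D. 1 / (real p - 2)"
  have "real M / (\<Prod>p\<le>N. twin_prime_factor p) - ?K =
      (\<Sum>D\<in>Pow (odd_primes_upto N). (\<Prod>p\<in>D. 1 / (real p - 2)) * (real M / real (\<Prod>D) - 1))"
    unfolding sum_Pow_twin_prime [symmetric] by (simp add: right_diff_distrib sum_subtractf)
  also have "\<dots> \<le> (\<Sum>e=1..M. truncated_series N e)"
    unfolding truncated_series_sum
  proof (intro sum_mono mult_left_mono prod_nonneg)
    fix D
    show "real M / real (\<Prod>D) - 1 \<le> real (M div \<Prod>D)"
      using floor_divide_of_nat_eq[where 'a = real, of M "\<Prod>D"] floor_correct[of "real M / real (\<Prod>D)"]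
      by linarith
  qed (auto simp: odd_primes_upto_def)
  finally show "real M / (\<Prod>p\<le>N. twin_prime_factor p) - ?K \<le> (\<Sum>e=1..M. truncated_series N e)" .
qed

lemma truncated_series_altdef:
  "truncated_series N e = (\<Prod>p\<in>{p\<in>odd_primes_upto N. p dvd e}. (real p - 1) / (real p - 2))"
proof -
  have "truncated_series N e = (\<Prod>p\<in>odd_primes_upto N. if p dvd e then (real p - 1) / (real p - 2) else 1)"
    unfolding truncated_series_def
    by (intro prod.cong refl) (auto simp: odd_primes_upto_def field_simps)
  then show ?thesis by (simp add: prod.inter_filter)
qed

lemma odd_prime_dvd_double_iff:
  "prime (p::nat) \<Longrightarrow> 2 < p \<Longrightarrow> p dvd 2 * e \<longleftrightarrow> p dvd e"
  by (metis dvd_imp_le linorder_not_less prime_dvd_mult_iff zero_less_numeral)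

lemma singular_series_truncated_le:
  assumes "e > 0"
  shows "2 * twin_prime_const * truncated_series N e \<le> singular_series (2 * e)"
proof -
  have "truncated_series N e \<le> (\<Prod>p\<in>{p. prime p \<and> p dvd 2 * e \<and> p > 2}. (real p - 1) / (real p - 2))"
    unfolding truncated_series_altdef
  proof (rule prod_mono2)
    show "finite {p. prime p \<and> p dvd 2 * e \<and> p > 2}"
      by (rule finite_subset[of _ "{p. p dvd 2 * e}"]) (use assms in auto)
    show "{p\<in>odd_primes_upto N. p dvd e} \<subseteq> {p. prime p \<and> p dvd 2 * e \<and> p > 2}"
      by (auto simp: odd_primes_upto_def)
    show "1 \<le> (real p - 1) / (real p - 2)"
      if "p \<in> {p. prime p \<and> p dvd 2 * e \<and> p > 2} - {p\<in>odd_primes_upto N. p dvd e}" for p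
    proof -
      have "real p > 2" using that by simp
      then show ?thesis by (simp add: field_simps)
    qed
    show "0 \<le> (real p - 1) / (real p - 2)" if "p \<in> {p\<in>odd_primes_upto N. p dvd e}" for p
    proof -
      have "real p > 2" using that by (simp add: odd_primes_upto_def)
      then show ?thesis by simp
    qed
  qed
  then show ?thesis
    using twin_prime_const_pos by (simp add: singular_series_altdef)
qed

lemma singular_series_truncated_eq:
  assumes "e > 0" "e \<le> N"
  shows "singular_series (2 * e) = 2 * twin_prime_const * truncated_series N e"
proof -
  have "{p. prime p \<and> p dvd 2 * e \<and> p > 2} = {p\<in>odd_primes_upto N. p dvd e}"
    using assms by (auto simp: odd_primes_upto_def odd_prime_dvd_double_iff intro: order_trans[OF dvd_imp_le[of _ e]])
  then show ?thesis
    by (simp add: singular_series_altdef truncated_series_altdef)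
qed

definition even_singular_series :: "nat \<Rightarrow> real" where
  "even_singular_series d = (if even d \<and> 2 \<le> d then singular_series d else 0)"

lemma even_singular_series_nonneg: "even_singular_series d \<ge> 0"
  using singular_series_pos[of d] by (simp add: even_singular_series_def)

lemma even_singular_series_sum:
  "(\<Sum>d\<le>n. even_singular_series d) = (\<Sum>e=1..n div 2. singular_series (2 * e))"
proof -
  have "(\<Sum>d\<le>n. even_singular_series d) = (\<Sum>d | d \<le> n \<and> even d \<and> 2 \<le> d. singular_series d)"
    unfolding even_singular_series_def by (rule sum.mono_neutral_cong_right) auto
  also have "\<dots> = (\<Sum>e=1..n div 2. singular_series (2 * e))"
    by (rule sum.reindex_bij_witness[of _ "\<lambda>e. 2 * e" "\<lambda>d. d div 2"]) auto
  finally show ?thesis .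
qed

text \<open>There is no error term: truncation at n div 2 is exact for the divisors that occur,
  floors round down, and the partial products lie above \<open>twin_prime_const\<close>.\<close>

lemma even_singular_series_sum_le: "(\<Sum>d\<le>n. even_singular_series d) \<le> real n"
proof -
  let ?M = "n div 2"
  have "(\<Sum>d\<le>n. even_singular_series d) = 2 * twin_prime_const * (\<Sum>e=1..?M. truncated_series ?M e)"
    unfolding even_singular_series_sum sum_distrib_left
    by (intro sum.cong refl singular_series_truncated_eq) auto
  also have "\<dots> \<le> 2 * twin_prime_const * (real ?M / (\<Prod>p\<le>?M. twin_prime_factor p))"
    using twin_prime_const_pos by (intro mult_left_mono truncated_series_sum_upper) auto
  also have "\<dots> \<le> 2 * twin_prime_const * (real ?M / twin_prime_const)"
    using twin_prime_const_pos twin_prime_const_le[of ?M]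
    by (intro mult_left_mono divide_left_mono mult_pos_pos) auto
  also have "\<dots> = 2 * real ?M" using twin_prime_const_pos by simp
  also have "\<dots> \<le> real n" by linarith
  finally show ?thesis .
qed

text \<open>For the lower bound the primes are cut off at a fixed N whose partial product is close
  to \<open>twin_prime_const\<close>; the omitted factors are at least 1, and the loss K no longer
  depends on n.\<close>

lemma even_singular_series_sum_asymp_equiv:
  "(\<lambda>n. \<Sum>d\<le>n. even_singular_series d) \<sim>[sequentially] real"
proof (subst asymp_equiv_at_top_iff)
  show "\<forall>\<^sub>F n in sequentially. 0 < real n"
    using eventually_gt_at_top[of 0] by eventually_elim simp
  show "\<forall>e>0. e < 1 \<longrightarrow> (\<forall>\<^sub>F n in sequentially. (1 - e) * real n \<le> sum even_singular_series {..n} \<and>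
          sum even_singular_series {..n} \<le> (1 + e) * real n)"
  proof (intro allI impI)
    fix e :: real assume e: "e > 0" "e < 1"
    let ?P = "\<lambda>N. \<Prod>p\<le>N. twin_prime_factor p"
    have "(\<lambda>N. twin_prime_const / ?P N) \<longlonglongrightarrow> twin_prime_const / twin_prime_const"
      using twin_prime_const_pos
      by (intro tendsto_divide tendsto_const twin_prime_partial_products_LIMSEQ) auto
    then have "\<forall>\<^sub>F N in sequentially. twin_prime_const / ?P N > 1 - e / 2"
      using twin_prime_const_pos e by (intro order_tendstoD(1)) auto
    then obtain N where N: "twin_prime_const / ?P N > 1 - e / 2"
      by (auto simp: eventually_sequentially)
    obtain K where K: "\<And>M. (\<Sum>e=1..M. truncated_series N e) \<ge> real M / ?P N - K"
      using truncated_series_sum_lower by blast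
    define K' where "K' = 2 * twin_prime_const * K"
    have lower: "(1 - e / 2) * (real n - 1) - K' \<le> sum even_singular_series {..n}" for n
    proof -
      let ?M = "n div 2"
      have "(1 - e / 2) * (real n - 1) \<le> (1 - e / 2) * (2 * real ?M)"
        using e by (intro mult_left_mono) linarith+
      also have "\<dots> \<le> twin_prime_const / ?P N * (2 * real ?M)"
        using N by (intro mult_right_mono) auto
      finally have "(1 - e / 2) * (real n - 1) - K' \<le> 2 * twin_prime_const * (real ?M / ?P N - K)"
        by (simp add: K'_def algebra_simps)
      also have "\<dots> \<le> 2 * twin_prime_const * (\<Sum>e=1..?M. truncated_series N e)"
        using twin_prime_const_pos by (intro mult_left_mono K) auto
      also have "\<dots> \<le> sum even_singular_series {..n}"
        unfolding even_singular_series_sum sum_distrib_left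
        by (intro sum_mono singular_series_truncated_le) auto
      finally show ?thesis .
    qed
    have "\<forall>\<^sub>F n in sequentially. (1 - e) * real n \<le> (1 - e / 2) * (real n - 1) - K'"
      using e by real_asymp
    then show "\<forall>\<^sub>F n in sequentially. (1 - e) * real n \<le> sum even_singular_series {..n} \<and>
          sum even_singular_series {..n} \<le> (1 + e) * real n"
    proof eventually_elim
      case (elim n)
      have "real n \<le> (1 + e) * real n" using e by (simp add: algebra_simps)
      with elim lower[of n] even_singular_series_sum_le[of n] show ?case by linarith
    qed
  qed
qed

section \<open>Second moments\<close>

text \<open>Subtraction on \<open>nat\<close> makes h - (q - p) vanish for pairs at distance h or
  more, so all pairs may be included.\<close>

lemma sum_pairs_by_difference:
  fixes P :: "nat set" and h :: nat
  assumes "finite P"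
  shows "(\<Sum>p\<in>P. \<Sum>q | q \<in> P \<and> p < q. h - (q - p)) =
         (\<Sum>d\<in>{1..<h}. (h - d) * card {p\<in>P. p + d \<in> P})"
proof -
  have "(\<Sum>q | q \<in> P \<and> p < q. h - (q - p)) = (\<Sum>d\<in>{1..<h}. if p + d \<in> P then h - d else 0)" for p
  proof -
    have "(\<Sum>q | q \<in> P \<and> p < q. h - (q - p)) = (\<Sum>q | q \<in> P \<and> p < q \<and> q < p + h. h - (q - p))"
      using assms by (intro sum.mono_neutral_right) auto
    also have "\<dots> = (\<Sum>d | d \<in> {1..<h} \<and> p + d \<in> P. h - d)"
      by (rule sum.reindex_bij_witness[of _ "\<lambda>d. p + d" "\<lambda>q. q - p"]) auto
    also have "\<dots> = (\<Sum>d\<in>{1..<h}. if p + d \<in> P then h - d else 0)"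
      by (rule sum.inter_filter) simp
    finally show ?thesis .
  qed
  then have "(\<Sum>p\<in>P. \<Sum>q | q \<in> P \<and> p < q. h - (q - p)) =
      (\<Sum>d\<in>{1..<h}. \<Sum>p\<in>P. if p + d \<in> P then h - d else 0)"
    by (simp add: sum.swap[of _ _ P])
  also have "\<dots> = (\<Sum>d\<in>{1..<h}. (h - d) * card {p\<in>P. p + d \<in> P})"
    by (intro sum.cong refl) (simp add: assms sum.inter_filter [symmetric] mult.commute)
  finally show ?thesis .
qed

text \<open>Cauchy--Schwarz for the number of elements of \<open>P\<close> in windows of length \<open>h\<close>.\<close>

lemma card_square_le_pair_differences:
  fixes P :: "nat set" and h N :: nat
  assumes P: "P \<subseteq> {..N}"
  shows "(real h * real (card P))\<^sup>2 \<le> real (N + h) * (real h * real (card P)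
           + 2 * (\<Sum>d\<in>{1..<h}. real (h - d) * real (card {p\<in>P. p + d \<in> P})))"
proof -
  have fin: "finite P" using P by (rule finite_subset) simp
  \<comment> \<open>\<open>c m\<close> counts the elements of P in the window from m - h + 1 to m.
    Letting m run up to N + h - 1 gives every element exactly h windows, and every pair h - |p - q|
    common ones.\<close>
  define w :: "nat \<Rightarrow> nat \<Rightarrow> nat" where "w p m = (if p \<le> m \<and> m < p + h then 1 else 0)" for p m
  define c where "c m = (\<Sum>p\<in>P. w p m)" for m
  let ?W = "{..<N + h}"
  have overlap: "(\<Sum>m\<in>?W. w p m * w q m) = h - (max p q - min p q)" if "p \<in> P" "q \<in> P" for p q
  proof -
    have "(\<Sum>m\<in>?W. w p m * w q m) = (\<Sum>m\<in>?W. if max p q \<le> m \<and> m < min p q + h then 1 else 0)"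
      by (intro sum.cong refl) (auto simp: w_def)
    also have "\<dots> = card {m\<in>?W. max p q \<le> m \<and> m < min p q + h}"
      by (simp add: sum.inter_filter [symmetric])
    also have "{m\<in>?W. max p q \<le> m \<and> m < min p q + h} = {max p q..<min p q + h}"
    proof -
      have "p \<le> N" using P that by auto
      then show ?thesis by auto
    qed
    finally show ?thesis by auto
  qed
  have first: "(\<Sum>m\<in>?W. c m) = h * card P"
  proof -
    have "(\<Sum>m\<in>?W. c m) = (\<Sum>p\<in>P. \<Sum>m\<in>?W. w p m * w p m)"
      unfolding c_def by (subst sum.swap) (simp add: w_def if_distrib cong: if_cong)
    also have "\<dots> = (\<Sum>p\<in>P. h)" using overlap by (intro sum.cong refl) simp
    finally show ?thesis by simp
  qed
  have split: "(\<Sum>q\<in>P. g q) = g p + (\<Sum>q | q \<in> P \<and> p < q. g q) + (\<Sum>q | q \<in> P \<and> q < p. g q)"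
    if "p \<in> P" for g :: "nat \<Rightarrow> nat" and p
  proof -
    have "P = {p} \<union> ({q\<in>P. p < q} \<union> {q\<in>P. q < p})" using that by auto
    then have "sum g P = sum g ({p} \<union> ({q\<in>P. p < q} \<union> {q\<in>P. q < p}))" by simp
    also have "\<dots> = sum g {p} + (sum g {q\<in>P. p < q} + sum g {q\<in>P. q < p})"
      using fin by (subst sum.union_disjoint; (subst sum.union_disjoint)?) auto
    finally show ?thesis by simp
  qed
  have second: "(\<Sum>m\<in>?W. c m ^ 2) = h * card P + 2 * (\<Sum>d\<in>{1..<h}. (h - d) * card {p\<in>P. p + d \<in> P})"
  proof -
    have "(\<Sum>m\<in>?W. c m ^ 2) = (\<Sum>m\<in>?W. \<Sum>p\<in>P. \<Sum>q\<in>P. w p m * w q m)"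
      by (simp add: c_def power2_eq_square sum_product)
    also have "\<dots> = (\<Sum>p\<in>P. \<Sum>q\<in>P. \<Sum>m\<in>?W. w p m * w q m)"
      by (subst sum.swap) (intro sum.cong refl sum.swap)
    also have "\<dots> = (\<Sum>p\<in>P. \<Sum>q\<in>P. h - (max p q - min p q))"
      by (intro sum.cong refl overlap)
    also have "\<dots> = (\<Sum>p\<in>P. h + (\<Sum>q | q \<in> P \<and> p < q. h - (q - p)) + (\<Sum>q | q \<in> P \<and> q < p. h - (p - q)))"
      by (intro sum.cong refl, subst split) (auto intro!: arg_cong2[where f = "(+)"] sum.cong)
    also have "\<dots> = h * card P + (\<Sum>p\<in>P. \<Sum>q | q \<in> P \<and> p < q. h - (q - p))
                    + (\<Sum>p\<in>P. \<Sum>q | q \<in> P \<and> q < p. h - (p - q))"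
      by (simp add: sum.distrib)
    also have "(\<Sum>p\<in>P. \<Sum>q | q \<in> P \<and> q < p. h - (p - q)) = (\<Sum>p\<in>P. \<Sum>q | q \<in> P \<and> p < q. h - (q - p))"
      using fin by (rule sum.swap_restrict) (rule fin)
    finally show ?thesis
      unfolding sum_pairs_by_difference[OF fin] by simp
  qed
  have "(\<Sum>m\<in>?W. real (c m) * 1)\<^sup>2 \<le> (\<Sum>m\<in>?W. (real (c m))\<^sup>2) * (\<Sum>m\<in>?W. 1\<^sup>2)"
    by (rule Cauchy_Schwarz_ineq_sum)
  also have "(\<Sum>m\<in>?W. real (c m) * 1) = real (h * card P)"
    by (simp flip: first)
  also have "(\<Sum>m\<in>?W. (real (c m))\<^sup>2) = real (\<Sum>m\<in>?W. c m ^ 2)" by simp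
  finally show ?thesis
    unfolding second by (simp add: mult.commute)
qed

section \<open>The Moebius function\<close>

definition mobius :: "nat \<Rightarrow> real" where
  "mobius n = (if squarefree n then (- 1) ^ card (prime_factors n) else 0)"

lemma abs_mobius_le_1: "\<bar>mobius n\<bar> \<le> 1"
  by (simp add: mobius_def power_abs)

lemma prime_factors_prod_primes:
  fixes D :: "nat set"
  assumes "finite D" "\<And>p. p \<in> D \<Longrightarrow> prime p"
  shows "prime_factors (\<Prod>D) = D"
proof -
  have nz: "\<Prod>D \<noteq> 0" using assms prod_zero_iff[of D "\<lambda>p. p"] not_prime_0 by metis
  have "p \<in> D" if p: "prime p" "p dvd \<Prod>D" for p
  proof -
    obtain q where "q \<in> D" "p dvd q"
      using p assms prime_dvd_prod_iff[of D p "\<lambda>x. x"] by auto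
    then show ?thesis using assms(2)[of q] \<open>prime p\<close> primes_dvd_imp_eq[of p q] by auto
  qed
  moreover have "p dvd \<Prod>D" if "p \<in> D" for p
    using that assms by (auto intro: dvd_prod_eqI)
  ultimately show ?thesis
    using assms(2) nz by (auto simp: prime_factors_dvd)
qed

text \<open>Squarefree divisors correspond to sets of prime factors, so the sum is the expansion of
  the product of 1 - 1 over the primes dividing n.\<close>

lemma mobius_sum:
  assumes "n > 0"
  shows "(\<Sum>d | d dvd n. mobius d) = (if n = 1 then 1 else 0)"
proof -
  let ?P = "prime_factors n"
  have fin: "finite {d. d dvd n}" using assms by simp
  have "(\<Sum>d | d dvd n. mobius d) = (\<Sum>d | d dvd n \<and> squarefree d. (- 1) ^ card (prime_factors d))"
    unfolding mobius_def using fin by (intro sum.mono_neutral_cong_right) auto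
  also have "\<dots> = (\<Sum>D\<in>Pow ?P. (- 1) ^ card D)"
  proof (rule sum.reindex_bij_witness[of _ "\<lambda>D. \<Prod>D" prime_factors])
    fix d assume "d \<in> {d. d dvd n \<and> squarefree d}"
    then have d: "d dvd n" "squarefree d" by auto
    then have "d \<noteq> 0" using assms by auto
    have "d = (\<Prod>p\<in>prime_factors d. p ^ multiplicity p d)"
      using \<open>d \<noteq> 0\<close> by (intro prime_factorization_nat) auto
    also have "\<dots> = (\<Prod>p\<in>prime_factors d. p)"
      using d \<open>d \<noteq> 0\<close> squarefree_factorial_semiring'[of d] by (intro prod.cong refl) auto
    finally show "\<Prod>(prime_factors d) = d" ..
    show "prime_factors d \<in> Pow ?P"
      using d assms by (auto simp: prime_factors_dvd intro: dvd_trans)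
  next
    fix D assume "D \<in> Pow ?P"
    then have D: "D \<subseteq> ?P" "finite D" by (auto intro: finite_subset)
    then have prime: "\<And>p. p \<in> D \<Longrightarrow> prime p" by (auto simp: prime_factors_dvd)
    show "prime_factors (\<Prod>D) = D"
      using D prime by (intro prime_factors_prod_primes) auto
    have "\<Prod>D dvd n"
      using D prime by (subst prod_primes_dvd_iff) (auto simp: prime_factors_dvd)
    moreover have "squarefree (\<Prod>D)"
      using D prime by (intro squarefree_prod_coprime) (auto intro: primes_coprime squarefree_prime)
    ultimately show "\<Prod>D \<in> {d. d dvd n \<and> squarefree d}" by simp
  qed auto
  also have "\<dots> = (\<Prod>p\<in>?P. 1 - 1)"
    by (subst prod_diff_conv_sum) auto
  also have "\<dots> = (if n = 1 then 1 else 0)"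
    using assms prime_factorization_empty_iff[of n] by (auto simp: power_0_left)
  finally show ?thesis .
qed

text \<open>Both sides run over the pairs with d * e dividing n.\<close>

lemma sum_divisors_swap:
  fixes f :: "nat \<Rightarrow> nat \<Rightarrow> real"
  assumes "n > 0"
  shows "(\<Sum>d | d dvd n. \<Sum>e | e dvd n div d. f d e) = (\<Sum>e | e dvd n. \<Sum>d | d dvd n div e. f d e)"
proof -
  have fin: "finite {d. d dvd m}" if "m > 0" for m :: nat using that by simp
  have *: "d dvd n \<and> e dvd n div d \<longleftrightarrow> d * e dvd n" if "d > 0" for d e :: nat
    using that by (metis dvd_mult_left dvd_div_iff_mult mult.commute not_gr_zero)
  have "(\<Sum>d | d dvd n. \<Sum>e | e dvd n div d. f d e) = (\<Sum>d\<in>{d. d dvd n}. \<Sum>e\<in>{e\<in>{e. e dvd n}. d * e dvd n}. f d e)"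
  proof (intro sum.cong refl)
    fix d assume "d \<in> {d. d dvd n}"
    then have "d dvd n" "d > 0" using assms by (auto intro: Nat.gr0I)
    then show "{e. e dvd n div d} = {e\<in>{e. e dvd n}. d * e dvd n}"
      using * by (auto dest: dvd_mult_right)
  qed
  also have "\<dots> = (\<Sum>e\<in>{e. e dvd n}. \<Sum>d\<in>{d\<in>{d. d dvd n}. d * e dvd n}. f d e)"
    using assms by (intro sum.swap_restrict fin)
  also have "\<dots> = (\<Sum>e | e dvd n. \<Sum>d | d dvd n div e. f d e)"
  proof (intro sum.cong refl)
    fix e assume "e \<in> {e. e dvd n}"
    then have "e dvd n" "e > 0" using assms by (auto intro: Nat.gr0I)
    then show "{d\<in>{d. d dvd n}. d * e dvd n} = {d. d dvd n div e}"
      using *[of e] by (auto simp: mult.commute dest: dvd_mult_right)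
  qed
  finally show ?thesis .
qed

text \<open>Inverting ln n as the divisor sum of \<open>mangoldt\<close> gives the sum of mobius d *
  ln (n / d). After splitting ln (n / d), the part with ln n vanishes: for n > 1 because the mobius
  sum is 0, for n = 1 because ln 1 is.\<close>

lemma mobius_ln_sum:
  assumes "n > 0"
  shows "(\<Sum>d | d dvd n. mobius d * ln (real d)) = - mangoldt n"
proof -
  have "(\<Sum>d | d dvd n. mobius d * ln (real (n div d))) =
      (\<Sum>d | d dvd n. \<Sum>e | e dvd n div d. mobius d * mangoldt e)"
  proof (intro sum.cong refl)
    fix d assume "d \<in> {d. d dvd n}"
    then have "n div d \<noteq> 0" using assms by (auto elim!: dvdE)
    then show "mobius d * ln (real (n div d)) = (\<Sum>e | e dvd n div d. mobius d * mangoldt e)"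
      using mangoldt_sum[of "n div d", where 'a = real] by (simp add: sum_distrib_left [symmetric])
  qed
  also have "\<dots> = (\<Sum>e | e dvd n. \<Sum>d | d dvd n div e. mobius d * mangoldt e)"
    by (rule sum_divisors_swap[OF assms])
  also have "\<dots> = (\<Sum>e | e dvd n. if e = n then mangoldt e else 0)"
  proof (intro sum.cong refl)
    fix e assume "e \<in> {e. e dvd n}"
    then obtain k where k: "n = e * k" by (auto elim: dvdE)
    then have "e > 0" "k > 0" using assms by auto
    then show "(\<Sum>d | d dvd n div e. mobius d * mangoldt e) = (if e = n then mangoldt e else 0)"
      using k mobius_sum[of k] by (auto simp: sum_distrib_right [symmetric])
  qed
  also have "\<dots> = mangoldt n" using assms by simp
  finally have eq: "(\<Sum>d | d dvd n. mobius d * ln (real (n div d))) = mangoldt n" .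
  have "(\<Sum>d | d dvd n. mobius d * ln (real (n div d))) =
      (\<Sum>d | d dvd n. ln (real n) * mobius d - mobius d * ln (real d))"
  proof (intro sum.cong refl)
    fix d assume "d \<in> {d. d dvd n}"
    then obtain k where "n = d * k" by (auto elim: dvdE)
    then show "mobius d * ln (real (n div d)) = ln (real n) * mobius d - mobius d * ln (real d)"
      using assms by (auto simp: ln_mult algebra_simps)
  qed
  also have "\<dots> = ln (real n) * (\<Sum>d | d dvd n. mobius d) - (\<Sum>d | d dvd n. mobius d * ln (real d))"
    by (simp add: sum_subtractf sum_distrib_left)
  also have "ln (real n) * (\<Sum>d | d dvd n. mobius d) = 0"
    using mobius_sum[OF assms] by auto
  finally show ?thesis using eq by simp
qed

section \<open>Selberg's symmetry formula\<close>

definition psi :: "nat \<Rightarrow> real" where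
  "psi N = (\<Sum>n=1..N. mangoldt n)"

definition prime_count :: "nat \<Rightarrow> nat" where
  "prime_count N = card {p. prime p \<and> p \<le> N}"

lemma finite_primes_upto [simp]: "finite {p::nat. prime p \<and> p \<le> N}"
  by (rule finite_subset[of _ "{..N}"]) auto

lemma psi_nonneg: "psi N \<ge> 0"
  unfolding psi_def by (intro sum_nonneg mangoldt_nonneg)

text \<open>A prime p has at most ln N / ln p powers up to N, each of weight ln p, hence contributes
  at most ln N in total.\<close>

lemma psi_le_prime_count:
  assumes "N \<ge> 1"
  shows "psi N \<le> real (prime_count N) * ln (real N)"
proof -
  let ?P = "{p::nat. prime p \<and> p \<le> N}"
  let ?S = "{n\<in>{1..N}. primepow n}"
  have "psi N = (\<Sum>n\<in>?S. ln (real (aprimedivisor n)))"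
    unfolding psi_def by (rule sum.mono_neutral_cong_right) (auto simp: mangoldt_def)
  also have "\<dots> = (\<Sum>p\<in>?P. \<Sum>n | n \<in> ?S \<and> aprimedivisor n = p. ln (real (aprimedivisor n)))"
  proof (rule sum.group [symmetric])
    show "aprimedivisor ` ?S \<subseteq> ?P"
    proof safe
      fix n :: nat assume n: "n \<in> {1..N}" "primepow n"
      then have "n > 1" using primepow_gt_Suc_0[of n] by simp
      then show "prime (aprimedivisor n)" by (intro prime_aprimedivisor') auto
      have "aprimedivisor n \<le> n" using \<open>n > 1\<close> by (intro aprimedivisor_le_nat) auto
      with n show "aprimedivisor n \<le> N" by simp
    qed
  qed auto
  also have "\<dots> \<le> (\<Sum>p\<in>?P. ln (real N))"
  proof (rule sum_mono)
    fix p assume "p \<in> ?P"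
    then have p: "prime p" "p \<le> N" by auto
    then have lnp: "ln (real p) > 0" using prime_gt_1_nat[of p] by simp
    define K where "K = nat \<lfloor>ln (real N) / ln (real p)\<rfloor>"
    let ?F = "{n. n \<in> ?S \<and> aprimedivisor n = p}"
    have "?F \<subseteq> (\<lambda>k. p ^ k) ` {1..K}"
    proof
      fix n assume n: "n \<in> ?F"
      then have "primepow n" "n \<le> N" "aprimedivisor n = p" by auto
      then obtain k where k: "n = p ^ k" "k > 0"
        unfolding primepow_def using aprimedivisor_prime_power by metis
      have "real k * ln (real p) = ln (real n)" using k p by (simp add: ln_realpow prime_gt_0_nat)
      also have "\<dots> \<le> ln (real N)" using n \<open>n \<le> N\<close> by simp
      finally have "real k \<le> ln (real N) / ln (real p)" using lnp by (simp add: field_simps)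
      then have "k \<le> K" unfolding K_def by (simp add: le_nat_floor)
      with k show "n \<in> (\<lambda>k. p ^ k) ` {1..K}" by auto
    qed
    then have "card ?F \<le> card ((\<lambda>k. p ^ k) ` {1..K})" by (intro card_mono) auto
    also have "\<dots> \<le> K" using card_image_le[of "{1..K}" "\<lambda>k. p ^ k"] by simp
    finally have "real (card ?F) * ln (real p) \<le> real K * ln (real p)"
      using lnp by (intro mult_right_mono) auto
    also have "\<dots> \<le> ln (real N) / ln (real p) * ln (real p)"
      unfolding K_def using lnp assms by (intro mult_right_mono of_nat_floor) auto
    finally show "(\<Sum>n\<in>?F. ln (real (aprimedivisor n))) \<le> ln (real N)"
      using lnp by simp
  qed
  finally show ?thesis by (simp add: prime_count_def)
qed

section \<open>Sums over divisors, Stirling's formula and harmonic numbers\<close>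

lemma sum_divisors_upto:
  fixes f :: "nat \<Rightarrow> nat \<Rightarrow> real"
  shows "(\<Sum>m=1..N. \<Sum>d | d dvd m. f d (m div d)) = (\<Sum>d=1..N. \<Sum>k=1..N div d. f d k)"
proof -
  have "(\<Sum>m=1..N. \<Sum>d | d dvd m. f d (m div d)) = (\<Sum>(m, d)\<in>(SIGMA m:{1..N}. {d. d dvd m}). f d (m div d))"
    by (rule sum.Sigma) auto
  also have "\<dots> = (\<Sum>(d, k)\<in>(SIGMA d:{1..N}. {1..N div d}). f d k)"
  proof (rule sum.reindex_bij_betw[of "\<lambda>(d, k). (d * k, d)", symmetric, THEN trans])
    show "bij_betw (\<lambda>(d, k). (d * k, d)) (SIGMA d:{1..N}. {1..N div d}) (SIGMA m:{1..N}. {d. d dvd m})"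
      unfolding bij_betw_def
    proof
      show "inj_on (\<lambda>(d, k). (d * k, d)) (SIGMA d:{1..N}. {1..N div d})"
        by (auto simp: inj_on_def)
      show "(\<lambda>(d, k). (d * k, d)) ` (SIGMA d:{1..N}. {1..N div d}) = (SIGMA m:{1..N}. {d. d dvd m})"
      proof (intro equalityI subsetI)
        fix x assume "x \<in> (\<lambda>(d, k). (d * k, d)) ` (SIGMA d:{1..N}. {1..N div d})"
        then obtain d k where x: "x = (d * k, d)" "d \<ge> 1" "k \<ge> 1" "k \<le> N div d" by auto
        have "d * k \<le> N"
          using mult_le_mono2[OF x(4), of d] times_div_less_eq_dividend[of d N] by (rule order_trans)
        moreover have "d * k \<ge> 1" using mult_le_mono[OF x(2,3)] by simp
        ultimately show "x \<in> (SIGMA m:{1..N}. {d. d dvd m})" using x(1) by simp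
      next
        fix x assume "x \<in> (SIGMA m:{1..N}. {d. d dvd m})"
        then obtain d k where x: "x = (d * k, d)" "d * k \<ge> 1" "d * k \<le> N" by (auto elim!: dvdE)
        then have dk: "d \<ge> 1" "k \<ge> 1" by (auto intro!: Suc_leI Nat.gr0I)
        have "d * 1 \<le> d * k" using dk(2) by (rule mult_le_mono2)
        then have "d \<le> N" using x(3) by linarith
        moreover have "k \<le> N div d" using div_le_mono[OF x(3), of d] dk(1) by simp
        ultimately show "x \<in> (\<lambda>(d, k). (d * k, d)) ` (SIGMA d:{1..N}. {1..N div d})"
          using x(1) dk by (intro image_eqI[of _ _ "(d, k)"]) auto
      qed
    qed
    show "(\<Sum>x\<in>(SIGMA d:{1..N}. {1..N div d}).
            case (case x of (d, k) \<Rightarrow> (d * k, d)) of (m, d) \<Rightarrow> f d (m div d)) =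
          (\<Sum>(d, k)\<in>(SIGMA d:{1..N}. {1..N div d}). f d k)"
      by (intro sum.cong refl) auto
  qed
  also have "\<dots> = (\<Sum>d=1..N. \<Sum>k=1..N div d. f d k)"
    by (rule sum.Sigma [symmetric]) auto
  finally show ?thesis .
qed

lemma sum_hyperbola_swap:
  fixes f :: "nat \<Rightarrow> nat \<Rightarrow> real"
  shows "(\<Sum>d=1..N. \<Sum>k=1..N div d. f d k) = (\<Sum>k=1..N. \<Sum>d=1..N div k. f d k)"
proof -
  have *: "{1..N div d} = {k\<in>{1..N}. d * k \<le> N}" if "d \<in> {1..N}" for d
  proof (rule Set.set_eqI)
    fix k
    have d: "d > 0" using that by simp
    have "k \<le> N div d \<longleftrightarrow> d * k \<le> N"
      using less_eq_div_iff_mult_less_eq[OF d, of k N] by (simp only: mult.commute)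
    moreover have "k \<le> N" if "d * k \<le> N"
      using mult_le_mono1[of 1 d k] d that by linarith
    ultimately show "k \<in> {1..N div d} \<longleftrightarrow> k \<in> {k\<in>{1..N}. d * k \<le> N}" by auto
  qed
  have "(\<Sum>d=1..N. \<Sum>k=1..N div d. f d k) = (\<Sum>d=1..N. \<Sum>k\<in>{k\<in>{1..N}. d * k \<le> N}. f d k)"
    by (intro sum.cong refl *)
  also have "\<dots> = (\<Sum>k=1..N. \<Sum>d\<in>{d\<in>{1..N}. d * k \<le> N}. f d k)"
    by (rule sum.swap_restrict) auto
  also have "\<dots> = (\<Sum>k=1..N. \<Sum>d=1..N div k. f d k)"
    using * by (intro sum.cong refl) (simp only: mult.commute)
  finally show ?thesis .
qed

text \<open>Chebyshev's identity, from ln m as a divisor sum of \<open>mangoldt\<close>.\<close>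

lemma sum_mangoldt_div: "(\<Sum>d=1..N. mangoldt d * real (N div d)) = ln (fact N)"
proof -
  have "ln (fact N) = (\<Sum>m=1..N. ln (real m))"
    unfolding fact_prod of_nat_prod by (subst ln_prod) auto
  also have "\<dots> = (\<Sum>m=1..N. \<Sum>d | d dvd m. mangoldt d)"
    by (intro sum.cong refl) (simp add: mangoldt_sum)
  also have "\<dots> = (\<Sum>d=1..N. mangoldt d * real (N div d))"
    by (subst sum_divisors_upto[where f = "\<lambda>d _. mangoldt d"]) (simp add: mult.commute)
  finally show ?thesis ..
qed

lemma sum_psi_div: "(\<Sum>n=1..N. psi (N div n)) = ln (fact N)"
proof -
  have "(\<Sum>n=1..N. psi (N div n)) = (\<Sum>d=1..N. \<Sum>k=1..N div d. mangoldt d)"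
    unfolding psi_def by (rule sum_hyperbola_swap [symmetric])
  then show ?thesis
    by (simp add: sum_mangoldt_div [symmetric] mult.commute)
qed

lemma ln_Suc_diff:
  assumes "K \<ge> 1"
  shows "ln (real K + 1) - ln (real K) \<le> 1 / real K"
    and "ln (real K + 1) - ln (real K) \<ge> 1 / (real K + 1)"
proof -
  have K: "real K > 0" using assms by simp
  have "(real K + 1) / real K = 1 + 1 / real K" using K by (simp add: field_simps)
  then have "ln (real K + 1) - ln (real K) = ln (1 + 1 / real K)"
    using K ln_div[of "real K + 1" "real K"] by simp
  also have "\<dots> \<le> 1 / real K" using K by (intro ln_add_one_self_le_self) simp
  finally show "ln (real K + 1) - ln (real K) \<le> 1 / real K" .
  have "real K / (real K + 1) = 1 - 1 / (real K + 1)" using K by (simp add: field_simps)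
  then have "ln (real K) - ln (real K + 1) = ln (1 - 1 / (real K + 1))"
    using K ln_div[of "real K" "real K + 1"] by simp
  also have "\<dots> \<le> - (1 / (real K + 1))"
    using K ln_le_minus_one[of "1 - 1 / (real K + 1)"] by simp
  finally show "ln (real K + 1) - ln (real K) \<ge> 1 / (real K + 1)" by linarith
qed

text \<open>The increment of K ln K - K from K to K + 1 lies between ln K and ln (K + 1), which
  accounts for the distance ln K between the two bounds.\<close>

lemma ln_fact_bounds:
  assumes "K \<ge> 1"
  shows "real K * ln K - K \<le> ln (fact K)" "ln (fact K) \<le> real K * ln K - K + 1 + ln K"
proof -
  have "real K * ln K - K + 1 \<le> ln (fact K) \<and> ln (fact K) \<le> real K * ln K - K + 1 + ln K"
    using assms
  proof (induction K rule: dec_induct)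
    case (step K)
    define a where "a = ln (real (Suc K)) - ln (real K)"
    have K: "real K > 0" using step by simp
    have upper: "real K * a \<le> 1" and lower: "real (Suc K) * a \<ge> 1"
      using ln_Suc_diff[of K] step K by (simp_all add: a_def field_simps)
    have fact: "ln (fact (Suc K)) = ln (real (Suc K)) + ln (fact K)"
      using K by (simp add: ln_mult)
    have "real (Suc K) * ln (real (Suc K)) = real K * ln (real K) + real K * a + ln (real (Suc K))"
      by (simp add: a_def algebra_simps)
    moreover have "real (Suc K) * a = real K * a + ln (real (Suc K)) - ln (real K)"
      by (simp add: a_def algebra_simps)
    ultimately show ?case
      using step.IH upper lower fact by (simp only: of_nat_Suc [of K]) linarith
  qed simp
  then show "real K * ln K - K \<le> ln (fact K)" "ln (fact K) \<le> real K * ln K - K + 1 + ln K"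
    by auto
qed

lemma harm_approx:
  assumes "K \<ge> 1"
  shows "\<bar>harm K - ln (real K) - euler_mascheroni\<bar> \<le> 1 / real K"
proof -
  obtain n where n: "K = Suc n" using assms by (cases K) auto
  have K: "real K > 0" using assms by simp
  have "harm K - ln (real K + 1) + 1 / (2 * (real K + 1)) \<le> euler_mascheroni"
    using euler_mascheroni_lower[of n] by (simp add: n add_ac)
  moreover have "euler_mascheroni \<le> harm K - ln (real K + 1) + 1 / (2 * real K)"
    using euler_mascheroni_upper[of n] by (simp add: n add_ac)
  moreover have "ln (real K + 1) - ln (real K) \<le> 1 / real K"
    using assms by (rule ln_Suc_diff)
  moreover have "ln (real K + 1) \<ge> ln (real K)" using K by simp
  moreover have "1 / (2 * (real K + 1)) \<ge> 0" "1 / (2 * real K) \<le> 1 / real K" using K by (auto simp: field_simps)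
  ultimately show ?thesis by linarith
qed

text \<open>
  The constant makes the main terms of \<open>\<Sum>n\<le>K. psi_error N (d * n)\<close>, where \<open>K = N div d\<close>, cancel.
\<close>

definition psi_error :: "nat \<Rightarrow> nat \<Rightarrow> real" where
  "psi_error N m = psi (N div m) - real N / real m + (euler_mascheroni + 1)"

text \<open>With K = N div d the sum is ln (K!) - y H_K + (\<gamma> + 1) K, where H_K is the
  harmonic number. By Stirling and H_K = ln K + \<gamma> + O(1 / K) the main terms collapse to (K -
  y) (ln K + \<gamma>), and K is within 1 of y, so only a logarithm remains.\<close>

lemma sum_psi_error_bound:
  assumes d: "1 \<le> d" "d \<le> N"
  defines "y \<equiv> real N / real d"
  shows "\<bar>\<Sum>n=1..N div d. psi_error N (d * n)\<bar> \<le> 2 * ln y + 5"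
proof -
  define K where "K = N div d"
  have K1: "K \<ge> 1" using d by (simp add: K_def div_greater_zero_iff Suc_le_eq)
  have yK: "real K \<le> y" "y < real K + 1"
    using floor_divide_of_nat_eq[where 'a = real, of N d] floor_correct[of y]
    unfolding y_def K_def by linarith+
  have K0: "real K > 0" using K1 by simp
  define e1 where "e1 = ln (fact K) - (real K * ln K - K)"
  define e2 where "e2 = harm K - ln (real K) - euler_mascheroni"
  have e1: "0 \<le> e1" "e1 \<le> 1 + ln K" using ln_fact_bounds[OF K1] by (auto simp: e1_def)
  have e2: "\<bar>e2\<bar> \<le> 1 / real K" using harm_approx[OF K1] by (simp add: e2_def)
  have gamma: "0 < (euler_mascheroni::real)" "(euler_mascheroni::real) < 1"
    using euler_mascheroni_pos euler_mascheroni_less_13_over_22 by auto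
  have "(\<Sum>n=1..K. psi_error N (d * n)) = (\<Sum>n=1..K. psi (K div n) - y * inverse (real n) + (euler_mascheroni + 1))"
    by (intro sum.cong refl) (simp add: psi_error_def K_def y_def div_mult2_eq[of N d] divide_inverse)
  also have "\<dots> = ln (fact K) - y * harm K + (euler_mascheroni + 1) * K"
    by (simp add: sum.distrib sum_subtractf sum_psi_div harm_def sum_distrib_left mult.commute del: One_nat_def)
  also have "\<dots> = (real K - y) * (ln K + euler_mascheroni) + e1 - y * e2"
    by (simp add: e1_def e2_def algebra_simps)
  finally have eq: "(\<Sum>n=1..K. psi_error N (d * n)) = (real K - y) * (ln K + euler_mascheroni) + e1 - y * e2" .
  have lnK: "0 \<le> ln (real K)" "ln (real K) \<le> ln y" using K0 K1 yK by auto
  have "\<bar>(real K - y) * (ln K + euler_mascheroni)\<bar> \<le> 1 * (ln K + 1)"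
    unfolding abs_mult using yK lnK gamma by (intro mult_mono) auto
  moreover have "\<bar>y * e2\<bar> \<le> 2 * real K * (1 / real K)"
    unfolding abs_mult using yK K1 e2 by (intro mult_mono) auto
  ultimately have "\<bar>\<Sum>n=1..K. psi_error N (d * n)\<bar> \<le> 2 * ln y + 5"
    unfolding eq using e1 lnK K0 by simp
  then show ?thesis by (simp add: K_def)
qed

lemma sum_inverse_sqrt_le: "(\<Sum>d=1..N. 1 / sqrt (real d)) \<le> 2 * sqrt (real N)"
proof (induction N)
  case (Suc N)
  define a b where "a = sqrt (real N)" and "b = sqrt (real (Suc N))"
  have ab: "0 \<le> a" "a < b" "b\<^sup>2 = a\<^sup>2 + 1" by (auto simp: a_def b_def)
  have "1 = (b - a) * (b + a)" using ab by (simp add: algebra_simps power2_eq_square)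
  also have "\<dots> \<le> (b - a) * (2 * b)" using ab by (intro mult_left_mono) auto
  finally have "1 / b \<le> 2 * b - 2 * a" using ab by (simp add: field_simps)
  with Suc.IH show ?case by (simp add: a_def b_def)
qed simp

text \<open>The logarithmic weight times the logarithmic error is traded for a square root, whose
  sum over d loses no logarithm. The constant is 42 = 2 * 16 + 5 * 2.\<close>

lemma ln_quadratic_le_sqrt:
  assumes "y \<ge> (1::real)"
  shows "ln y * (2 * ln y + 5) \<le> 42 * sqrt y"
proof -
  have 1: "ln y \<le> 4 * y powr (1/4)" using ln_powr_bound[of y "1/4"] assms by simp
  have 2: "ln y \<le> 2 * sqrt y" using ln_powr_bound[of y "1/2"] assms by (simp add: powr_half_sqrt)
  have 3: "ln y \<ge> 0" using assms by simp
  have "ln y * ln y \<le> (4 * y powr (1/4)) * (4 * y powr (1/4))"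
    using 1 3 by (intro mult_mono) auto
  also have "\<dots> = 16 * sqrt y"
    using assms by (simp add: powr_add [symmetric] powr_half_sqrt)
  finally show ?thesis using 2 by (simp add: algebra_simps)
qed

text \<open>Selberg's symmetry formula, by the Moebius inversion argument of Tatuzawa and Iseki.\<close>

lemma selberg_symmetry:
  assumes N: "N \<ge> 1"
  shows "\<bar>psi_error N 1 * ln (real N) + (\<Sum>m=1..N. mangoldt m * psi_error N m)\<bar> \<le> 84 * real N"
proof -
  let ?g = "\<lambda>d. mobius d * ln (real N / real d)"
  \<comment> \<open>The double sum is evaluated twice. Collected by m = d n, the coefficient of
    \<open>psi_error N m\<close> is the divisor sum of mobius d * ln (N / d), namely mangoldt m plus
    ln N at m = 1; taken d by d, each inner sum is logarithmic.\<close>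
  have "(\<Sum>d=1..N. ?g d * (\<Sum>n=1..N div d. psi_error N (d * n))) =
      (\<Sum>m=1..N. \<Sum>d | d dvd m. ?g d * psi_error N (d * (m div d)))"
    by (subst sum_divisors_upto[where f = "\<lambda>d k. ?g d * psi_error N (d * k)"]) (simp add: sum_distrib_left)
  also have "\<dots> = (\<Sum>m=1..N. ((if m = 1 then ln (real N) else 0) + mangoldt m) * psi_error N m)"
  proof (intro sum.cong refl)
    fix m assume m: "m \<in> {1..N}"
    have "(\<Sum>d | d dvd m. ?g d * psi_error N (d * (m div d))) = (\<Sum>d | d dvd m. ?g d) * psi_error N m"
      unfolding sum_distrib_right by (intro sum.cong refl) simp
    also have "(\<Sum>d | d dvd m. ?g d) = (\<Sum>d | d dvd m. ln (real N) * mobius d - mobius d * ln (real d))"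
    proof (intro sum.cong refl)
      fix d assume "d \<in> {d. d dvd m}"
      then have "d > 0" using m by (auto intro!: Nat.gr0I)
      then show "?g d = ln (real N) * mobius d - mobius d * ln (real d)"
        using N by (simp add: ln_div algebra_simps)
    qed
    also have "\<dots> = (if m = 1 then ln (real N) else 0) + mangoldt m"
      using m mobius_sum[of m] mobius_ln_sum[of m] by (simp add: sum_subtractf sum_distrib_left [symmetric])
    finally show "(\<Sum>d | d dvd m. ?g d * psi_error N (d * (m div d))) =
        ((if m = 1 then ln (real N) else 0) + mangoldt m) * psi_error N m" .
  qed
  also have "\<dots> = (\<Sum>m=1..N. (if m = 1 then ln (real N) * psi_error N m else 0) + mangoldt m * psi_error N m)"
    by (intro sum.cong refl) (simp add: algebra_simps)
  also have "\<dots> = psi_error N 1 * ln (real N) + (\<Sum>m=1..N. mangoldt m * psi_error N m)"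
    using N by (simp add: sum.distrib mult.commute)
  finally have eq: "(\<Sum>d=1..N. ?g d * (\<Sum>n=1..N div d. psi_error N (d * n))) =
      psi_error N 1 * ln (real N) + (\<Sum>m=1..N. mangoldt m * psi_error N m)" .
  \<comment> \<open>The sum of sqrt (N / d) over d \<le> N is at most 2 N, so the total is O(N) with
    no factor ln N; 84 = 42 * 2.\<close>
  have "\<bar>\<Sum>d=1..N. ?g d * (\<Sum>n=1..N div d. psi_error N (d * n))\<bar> \<le> (\<Sum>d=1..N. 42 * (sqrt (real N) * (1 / sqrt (real d))))"
  proof (rule order_trans[OF sum_abs], rule sum_mono)
    fix d assume d: "d \<in> {1..N}"
    let ?y = "real N / real d"
    have y: "?y \<ge> 1" using d by simp
    have "\<bar>?g d * (\<Sum>n=1..N div d. psi_error N (d * n))\<bar> \<le> (1 * ln ?y) * (2 * ln ?y + 5)"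
      unfolding abs_mult using d y
      by (intro mult_mono sum_psi_error_bound abs_mobius_le_1) auto
    also have "\<dots> \<le> 42 * sqrt ?y" using ln_quadratic_le_sqrt[OF y] by simp
    finally show "\<bar>?g d * (\<Sum>n=1..N div d. psi_error N (d * n))\<bar> \<le> 42 * (sqrt (real N) * (1 / sqrt (real d)))"
      by (simp add: real_sqrt_divide)
  qed
  also have "\<dots> = 42 * sqrt (real N) * (\<Sum>d=1..N. 1 / sqrt (real d))"
    by (simp add: sum_distrib_left mult.assoc)
  also have "\<dots> \<le> 42 * sqrt (real N) * (2 * sqrt (real N))"
    by (intro mult_left_mono sum_inverse_sqrt_le) auto
  also have "\<dots> = 84 * real N" by simp
  finally show ?thesis unfolding eq .
qed

text \<open>
  The upper bound for \<open>psi\<close> bounds the sum in the symmetry formula above by \<open>e N ln N + O(N)\<close>, so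
  \<open>psi_error N 1\<close> cannot be much below 0.
\<close>

lemma psi_lower_from_upper:
  assumes upper: "\<And>e. e > 0 \<Longrightarrow> \<forall>\<^sub>F N in sequentially. psi N \<le> (1 + e) * real N"
    and "e > 0"
  shows "\<forall>\<^sub>F N in sequentially. psi N \<ge> (1 - e) * real N"
proof -
  define e' where "e' = e / 2"
  have e': "e' > 0" using \<open>e > 0\<close> by (simp add: e'_def)
  obtain N0 where N0: "\<And>N. N \<ge> N0 \<Longrightarrow> psi N \<le> (1 + e') * real N"
    using upper[OF e'] by (auto simp: eventually_sequentially)
  \<comment> \<open>The bound is applied at every N div m, however small, so the finitely many
    exceptions are absorbed into a constant.\<close>
  define K where "K = psi N0"
  have K0: "K \<ge> 0" by (simp add: K_def psi_nonneg)
  have psi_le: "psi N \<le> (1 + e') * real N + K" for N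
  proof (cases "N \<ge> N0")
    case False
    then have "psi N \<le> K"
      unfolding K_def psi_def by (intro sum_mono2) (auto intro: mangoldt_nonneg)
    moreover have "0 \<le> (1 + e') * real N" using e' by simp
    ultimately show ?thesis by linarith
  qed (use N0 K0 in \<open>fastforce\<close>)
  define c :: real where "c = euler_mascheroni + 1"
  have c: "0 < c" using euler_mascheroni_pos by (simp add: c_def)
  define B where "B = (e' + K + c) * (1 + e' + K) + 84"
  have main: "psi_error N 1 * ln (real N) \<ge> - (e' * real N * ln (real N)) - B * real N" if N: "N \<ge> 1" for N
  proof -
    have "K \<le> K * real N" using N K0 by (simp add: mult_le_cancel_left1)
    then have psiN: "psi N \<le> (1 + e' + K) * real N"
      using psi_le[of N] by (simp add: algebra_simps)
    \<comment> \<open>As \<open>mangoldt\<close> is nonnegative, upper bounds for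
      \<open>psi_error N m\<close> bound the sum from above; their main part e' * (N div m) sums to
      e' ln (N!).\<close>
    have "(\<Sum>m=1..N. mangoldt m * psi_error N m) \<le>
        (\<Sum>m=1..N. e' * (mangoldt m * real (N div m)) + (e' + K + c) * mangoldt m)"
    proof (rule sum_mono)
      fix m assume m: "m \<in> {1..N}"
      have div: "real (N div m) \<le> real N / real m" by (rule of_nat_div_le_of_nat)
      have "psi_error N m \<le> e' * real (N div m) + (e' + K + c)"
      proof -
        have "psi_error N m \<le> (1 + e') * real (N div m) + K - real N / real m + c"
          using psi_le[of "N div m"] by (simp add: psi_error_def c_def)
        also have "\<dots> \<le> e' * real (N div m) + (e' + K + c)"
          using div e' by (simp add: algebra_simps)
        finally show ?thesis .
      qed
      then have "mangoldt m * psi_error N m \<le> mangoldt m * (e' * real (N div m) + (e' + K + c))"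
        by (intro mult_left_mono mangoldt_nonneg)
      then show "mangoldt m * psi_error N m \<le> e' * (mangoldt m * real (N div m)) + (e' + K + c) * mangoldt m"
        by (simp add: algebra_simps)
    qed
    also have "\<dots> = e' * ln (fact N) + (e' + K + c) * psi N"
      by (simp add: sum.distrib sum_distrib_left [symmetric] sum_mangoldt_div psi_def
            del: One_nat_def)
    also have "\<dots> \<le> e' * (real N * ln (real N)) + (e' + K + c) * ((1 + e' + K) * real N)"
    proof (intro add_mono mult_left_mono psiN)
      have "ln (fact N :: real) \<le> ln (real (N ^ N))"
        using fact_le_power[of N, where 'a = real] N by (subst ln_le_cancel_iff) auto
      then show "ln (fact N) \<le> real N * ln (real N)" using N by (simp add: ln_realpow)
    qed (use e' K0 c in auto)
    finally show ?thesis
      using selberg_symmetry[OF N] by (simp add: B_def algebra_simps)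
  qed
  \<comment> \<open>A second e' N ln N dominates B N and c ln N, so the total deficit is 2 * e' =
    e.\<close>
  have "\<forall>\<^sub>F N in sequentially. e' * real N * ln (real N) \<ge> (B + c * ln (real N) / real N) * real N"
    using e' by real_asymp
  moreover have "\<forall>\<^sub>F N in sequentially. N \<ge> (2::nat)" by (rule eventually_ge_at_top)
  ultimately show ?thesis
  proof eventually_elim
    case (elim N)
    have ln: "ln (real N) > 0" using elim by simp
    have "(psi N - real N + c) * ln (real N) \<ge> - (e' * real N * ln (real N)) - B * real N"
      using main[of N] elim by (simp add: psi_error_def c_def)
    moreover have "(B + c * ln (real N) / real N) * real N = B * real N + c * ln (real N)"
      using elim by (simp add: field_simps)
    ultimately have "(psi N - real N + 2 * (e' * real N)) * ln (real N) \<ge> 0"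
      using elim by (simp add: algebra_simps)
    then have "psi N - real N + 2 * (e' * real N) \<ge> 0"
      using ln by (simp add: zero_le_mult_iff)
    then show ?case by (simp add: e'_def algebra_simps)
  qed
qed

section \<open>The prime number theorem from the prime-pair conjecture\<close>

lemma hardy_littlewood_uniform:
  assumes "hardy_littlewood_prime_pairs" "C > 0" "e > 0"
  shows "\<forall>\<^sub>F N in sequentially. \<forall>d. even d \<and> 2 \<le> d \<and> real d \<le> C * ln (real N) \<longrightarrow>
           \<bar>real (prime_pair_count d (real N)) - singular_series d * (real N / (ln (real N))\<^sup>2)\<bar>
             \<le> e * (singular_series d * (real N / (ln (real N))\<^sup>2))"
proof -
  let ?D = "\<lambda>X. {d::nat. even d \<and> 2 \<le> d \<and> real d \<le> C * ln X}"
  let ?q = "\<lambda>X d. \<bar>real (prime_pair_count d X) / (singular_series d * X / (ln X)\<^sup>2) - 1\<bar>"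
  have "((\<lambda>X::real. SUP d\<in>?D X. ?q X d) \<longlongrightarrow> 0) at_top"
    using assms by (simp add: hardy_littlewood_prime_pairs_def)
  then have "((\<lambda>N. SUP d\<in>?D (real N). ?q (real N) d) \<longlongrightarrow> 0) sequentially"
    by (rule filterlim_compose[OF _ filterlim_real_sequentially])
  then have "\<forall>\<^sub>F N in sequentially. (SUP d\<in>?D (real N). ?q (real N) d) < e"
    using \<open>e > 0\<close> by (rule order_tendstoD(2))
  moreover have "\<forall>\<^sub>F N in sequentially. N \<ge> (2::nat)" by (rule eventually_ge_at_top)
  ultimately show ?thesis
  proof eventually_elim
    case (elim N)
    show ?case
    proof (intro allI impI)
      fix d :: nat assume d: "even d \<and> 2 \<le> d \<and> real d \<le> C * ln (real N)"
      \<comment> \<open>A real \<open>SUP\<close> bounds the members of a set only if the set is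
        bounded above; finiteness of the index set ensures this.\<close>
      have "?D (real N) \<subseteq> {..nat \<lfloor>C * ln (real N)\<rfloor>}"
        by (auto simp: le_nat_floor)
      then have fin: "finite (?D (real N))" by (rule finite_subset) simp
      have "?q (real N) d \<le> (SUP d\<in>?D (real N). ?q (real N) d)"
        using d by (intro cSUP_upper bdd_above_finite finite_imageI fin) auto
      also note elim(1)
      finally have q: "?q (real N) d \<le> e" by simp
      define W where "W = singular_series d * (real N / (ln (real N))\<^sup>2)"
      have W: "W > 0" using elim singular_series_pos[of d] by (simp add: W_def)
      have "\<bar>real (prime_pair_count d (real N)) - W\<bar> = ?q (real N) d * W"
      proof -
        have "singular_series d * real N / (ln (real N))\<^sup>2 = W" by (simp add: W_def)
        then have "?q (real N) d = \<bar>(real (prime_pair_count d (real N)) - W) / W\<bar>"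
          using W by (simp only: diff_divide_distrib) simp
        then show ?thesis using W by (simp add: abs_divide)
      qed
      also have "\<dots> \<le> e * W" using q W by (intro mult_right_mono) auto
      finally show "\<bar>real (prime_pair_count d (real N)) - singular_series d * (real N / (ln (real N))\<^sup>2)\<bar>
             \<le> e * (singular_series d * (real N / (ln (real N))\<^sup>2))"
        by (simp add: W_def)
    qed
  qed
qed

lemma prime_pair_count_nat:
  "prime_pair_count d (real N) = card {p\<in>{p. prime p \<and> p \<le> N}. p + d \<in> {p. prime p \<and> p \<le> N}}"
  unfolding prime_pair_count_def
  by (intro arg_cong[where f = card]) (auto simp flip: of_nat_add)

text \<open>Odd differences lie outside the conjecture but occur in the second moment; of two primes
  at odd distance the smaller one is 2.\<close>

lemma prime_pair_count_odd_le_1: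
  assumes "odd d"
  shows "prime_pair_count d (real N) \<le> 1"
proof -
  have "{p\<in>{p. prime p \<and> p \<le> N}. p + d \<in> {p. prime p \<and> p \<le> N}} \<subseteq> {2}"
  proof safe
    fix p :: nat assume p: "prime p" "prime (p + d)"
    have "p + d > 2" using prime_ge_2_nat[OF p(1)] assms by (auto elim: oddE)
    then have "odd (p + d)" using p(2) prime_odd_nat by blast
    then have "even p" using assms by simp
    then show "p = 2" using p(1) prime_odd_nat[of p] prime_ge_2_nat[of p] by force
  qed
  then show ?thesis
    unfolding prime_pair_count_nat using card_mono[of "{2::nat}"] by fastforce
qed

text \<open>The weight h - d is the number of m with d \<le> m < h, so the weighted sum is a sum of
  partial sums.\<close>

lemma sum_linear_weight_le:
  fixes a :: "nat \<Rightarrow> real"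
  assumes "\<And>m. (\<Sum>d\<le>m. a d) \<le> real m"
  shows "(\<Sum>d<h. real (h - d) * a d) \<le> (real h)\<^sup>2 / 2"
proof -
  have "(\<Sum>d<h. real (h - d) * a d) = (\<Sum>m<h. \<Sum>d\<le>m. a d)"
  proof (induction h)
    case (Suc h)
    have "(\<Sum>d<Suc h. real (Suc h - d) * a d) = (\<Sum>d<Suc h. real (h - d) * a d + a d)"
      by (intro sum.cong refl) (simp add: Suc_diff_le algebra_simps)
    then show ?case using Suc by (simp add: sum.distrib lessThan_Suc_atMost [symmetric])
  qed simp
  also have "\<dots> \<le> (\<Sum>m<h. real m)" by (intro sum_mono assms)
  also have "\<dots> \<le> (real h)\<^sup>2 / 2"
    by (induction h) (auto simp: power2_eq_square field_simps)
  finally show ?thesis .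
qed

text \<open>Put x = \<open>prime_count N\<close> and u = N / L. As the singular series has mean at
  most 1, windows of length h give x^2 \<le> (1 + o(1)) (u x L / h + u^2). When h is a large
  multiple of L the first term is small, and x \<le> (1 + o(1)) u follows.\<close>

lemma prime_count_upper:
  assumes HL: "hardy_littlewood_prime_pairs" and "\<eta> > 0"
  shows "\<forall>\<^sub>F N in sequentially. real (prime_count N) \<le> (1 + \<eta>) * (real N / ln (real N))"
proof -
  \<comment> \<open>The losses multiply to (1 + e) (1 + 5 / 2 * e) \<le> 1 + 6 * e, within
    \<eta>.\<close>
  define e where "e = min \<eta> 1 / 8"
  have e: "e > 0" "8 * e \<le> \<eta>" "8 * e \<le> 1" using \<open>\<eta> > 0\<close> by (auto simp: e_def min_def)
  \<comment> \<open>Rounding leaves h \<ge> 2 L / e, so the diagonal term N x / h is at most e / 2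
    times x u.\<close>
  define C where "C = 4 / e"
  have C: "C > 0" using e by (simp add: C_def)
  have "\<forall>\<^sub>F N in sequentially. C * ln (real N) - 1 \<ge> 2 / e * ln (real N)"
    using e unfolding C_def by real_asymp
  moreover have "\<forall>\<^sub>F N in sequentially. C * ln (real N) \<le> e * real N"
    using e unfolding C_def by real_asymp
  moreover have "\<forall>\<^sub>F N in sequentially. 2 \<le> e * (real N / (ln (real N))\<^sup>2)"
    using e by real_asymp
  moreover have "\<forall>\<^sub>F N in sequentially. N \<ge> (2::nat)" by (rule eventually_ge_at_top)
  ultimately show ?thesis using hardy_littlewood_uniform[OF HL C e(1)]
  proof eventually_elim
    case (elim N)
    define L where "L = ln (real N)"
    define W where "W = real N / L\<^sup>2"
    define u where "u = real N / L"
    define h where "h = nat \<lfloor>C * L\<rfloor>"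
    define P where "P = {p. prime p \<and> p \<le> N}"
    define x where "x = real (prime_count N)"
    have L: "L > 0" using elim by (simp add: L_def)
    have N0: "real N > 0" using elim by simp
    have W0: "W > 0" using L N0 by (simp add: W_def)
    have u0: "u > 0" using L N0 by (simp add: u_def)
    have "C * L > 0" using C L by simp
    then have h_le: "real h \<le> C * L" by (simp add: h_def)
    have "real h \<ge> C * L - 1" unfolding h_def by linarith
    then have h_ge: "real h \<ge> 2 / e * L" using elim(1) by (simp add: L_def)
    have "2 / e * L > 0" using e L by simp
    with h_ge have h0: "real h > 0" by linarith
    have pairs: "real (prime_pair_count d (real N)) \<le> 1 + (1 + e) * W * even_singular_series d"
      if "d \<in> {1..<h}" for d
    proof (cases "even d")
      case True
      then have d: "even d \<and> 2 \<le> d \<and> real d \<le> C * ln (real N)"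
        using that h_le by (auto simp: L_def elim!: evenE)
      then have "\<bar>real (prime_pair_count d (real N)) - singular_series d * W\<bar> \<le> e * (singular_series d * W)"
        using elim(5) by (simp add: W_def L_def)
      then have "real (prime_pair_count d (real N)) \<le> (1 + e) * W * singular_series d"
        by (simp add: algebra_simps abs_le_iff)
      then show ?thesis using d by (simp add: even_singular_series_def)
    next
      case False
      then show ?thesis using prime_pair_count_odd_le_1[of d N]
        by (simp add: even_singular_series_def)
    qed
    have "(real h * x)\<^sup>2 \<le> real (N + h) * (real h * x
        + 2 * (\<Sum>d\<in>{1..<h}. real (h - d) * real (prime_pair_count d (real N))))"
      using card_square_le_pair_differences[of P N h]
      by (simp add: P_def x_def prime_count_def prime_pair_count_nat subset_eq)
    \<comment> \<open>The lone (real h)^2 comes from the summand 1 in \<open>pairs\<close>, which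
      covers the odd differences; it ends up as the 2 \<le> e W below.\<close>
    also have "\<dots> \<le> real (N + h) * (real h * x + 2 * ((real h)\<^sup>2 + (1 + e) * W * ((real h)\<^sup>2 / 2)))"
    proof -
      have "(\<Sum>d\<in>{1..<h}. real (h - d) * real (prime_pair_count d (real N)))
          \<le> (\<Sum>d\<in>{1..<h}. real (h - d) * (1 + (1 + e) * W * even_singular_series d))"
        by (intro sum_mono mult_left_mono pairs) auto
      also have "\<dots> \<le> (\<Sum>d<h. real (h - d) * (1 + (1 + e) * W * even_singular_series d))"
        using e W0 by (intro sum_mono2) (auto intro!: mult_nonneg_nonneg add_nonneg_nonneg even_singular_series_nonneg)
      also have "\<dots> = (\<Sum>d<h. real (h - d)) + (1 + e) * W * (\<Sum>d<h. real (h - d) * even_singular_series d)"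
        by (simp only: distrib_left sum.distrib sum_distrib_left mult_1_right mult.left_commute)
      also have "\<dots> \<le> (\<Sum>d<h. real h) + (1 + e) * W * ((real h)\<^sup>2 / 2)"
        using e W0 by (intro add_mono sum_mono mult_left_mono sum_linear_weight_le even_singular_series_sum_le) auto
      finally show ?thesis by (intro mult_left_mono add_left_mono) (auto simp: power2_eq_square)
    qed
    finally have "(real h * x)\<^sup>2 \<le> real (N + h) * (real h * x + 2 * ((real h)\<^sup>2 + (1 + e) * W * ((real h)\<^sup>2 / 2)))" .
    also have "\<dots> = (real h)\<^sup>2 * (real (N + h) * (x / real h + 2 + (1 + e) * W))"
      using h0 by (simp add: field_simps power2_eq_square)
    finally have "x\<^sup>2 \<le> real (N + h) * (x / real h + 2 + (1 + e) * W)"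
      using h0 by (simp add: power_mult_distrib)
    also have "\<dots> \<le> ((1 + e) * real N) * (x * (e / (2 * L)) + e * W + (1 + e) * W)"
    proof (intro mult_mono add_mono order_refl)
      show "real (N + h) \<le> (1 + e) * real N"
        using h_le elim(2) by (simp add: L_def algebra_simps)
      have "1 / real h \<le> e / (2 * L)"
        using h_ge h0 L e by (simp add: field_simps)
      then show "x / real h \<le> x * (e / (2 * L))"
        using mult_left_mono[of "1 / real h" "e / (2 * L)" x] by (simp add: x_def)
      show "2 \<le> e * W" using elim(3) by (simp add: W_def L_def)
    qed (use e W0 h0 in \<open>auto simp: x_def intro!: add_nonneg_nonneg\<close>)
    also have "\<dots> = (1 + e) * (e / 2 * x * u + (1 + 2 * e) * u\<^sup>2)"
      using L by (simp add: u_def W_def field_simps power2_eq_square)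
    finally have quad: "x\<^sup>2 \<le> (1 + e) * (e / 2 * x * u + (1 + 2 * e) * u\<^sup>2)" .
    \<comment> \<open>For x > u the term u^2 may be enlarged to x u, after which x cancels from the
      quadratic inequality.\<close>
    have "x \<le> (1 + \<eta>) * u"
    proof (cases "x \<le> u")
      case True
      have "u \<le> (1 + \<eta>) * u" using u0 \<open>\<eta> > 0\<close> by simp
      with True show ?thesis by linarith
    next
      case False
      then have xu: "u < x" "x > 0" using u0 by auto
      have "(1 + e) * (e / 2 * x * u + (1 + 2 * e) * u\<^sup>2) \<le> (1 + e) * (e / 2 * x * u + (1 + 2 * e) * (x * u))"
        using xu u0 e by (intro mult_left_mono add_left_mono) (auto simp: power2_eq_square)
      then have "x * x \<le> x * ((1 + e) * (1 + 5 / 2 * e) * u)"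
        using quad by (simp add: power2_eq_square algebra_simps)
      then have "x \<le> (1 + e) * (1 + 5 / 2 * e) * u"
        using xu by (simp only: mult_le_cancel_left_pos)
      also have "\<dots> \<le> (1 + \<eta>) * u"
      proof (intro mult_right_mono)
        have "e * e \<le> e * 1" using e by (intro mult_left_mono) auto
        moreover have "(1 + e) * (1 + 5 / 2 * e) = 1 + 7 / 2 * e + 5 / 2 * (e * e)"
          by (simp add: field_simps)
        ultimately show "(1 + e) * (1 + 5 / 2 * e) \<le> 1 + \<eta>" using e by linarith
      qed (use u0 in auto)
      finally show ?thesis .
    qed
    then show ?case by (simp add: x_def u_def L_def)
  qed
qed

text \<open>The inequality psi N \<le> prime_count N * ln N serves twice: it carries the upper bound
  from \<open>prime_count\<close> to \<open>psi\<close>, and the lower bound that Selberg's formula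
  then gives from \<open>psi\<close> back to \<open>prime_count\<close>.\<close>

lemma prime_count_asymp_equiv:
  assumes HL: "hardy_littlewood_prime_pairs"
  shows "(\<lambda>N. real (prime_count N)) \<sim>[sequentially] (\<lambda>N. real N / ln (real N))"
proof (subst asymp_equiv_at_top_iff)
  have N2: "\<forall>\<^sub>F N in sequentially. N \<ge> (2::nat)" by (rule eventually_ge_at_top)
  then show "\<forall>\<^sub>F N in sequentially. 0 < real N / ln (real N)"
    by eventually_elim simp
  have psi_upper: "\<forall>\<^sub>F N in sequentially. psi N \<le> (1 + e) * real N" if "e > 0" for e
    using prime_count_upper[OF HL that] N2
  proof eventually_elim
    case (elim N)
    have ln: "ln (real N) > 0" using elim by simp
    have "psi N \<le> real (prime_count N) * ln (real N)" using elim by (intro psi_le_prime_count) auto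
    also have "\<dots> \<le> (1 + e) * (real N / ln (real N)) * ln (real N)"
      using elim ln by (intro mult_right_mono) auto
    also have "\<dots> = (1 + e) * real N" using ln by simp
    finally show ?case .
  qed
  show "\<forall>e>0. e < 1 \<longrightarrow> (\<forall>\<^sub>F N in sequentially. (1 - e) * (real N / ln (real N)) \<le> real (prime_count N) \<and>
          real (prime_count N) \<le> (1 + e) * (real N / ln (real N)))"
  proof (intro allI impI)
    fix e :: real assume "e > 0"
    have "\<forall>\<^sub>F N in sequentially. psi N \<ge> (1 - e) * real N"
      by (rule psi_lower_from_upper[OF psi_upper \<open>e > 0\<close>])
    with prime_count_upper[OF HL \<open>e > 0\<close>] N2
    show "\<forall>\<^sub>F N in sequentially. (1 - e) * (real N / ln (real N)) \<le> real (prime_count N) \<and>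
          real (prime_count N) \<le> (1 + e) * (real N / ln (real N))"
    proof eventually_elim
      case (elim N)
      have ln: "ln (real N) > 0" using elim by simp
      have "(1 - e) * real N \<le> real (prime_count N) * ln (real N)"
        using elim psi_le_prime_count[of N] by simp
      with elim ln show ?case by (simp add: field_simps)
    qed
  qed
qed

section \<open>Brun's pure sieve\<close>

lemma card_shifted_multiples:
  fixes M N s :: nat
  assumes "M > 0"
  shows "\<bar>real (card {n\<in>{1..N}. M dvd n + s}) - real N / real M\<bar> \<le> 1"
proof -
  have "card {n\<in>{1..N}. M dvd n + s} = card ((\<lambda>n. n + s) ` {n\<in>{1..N}. M dvd n + s})"
    by (simp add: card_image inj_on_def)
  also have "(\<lambda>n. n + s) ` {n\<in>{1..N}. M dvd n + s} = {e\<in>{1..N + s}. M dvd e} - {e\<in>{1..s}. M dvd e}"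
  proof (intro equalityI subsetI)
    fix e assume "e \<in> {e\<in>{1..N + s}. M dvd e} - {e\<in>{1..s}. M dvd e}"
    then show "e \<in> (\<lambda>n. n + s) ` {n\<in>{1..N}. M dvd n + s}"
      by (intro image_eqI[of _ _ "e - s"]) auto
  qed auto
  also have "card \<dots> = (N + s) div M - s div M"
    using card_multiples_nat[OF assms] by (subst card_Diff_subset) auto
  finally have "real (card {n\<in>{1..N}. M dvd n + s}) = real ((N + s) div M) - real (s div M)"
    by (simp add: of_nat_diff div_le_mono)
  then show ?thesis
    using floor_divide_of_nat_eq[where 'a = real, of "N + s" M] floor_correct[of "real (N + s) / real M"]
      floor_divide_of_nat_eq[where 'a = real, of s M] floor_correct[of "real s / real M"]
    unfolding of_nat_add add_divide_distrib by linarith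
qed

definition divides_triple :: "nat \<Rightarrow> nat \<Rightarrow> nat \<Rightarrow> nat \<Rightarrow> bool" where
  "divides_triple a b p n \<longleftrightarrow> p dvd n \<or> p dvd n + a \<or> p dvd n + b"

text \<open>Each prime of D allows three residue classes. By the Chinese remainder theorem every
  choice of classes is one congruence, counted with error at most 1, and there are 3 ^ card D
  choices. The congruence modulo M carries the choices already made through the induction.\<close>

lemma card_divides_triple:
  fixes D :: "nat set" and a b :: nat
  assumes "finite D" "\<And>p. p \<in> D \<Longrightarrow> prime p \<and> b < p" "0 < a" "a < b"
    and "M > 0" "\<And>p. p \<in> D \<Longrightarrow> coprime M p"
  shows "\<bar>real (card {n\<in>{1..N}. M dvd n + s \<and> (\<forall>p\<in>D. divides_triple a b p n)})
            - 3 ^ card D * (real N / real (M * \<Prod>D))\<bar> \<le> 3 ^ card D"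
  using assms
proof (induction D arbitrary: M s rule: finite_induct)
  case empty
  then show ?case using card_shifted_multiples[of M N s] by simp
next
  case (insert p D)
  let ?S = "\<lambda>M s. {n\<in>{1..N}. M dvd n + s \<and> (\<forall>p\<in>D. divides_triple a b p n)}"
  let ?T = "\<lambda>t. {n\<in>{1..N}. (M dvd n + s \<and> p dvd n + t) \<and> (\<forall>p\<in>D. divides_triple a b p n)}"
  let ?x = "3 ^ card D * (real N / real (M * \<Prod>(insert p D)))"
  have p: "prime p" "b < p" "coprime M p" using insert by auto
  have each: "\<bar>real (card (?T t)) - ?x\<bar> \<le> 3 ^ card D" for t
  proof -
    obtain u where u: "[u = s] (mod M)" "[u = t] (mod p)"
      using binary_chinese_remainder_nat[OF p(3), of s t] by blast
    have "M dvd n + s \<longleftrightarrow> M dvd n + u" "p dvd n + t \<longleftrightarrow> p dvd n + u" for n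
      using u cong_dvd_iff[OF cong_add[OF cong_refl]] by blast+
    then have "?T t = ?S (M * p) u"
      using p(3) by (auto intro: divides_mult dest: dvd_mult_left dvd_mult_right)
    moreover have "\<bar>real (card (?S (M * p) u)) - 3 ^ card D * (real N / real (M * p * \<Prod>D))\<bar> \<le> 3 ^ card D"
      using insert p by (intro insert.IH) (auto simp: prime_gt_0_nat intro!: primes_coprime)
    ultimately show ?thesis using insert.hyps by (simp add: mult.assoc)
  qed
  \<comment> \<open>Since 0 < a < b < p, the classes 0, -a and -b modulo p are distinct, so the
    three cases do not overlap.\<close>
  have small: "\<not> p dvd a" "\<not> p dvd b" "\<not> p dvd b - a"
    using p(2) insert.prems(2,3) nat_dvd_not_less[of a p] nat_dvd_not_less[of b p]
      nat_dvd_not_less[of "b - a" p] by simp_all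
  have disj: "?T 0 \<inter> ?T a = {}" "(?T 0 \<union> ?T a) \<inter> ?T b = {}"
  proof -
    have "\<not> (p dvd n \<and> p dvd n + a)" "\<not> (p dvd n \<and> p dvd n + b)" "\<not> (p dvd n + a \<and> p dvd n + b)" for n
    proof -
      show "\<not> (p dvd n \<and> p dvd n + a)"
        using small(1) dvd_add_right_iff[of p n a] by blast
      show "\<not> (p dvd n \<and> p dvd n + b)"
        using small(2) dvd_add_right_iff[of p n b] by blast
      show "\<not> (p dvd n + a \<and> p dvd n + b)"
      proof
        assume "p dvd n + a \<and> p dvd n + b"
        then have "p dvd (n + b) - (n + a)" by (intro dvd_diff_nat) auto
        with small(3) show False by simp
      qed
    qed
    note no_two = this
    show "?T 0 \<inter> ?T a = {}"
      by (rule equals0I, elim IntE CollectE conjE) (use no_two(1) in simp)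
    show "(?T 0 \<union> ?T a) \<inter> ?T b = {}"
      by (rule equals0I, elim IntE UnE CollectE conjE) (use no_two(2,3) in simp_all)
  qed
  have "{n\<in>{1..N}. M dvd n + s \<and> (\<forall>p\<in>insert p D. divides_triple a b p n)} = (?T 0 \<union> ?T a) \<union> ?T b"
    by (auto simp: divides_triple_def)
  moreover have "card ((?T 0 \<union> ?T a) \<union> ?T b) = card (?T 0 \<union> ?T a) + card (?T b)"
    by (rule card_Un_disjoint[OF _ _ disj(2)]) simp_all
  moreover have "card (?T 0 \<union> ?T a) = card (?T 0) + card (?T a)"
    by (rule card_Un_disjoint[OF _ _ disj(1)]) simp_all
  ultimately have card: "card {n\<in>{1..N}. M dvd n + s \<and> (\<forall>p\<in>insert p D. divides_triple a b p n)} =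
      card (?T 0) + card (?T a) + card (?T b)"
    by (simp only:)
  have Suc: "card (insert p D) = Suc (card D)" using insert.hyps by simp
  have three: "\<bar>(u + v + w) - 3 * x\<bar> \<le> 3 * c"
    if "\<bar>u - x\<bar> \<le> c" "\<bar>v - x\<bar> \<le> c" "\<bar>w - x\<bar> \<le> c" for u v w x c :: real
    using that by linarith
  show ?case
    unfolding card Suc of_nat_add power_Suc mult.assoc
    by (rule three[OF each[of 0] each[of a] each[of b], unfolded mult.assoc])
qed

lemma sum_over_bounded_subsets:
  fixes g :: "nat \<Rightarrow> real"
  assumes "finite G"
  shows "(\<Sum>D | D \<subseteq> G \<and> card D \<le> r. g (card D)) = (\<Sum>j\<le>r. real (card G choose j) * g j)"
proof -
  have fin: "finite {D. D \<subseteq> G \<and> card D \<le> r}"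
    by (rule finite_subset[of _ "Pow G"]) (use assms in auto)
  have "(\<Sum>D | D \<subseteq> G \<and> card D \<le> r. g (card D)) =
      (\<Sum>j\<le>r. \<Sum>D | D \<in> {D. D \<subseteq> G \<and> card D \<le> r} \<and> card D = j. g (card D))"
    by (rule sum.group [symmetric]) (use fin in auto)
  also have "\<dots> = (\<Sum>j\<le>r. \<Sum>D | D \<subseteq> G \<and> card D = j. g j)"
    by (intro sum.cong refl) auto
  also have "\<dots> = (\<Sum>j\<le>r. real (card G choose j) * g j)"
    using assms by (simp add: n_subsets)
  finally show ?thesis .
qed

text \<open>For card G = m + 1 the truncated alternating sum is (-1)^r times m choose r, nonnegative
  when r is even.\<close>

lemma bonferroni_upper:
  assumes "finite G" "even r"
  shows "(if G = {} then 1 else 0) \<le> (\<Sum>D | D \<subseteq> G \<and> card D \<le> r. (- 1) ^ card D :: real)"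
proof (cases "G = {}")
  case True
  have "{D. D \<subseteq> G \<and> card D \<le> r} = {{}}" using True by auto
  then show ?thesis using True by simp
next
  case False
  then obtain m where m: "card G = Suc m" using assms by (cases "card G") auto
  have "(\<Sum>D | D \<subseteq> G \<and> card D \<le> r. (- 1) ^ card D :: real) = (\<Sum>j\<le>r. (real (card G) gchoose j) * (- 1) ^ j)"
    using sum_over_bounded_subsets[OF assms(1), where r = r and g = "\<lambda>j. (- 1) ^ j"] by (simp add: binomial_gbinomial)
  also have "\<dots> = (- 1) ^ r * ((real (card G) - 1) gchoose r)"
    by (rule gbinomial_sum_lower_neg)
  also have "\<dots> = real (m choose r)"
    using assms m by (simp add: binomial_gbinomial)
  finally show ?thesis using False by simp
qed

text \<open>The factor r choose j, at least 1 for j \<le> r, is inserted to complete a binomial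
  expansion. The bound is crude but affordable: in the application it stays below the square root of
  N.\<close>

lemma sum_bounded_subsets_power_le:
  assumes "finite P"
  shows "(\<Sum>D | D \<subseteq> P \<and> card D \<le> r. 3 ^ card D :: real) \<le> (1 + 3 * real (card P)) ^ r"
proof -
  have "(\<Sum>D | D \<subseteq> P \<and> card D \<le> r. 3 ^ card D :: real) = (\<Sum>j\<le>r. real (card P choose j) * 3 ^ j)"
    by (rule sum_over_bounded_subsets[OF assms])
  also have "\<dots> \<le> (\<Sum>j\<le>r. real (r choose j) * (3 * real (card P)) ^ j)"
  proof (rule sum_mono)
    fix j assume j: "j \<in> {..r}"
    have "real (card P choose j) * 3 ^ j \<le> real (card P) ^ j * 3 ^ j"
    proof (intro mult_right_mono)
      have "card P choose j \<le> card P ^ j"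
        by (cases "j \<le> card P") (auto intro: binomial_le_pow simp: binomial_eq_0)
      then show "real (card P choose j) \<le> real (card P) ^ j"
        by (metis of_nat_le_iff of_nat_power)
    qed simp
    also have "\<dots> = 1 * (3 * real (card P)) ^ j" by (simp add: power_mult_distrib mult.commute)
    also have "\<dots> \<le> real (r choose j) * (3 * real (card P)) ^ j"
      using j by (intro mult_right_mono) (auto simp: Suc_le_eq zero_less_binomial)
    finally show "real (card P choose j) * 3 ^ j \<le> real (r choose j) * (3 * real (card P)) ^ j" .
  qed
  also have "\<dots> = (3 * real (card P) + 1) ^ r"
    by (subst binomial_ring) simp
  finally show ?thesis by (simp add: add.commute)
qed

text \<open>
  Brun's pure sieve.  The terms of the inclusion-exclusion formula with more than \<open>r\<close> primes are
  weighted by \<open>exp (card D - r) \<ge> 1\<close>, which completes their sum to an Euler product.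
\<close>

lemma brun_sieve:
  fixes P :: "nat set" and a b :: nat
  assumes P: "finite P" "\<And>p. p \<in> P \<Longrightarrow> prime p \<and> b < p" and ab: "0 < a" "a < b" and r: "even r"
  defines "S \<equiv> (\<Sum>p\<in>P. 3 / real p)"
  shows "real (card {n\<in>{1..N}. \<forall>p\<in>P. \<not> divides_triple a b p n})
           \<le> real N * (exp (- S) + exp (3 * S - real r)) + (1 + 3 * real (card P)) ^ r"
proof -
  let ?D = "{D. D \<subseteq> P \<and> card D \<le> r}"
  let ?A = "\<lambda>D. {n\<in>{1..N}. \<forall>p\<in>D. divides_triple a b p n}"
  let ?y = "\<lambda>D. \<Prod>p\<in>D. 3 / real p"
  have fin: "finite D" if "D \<subseteq> P" for D using that P(1) finite_subset by blast
  have finD: "finite ?D" by (rule finite_subset[of _ "Pow P"]) (use P in auto)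
  have y: "?y D = 3 ^ card D * (1 / real (\<Prod>D))" for D
    by (simp add: prod_dividef)
  have y0: "?y D \<ge> 0" for D by (intro prod_nonneg) auto
  have none: "(\<forall>p\<in>P. \<not> divides_triple a b p n) \<longleftrightarrow> {p\<in>P. divides_triple a b p n} = {}" for n
    by auto
  have "real (card {n\<in>{1..N}. \<forall>p\<in>P. \<not> divides_triple a b p n}) =
      (\<Sum>n=1..N. if {p\<in>P. divides_triple a b p n} = {} then 1 else 0)"
    unfolding none by (subst sum.inter_filter [symmetric]) (simp_all del: Collect_empty_eq)
  also have "\<dots> \<le> (\<Sum>n=1..N. \<Sum>D | D \<subseteq> {p\<in>P. divides_triple a b p n} \<and> card D \<le> r. (- 1) ^ card D)"
    using P r by (intro sum_mono bonferroni_upper) auto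
  also have "\<dots> = (\<Sum>n=1..N. \<Sum>D\<in>{D\<in>?D. \<forall>p\<in>D. divides_triple a b p n}. (- 1) ^ card D)"
    by (intro sum.cong refl) auto
  also have "\<dots> = (\<Sum>D\<in>?D. \<Sum>n\<in>{n\<in>{1..N}. \<forall>p\<in>D. divides_triple a b p n}. (- 1) ^ card D)"
    using finD by (intro sum.swap_restrict) auto
  also have "\<dots> = (\<Sum>D\<in>?D. (- 1) ^ card D * real (card (?A D)))"
    by (simp add: mult.commute)
  also have "\<dots> \<le> (\<Sum>D\<in>?D. (- 1) ^ card D * (?y D * real N) + 3 ^ card D)"
  proof (rule sum_mono)
    fix D assume D: "D \<in> ?D"
    have "\<bar>real (card {n\<in>{1..N}. 1 dvd n + 0 \<and> (\<forall>p\<in>D. divides_triple a b p n)})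
            - 3 ^ card D * (real N / real (1 * \<Prod>D))\<bar> \<le> 3 ^ card D"
      using D P ab by (intro card_divides_triple fin) auto
    then have "\<bar>real (card (?A D)) - ?y D * real N\<bar> \<le> 3 ^ card D"
      by (simp add: y)
    moreover have "(- 1) ^ card D = (1::real) \<or> (- 1) ^ card D = (- 1 :: real)"
      by (cases "even (card D)") auto
    ultimately show "(- 1) ^ card D * real (card (?A D)) \<le> (- 1) ^ card D * (?y D * real N) + 3 ^ card D"
      by (auto simp: abs_le_iff)
  qed
  also have "\<dots> = real N * (\<Sum>D\<in>?D. (- 1) ^ card D * ?y D) + (\<Sum>D\<in>?D. 3 ^ card D)"
    by (simp add: sum.distrib sum_distrib_left mult_ac)
  also have "\<dots> \<le> real N * (exp (- S) + exp (3 * S - real r)) + (1 + 3 * real (card P)) ^ r"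
  proof (intro add_mono mult_left_mono sum_bounded_subsets_power_le P)
    \<comment> \<open>The sum over small sets is the full Euler product minus the tail over
      \<open>?E\<close>; the product is at most exp (- S), and the tail is bounded in absolute
      value.\<close>
    let ?E = "{D. D \<subseteq> P \<and> r < card D}"
    have "Pow P = ?D \<union> ?E" by auto
    then have "(\<Sum>D\<in>Pow P. (- 1) ^ card D * ?y D) =
        (\<Sum>D\<in>?D. (- 1) ^ card D * ?y D) + (\<Sum>D\<in>?E. (- 1) ^ card D * ?y D)"
      using P finite_subset[of ?E "Pow P"] finD by (simp only:) (subst sum.union_disjoint; auto)
    moreover have "(\<Sum>D\<in>Pow P. (- 1) ^ card D * ?y D) = (\<Prod>p\<in>P. 1 - 3 / real p)"
      using P by (subst prod_diff_conv_sum) auto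
    moreover have "(\<Prod>p\<in>P. 1 - 3 / real p) \<le> exp (- S)"
    proof -
      have "(\<Prod>p\<in>P. 1 - 3 / real p) \<le> (\<Prod>p\<in>P. exp (- (3 / real p)))"
      proof (rule prod_mono)
        fix p assume "p \<in> P"
        \<comment> \<open>From b \<ge> 2 and p > b; comparing the products factor by factor requires
          1 - 3 / p \<ge> 0.\<close>
        then have "p \<ge> 3" using P(2)[of p] ab by auto
        then have "3 / real p \<le> 1" by simp
        moreover have "1 + - (3 / real p) \<le> exp (- (3 / real p))" by (rule exp_ge_add_one_self)
        ultimately show "0 \<le> 1 - 3 / real p \<and> 1 - 3 / real p \<le> exp (- (3 / real p))" by simp
      qed
      also have "\<dots> = exp (- S)"
        using P by (simp add: S_def exp_sum [symmetric] sum_negf)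
      finally show ?thesis .
    qed
    moreover have "- (\<Sum>D\<in>?E. (- 1) ^ card D * ?y D) \<le> exp (3 * S - real r)"
    proof -
      have "- (\<Sum>D\<in>?E. (- 1) ^ card D * ?y D) \<le> (\<Sum>D\<in>?E. exp (real (card D) - real r) * ?y D)"
        unfolding sum_negf [symmetric]
      proof (rule sum_mono)
        fix D assume "D \<in> ?E"
        then have "1 \<le> exp (real (card D) - real r)" by simp
        then have "1 * ?y D \<le> exp (real (card D) - real r) * ?y D"
          by (intro mult_right_mono y0)
        moreover have "- ((- 1) ^ card D * ?y D) \<le> ?y D"
          using y0[of D] by (cases "even (card D)") auto
        ultimately show "- ((- 1) ^ card D * ?y D) \<le> exp (real (card D) - real r) * ?y D" by simp
      qed
      also have "\<dots> \<le> (\<Sum>D\<in>Pow P. exp (real (card D) - real r) * ?y D)"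
        using P y0 by (intro sum_mono2) auto
      also have "\<dots> = exp (- real r) * (\<Sum>D\<in>Pow P. \<Prod>p\<in>D. exp 1 * (3 / real p))"
      proof -
        have "exp (real (card D) - real r) * ?y D = exp (- real r) * (\<Prod>p\<in>D. exp 1 * (3 / real p))" for D
        proof -
          have "(\<Prod>p\<in>D. exp 1 * (3 / real p)) = exp 1 ^ card D * ?y D"
            by (simp only: prod.distrib prod_constant)
          also have "exp 1 ^ card D = exp (real (card D))"
            using exp_of_nat_mult[of "card D" "1::real"] by simp
          finally show ?thesis by (simp add: exp_diff exp_minus divide_inverse)
        qed
        then show ?thesis by (simp add: sum_distrib_left)
      qed
      also have "(\<Sum>D\<in>Pow P. \<Prod>p\<in>D. exp 1 * (3 / real p)) = (\<Prod>p\<in>P. exp 1 * (3 / real p) + 1)"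
        using P by (subst prod_add) auto
      \<comment> \<open>As exp 1 \<le> 3, each factor is at most 1 + 9 / p \<le> exp (9 / p), whence
        3 * S in the exponent.\<close>
      also have "\<dots> \<le> (\<Prod>p\<in>P. exp (3 * (3 / real p)))"
      proof (rule prod_mono)
        fix p assume "p \<in> P"
        have "exp 1 * (3 / real p) + 1 \<le> 3 * (3 / real p) + 1"
          using exp_le by (intro add_right_mono mult_right_mono) auto
        also have "\<dots> \<le> exp (3 * (3 / real p))" using exp_ge_add_one_self[of "3 * (3 / real p)"] by linarith
        finally show "0 \<le> exp 1 * (3 / real p) + 1 \<and> exp 1 * (3 / real p) + 1 \<le> exp (3 * (3 / real p))"
          by (auto intro!: add_nonneg_nonneg mult_nonneg_nonneg)
      qed
      also have "\<dots> = exp (3 * S)"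
        using P by (simp only: S_def exp_sum [symmetric] sum_distrib_left)
      finally show ?thesis by (simp add: exp_diff exp_minus divide_inverse mult.commute)
    qed
    ultimately show "(\<Sum>D\<in>?D. (- 1) ^ card D * ?y D) \<le> exp (- S) + exp (3 * S - real r)" by linarith
  qed auto
  finally show ?thesis .
qed

definition prime_triple_count :: "nat \<Rightarrow> nat \<Rightarrow> nat \<Rightarrow> nat" where
  "prime_triple_count a b N = card {p. prime p \<and> prime (p + a) \<and> prime (p + b) \<and> p + b \<le> N}"

text \<open>If p > z begins a triple, all three members are primes larger than every sieving prime,
  so p survives the sieve; the p up to z are counted trivially.\<close>

lemma prime_triple_count_le:
  fixes w z a b :: nat
  assumes ab: "0 < a" "a < b" "b \<le> w" and r: "even r"
  defines "P \<equiv> {p. prime p \<and> w < p \<and> p \<le> z}"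
  defines "S \<equiv> (\<Sum>p\<in>P. 3 / real p)"
  shows "real (prime_triple_count a b N)
           \<le> real z + real N * (exp (- S) + exp (3 * S - real r)) + (1 + 3 * real z) ^ r"
proof -
  have finP: "finite P" by (rule finite_subset[of _ "{..z}"]) (auto simp: P_def)
  let ?B = "{n\<in>{1..N}. \<forall>p\<in>P. \<not> divides_triple a b p n}"
  have "{p. prime p \<and> prime (p + a) \<and> prime (p + b) \<and> p + b \<le> N} \<subseteq> {1..z} \<union> ?B"
  proof safe
    fix n assume n: "prime n" "prime (n + a)" "prime (n + b)" "n + b \<le> N" "n \<notin> {1..z}"
    then have "n > z" using prime_gt_0_nat[of n] by auto
    then show "n \<in> {1..N}" using n by auto
    fix p assume "p \<in> P" "divides_triple a b p n"
    then have "prime p" "p \<le> z" "p = n \<or> p = n + a \<or> p = n + b"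
      using n primes_dvd_imp_eq[of p] by (auto simp: P_def divides_triple_def)
    with \<open>n > z\<close> show False by auto
  qed
  then have "prime_triple_count a b N \<le> card ({1..z} \<union> ?B)"
    unfolding prime_triple_count_def by (intro card_mono) auto
  also have "\<dots> \<le> card {1..z} + card ?B" by (rule card_Un_le)
  finally have "real (prime_triple_count a b N) \<le> real z + real (card ?B)" by simp
  also have "real (card ?B) \<le> real N * (exp (- S) + exp (3 * S - real r)) + (1 + 3 * real (card P)) ^ r"
    unfolding S_def using finP ab r by (intro brun_sieve) (auto simp: P_def)
  also have "(1 + 3 * real (card P)) ^ r \<le> (1 + 3 * real z) ^ r"
  proof (intro power_mono)
    have "P \<subseteq> {1..z}" using prime_gt_0_nat by (auto simp: P_def Suc_le_eq)
    then have "card P \<le> card {1..z}" by (intro card_mono) auto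
    then show "1 + 3 * real (card P) \<le> 1 + 3 * real z" by simp
  qed simp
  finally show ?thesis by simp
qed

section \<open>Prime triples\<close>

text \<open>The primes above n powr (1 - d) make up almost all primes up to n and have logarithm at
  least (1 - d) ln n, so replacing ln p by ln n costs only a factor close to 1.\<close>

lemma sum_ln_primes_asymp_equiv:
  assumes HL: "hardy_littlewood_prime_pairs"
  shows "(\<lambda>n. \<Sum>k\<le>n. if prime k then ln (real k) else 0) \<sim>[sequentially] real"
proof (subst asymp_equiv_at_top_iff)
  have N2: "\<forall>\<^sub>F N in sequentially. N \<ge> (2::nat)" by (rule eventually_ge_at_top)
  then show "\<forall>\<^sub>F n in sequentially. 0 < real n" by eventually_elim simp
  let ?t = "\<lambda>n. \<Sum>k\<le>n. if prime k then ln (real k) else 0"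
  have theta: "?t n = (\<Sum>p | prime p \<and> p \<le> n. ln (real p))" for n
    by (rule sum.mono_neutral_cong_right) auto
  have pos: "\<forall>\<^sub>F N in sequentially. real N / ln (real N) > 0"
    using N2 by eventually_elim simp
  show "\<forall>e>0. e < 1 \<longrightarrow> (\<forall>\<^sub>F n in sequentially. (1 - e) * real n \<le> ?t n \<and> ?t n \<le> (1 + e) * real n)"
  proof (intro allI impI)
    fix e :: real assume e: "e > 0" "e < 1"
    define d where "d = e / 3"
    have d: "d > 0" "d < 1" using e by (auto simp: d_def)
    have "\<forall>\<^sub>F n in sequentially. (1 - d) * (real n / ln (real n)) \<le> real (prime_count n) \<and>
            real (prime_count n) \<le> (1 + d) * (real n / ln (real n))"
      using prime_count_asymp_equiv[OF HL] d unfolding asymp_equiv_at_top_iff[OF pos] by blast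
    moreover have "\<forall>\<^sub>F n in sequentially. real n powr (1 - d) \<le> d * (real n / ln (real n))"
      using d by real_asymp
    ultimately show "\<forall>\<^sub>F n in sequentially. (1 - e) * real n \<le> ?t n \<and> ?t n \<le> (1 + e) * real n"
      using N2
    proof eventually_elim
      case (elim n)
      let ?P = "{p. prime p \<and> p \<le> n}"
      define L where "L = ln (real n)"
      have L: "L > 0" using elim by (simp add: L_def)
      have "?t n \<le> (\<Sum>p\<in>?P. L)"
        unfolding theta L_def by (intro sum_mono iffD2[OF ln_le_cancel_iff]) (auto dest: prime_gt_0_nat)
      also have "\<dots> = real (prime_count n) * L" by (simp add: prime_count_def)
      also have "\<dots> \<le> (1 + d) * (real n / L) * L" using elim L by (intro mult_right_mono) (auto simp: L_def)
      also have "\<dots> = (1 + d) * real n" using L by simp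
      also have "\<dots> \<le> (1 + e) * real n" using e by (intro mult_right_mono) (auto simp: d_def)
      finally have upper: "?t n \<le> (1 + e) * real n" .
      define m where "m = nat \<lfloor>real n powr (1 - d)\<rfloor>"
      let ?Q = "{p. prime p \<and> p \<le> n \<and> m < p}"
      have "?P \<subseteq> ?Q \<union> {1..m}" using prime_gt_0_nat by (auto simp: Suc_le_eq)
      then have "card ?P \<le> card (?Q \<union> {1..m})"
        by (rule card_mono[rotated]) (auto intro: finite_subset[OF _ finite_primes_upto[of n]])
      also have "\<dots> \<le> card ?Q + card {1..m}" by (rule card_Un_le)
      finally have "real (prime_count n) \<le> real (card ?Q) + real m" by (simp add: prime_count_def)
      also have "real m \<le> real n powr (1 - d)" by (simp add: m_def)
      finally have "real (prime_count n) \<le> real (card ?Q) + real n powr (1 - d)" by simp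
      moreover define q where "q = real n / L"
      ultimately have "real (card ?Q) \<ge> (1 - d) * q - d * q"
        using elim by (simp only: L_def q_def) linarith
      moreover have "(1 - d) * q - d * q = (1 - 2 * d) * q" by (simp add: algebra_simps)
      ultimately have "real (card ?Q) \<ge> (1 - 2 * d) * (real n / L)" by (simp only: q_def)
      then have "(1 - 2 * d) * (real n / L) * ((1 - d) * L) \<le> real (card ?Q) * ((1 - d) * L)"
        using d L by (intro mult_right_mono) auto
      also have "\<dots> = (\<Sum>p\<in>?Q. (1 - d) * L)" by simp
      also have "\<dots> \<le> (\<Sum>p\<in>?Q. ln (real p))"
      proof (rule sum_mono)
        fix p assume p: "p \<in> ?Q"
        then have "real n powr (1 - d) \<le> real p"
          unfolding m_def by (auto simp: nat_less_iff floor_less_iff)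
        then have "ln (real n powr (1 - d)) \<le> ln (real p)"
          using elim p prime_gt_0_nat by (intro iffD2[OF ln_le_cancel_iff]) auto
        then show "(1 - d) * L \<le> ln (real p)" using elim by (simp add: L_def ln_powr)
      qed
      also have "\<dots> \<le> ?t n"
        unfolding theta by (intro sum_mono2) (auto dest: prime_gt_0_nat intro!: ln_ge_zero)
      finally have "(1 - 2 * d) * (1 - d) * real n \<le> ?t n"
        using L by (simp add: mult_ac)
      moreover have "(1 - e) * real n \<le> (1 - 2 * d) * (1 - d) * real n"
        by (intro mult_right_mono) (auto simp: d_def algebra_simps)
      ultimately show ?case using upper by linarith
    qed
  qed
qed

definition prime_reciprocal_sum :: "nat \<Rightarrow> real" where
  "prime_reciprocal_sum n = (\<Sum>p | prime p \<and> p \<le> n. 1 / real p)"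

text \<open>A weak form of Mertens' second theorem: partial summation of ln p against 1 / (x ln x),
  whose primitive is ln (ln x).\<close>

lemma prime_reciprocal_sum_asymp_equiv:
  assumes HL: "hardy_littlewood_prime_pairs"
  shows "prime_reciprocal_sum \<sim>[sequentially] (\<lambda>n. ln (ln (real n)))"
proof -
  have "(\<lambda>n. \<Sum>k\<le>n. (if prime k then ln (real k) else 0) * (1 / (real k * ln (real k))))
          \<sim>[sequentially] (\<lambda>n. ln (ln (real n)))"
  proof (rule weighted_sum_asymp_equiv[OF sum_ln_primes_asymp_equiv[OF HL], where ?x0.0 = 2])
    fix x :: real assume x: "x \<ge> 2"
    then have "ln x > 0" by simp
    then show "((\<lambda>x. ln (ln x)) has_real_derivative 1 / (x * ln x)) (at x)"
      using x by (auto intro!: derivative_eq_intros simp: field_simps)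
    show "1 / (x * ln x) \<ge> 0" using x by simp
  next
    fix x y :: real assume "2 \<le> x" "x \<le> y"
    then show "1 / (y * ln y) \<le> 1 / (x * ln x)"
      by (intro divide_left_mono mult_mono mult_pos_pos) auto
  qed real_asymp
  moreover have "(\<Sum>k\<le>n. (if prime k then ln (real k) else 0) * (1 / (real k * ln (real k)))) =
      prime_reciprocal_sum n" for n
    unfolding prime_reciprocal_sum_def
  proof (rule sum.mono_neutral_cong_right)
    fix p assume "p \<in> {p. prime p \<and> p \<le> n}"
    then show "(if prime p then ln (real p) else 0) * (1 / (real p * ln (real p))) = 1 / real p"
      using prime_gt_1_nat[of p] by simp
  qed auto
  ultimately show ?thesis by (simp only:)
qed

text \<open>Let L = ln N and l = ln L. The primes between L and z have reciprocal sum (1 + o(1)) l,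
  since ln (ln z) is about l - ln (60 l) and ln (ln L) = ln l is of lower order. Hence exp (- S) is
  L powr (o(1) - 3), and a depth r proportional to l makes both the tail and the remainder
  smaller.\<close>

lemma prime_triple_count_bound:
  assumes HL: "hardy_littlewood_prime_pairs" and "\<eta> > 0"
  shows "\<forall>\<^sub>F N in sequentially. \<forall>a b. 0 < a \<and> a < b \<and> real b \<le> ln (real N) \<longrightarrow>
           real (prime_triple_count a b N) \<le> real N * ln (real N) powr (\<eta> - 3)"
proof -
  \<comment> \<open>The exponent loses 6 * e through the lower bound for S and 2 * e in absorbing a
    factor 3, in total 8 * e \<le> \<eta>.\<close>
  define e where "e = min \<eta> 1 / 8"
  have e: "e > 0" "8 * e \<le> \<eta>" "8 * e \<le> 1" "e < 1" using \<open>\<eta> > 0\<close> by (auto simp: e_def min_def)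
  \<comment> \<open>The 60 leaves room for the remainder: with r about 16 ln (ln N), z ^ r is about
    N powr (16 / 60), below the square root of N even after the constants are included.\<close>
  define z where "z N = nat \<lfloor>exp (ln (real N) / (60 * ln (ln (real N))))\<rfloor>" for N :: nat
  define w where "w N = nat \<lfloor>ln (real N)\<rfloor>" for N :: nat
  have z_top: "filterlim z at_top sequentially" unfolding z_def by real_asymp
  have w_top: "filterlim w at_top sequentially" unfolding w_def by real_asymp
  have LL: "\<forall>\<^sub>F N in sequentially. ln (ln (real N)) > 0" by real_asymp
  have Rz: "\<forall>\<^sub>F N in sequentially. (1 - e) * ln (ln (real N)) \<le> prime_reciprocal_sum (z N) \<and>
              prime_reciprocal_sum (z N) \<le> (1 + e) * ln (ln (real N))"
  proof -
    have "(\<lambda>N. prime_reciprocal_sum (z N)) \<sim>[sequentially] (\<lambda>N. ln (ln (real (z N))))"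
      by (rule asymp_equiv_compose'[OF prime_reciprocal_sum_asymp_equiv[OF HL] z_top])
    also have "(\<lambda>N. ln (ln (real (z N)))) \<sim>[sequentially] (\<lambda>N. ln (ln (real N)))"
      unfolding z_def by real_asymp
    finally show ?thesis using e unfolding asymp_equiv_at_top_iff[OF LL] by blast
  qed
  \<comment> \<open>Leaving out the primes up to ln N costs about ln (ln (ln N)), negligible against
    ln (ln N).\<close>
  have Rw: "\<forall>\<^sub>F N in sequentially. prime_reciprocal_sum (w N) \<le> e * ln (ln (real N))"
  proof -
    have "\<forall>\<^sub>F n in sequentially. ln (ln (real n)) > 0" by real_asymp
    then have "\<forall>\<^sub>F n in sequentially. prime_reciprocal_sum n \<le> (1 + e) * ln (ln (real n))"
      using prime_reciprocal_sum_asymp_equiv[OF HL] e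
      by (subst (asm) asymp_equiv_at_top_iff) (auto elim: eventually_mono)
    then have "\<forall>\<^sub>F N in sequentially. prime_reciprocal_sum (w N) \<le> (1 + e) * ln (ln (real (w N)))"
      using w_top by (rule eventually_compose_filterlim)
    moreover have "\<forall>\<^sub>F N in sequentially. (1 + e) * ln (ln (real (w N))) \<le> e * ln (ln (real N))"
      using e unfolding w_def by real_asymp
    ultimately show ?thesis by eventually_elim linarith
  qed
  have small: "\<forall>\<^sub>F N in sequentially. exp (ln (real N) / (60 * ln (ln (real N)))) +
      exp ((ln 4 + ln (real N) / (60 * ln (ln (real N)))) * (16 * ln (ln (real N)) + 2))
        \<le> real N * ln (real N) powr (- 4)"
  proof -
    have "\<forall>\<^sub>F N in sequentially. ln (real N) / (60 * ln (ln (real N))) \<le> 1 / 2 * ln (real N)"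
      by real_asymp
    moreover have "\<forall>\<^sub>F N in sequentially. (ln 4 + ln (real N) / (60 * ln (ln (real N)))) *
        (16 * ln (ln (real N)) + 2) \<le> 1 / 2 * ln (real N)"
      by real_asymp
    moreover have "\<forall>\<^sub>F N in sequentially. 2 * real N powr (1 / 2) \<le> real N * ln (real N) powr (- 4)"
      by real_asymp
    moreover have "\<forall>\<^sub>F N in sequentially. N > (0::nat)" by (rule eventually_gt_at_top)
    ultimately show ?thesis
    proof eventually_elim
      case (elim N)
      have "exp (1 / 2 * ln (real N)) = real N powr (1 / 2)" using elim by (simp add: powr_def)
      with iffD2[OF exp_le_cancel_iff elim(1)] iffD2[OF exp_le_cancel_iff elim(2)] elim(3)
      show ?case by linarith
    qed
  qed
  have three: "\<forall>\<^sub>F N in sequentially. 3 \<le> ln (real N) powr (2 * e)"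
    using e by real_asymp
  have L1: "\<forall>\<^sub>F N in sequentially. ln (real N) > 1" by real_asymp
  show ?thesis using LL Rz Rw small three L1
  proof eventually_elim
    case (elim N)
    show ?case
    proof (intro allI impI)
      fix a b :: nat assume ab: "0 < a \<and> a < b \<and> real b \<le> ln (real N)"
      define L where "L = ln (real N)"
      define l where "l = ln L"
      \<comment> \<open>Even, as the Bonferroni inequality demands, and at least 16 l: with S \<le>
        4 l this gives exp (3 * S - r) \<le> L powr (- 4).\<close>
      define r where "r = 2 * nat \<lceil>8 * l\<rceil>"
      define P where "P = {p. prime p \<and> w N < p \<and> p \<le> z N}"
      define S where "S = (\<Sum>p\<in>P. 3 / real p)"
      define Z where "Z = exp (L / (60 * l))"
      have L: "L > 1" "l > 0" using elim by (simp_all add: L_def l_def)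
      have r: "16 * l \<le> real r" "real r \<le> 16 * l + 2" using L unfolding r_def by linarith+
      have N: "real N > 0" using L by (cases "N = 0") (auto simp: L_def)
      have Z: "real (z N) \<le> Z" "1 \<le> Z" using L by (auto simp: z_def Z_def L_def l_def)
      have finP: "finite P" by (rule finite_subset[of _ "{..z N}"]) (auto simp: P_def)
      have S_upper: "S \<le> 4 * l"
      proof -
        have "S = 3 * (\<Sum>p\<in>P. 1 / real p)" by (simp add: S_def sum_distrib_left)
        also have "\<dots> \<le> 3 * prime_reciprocal_sum (z N)"
          unfolding prime_reciprocal_sum_def by (intro mult_left_mono sum_mono2) (auto simp: P_def)
        also have "\<dots> \<le> 3 * ((1 + e) * l)" using elim by (simp add: L_def l_def)
        also have "\<dots> = 3 * (1 + e) * l" by simp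
        also have "\<dots> \<le> 4 * l" using e L by (intro mult_right_mono) auto
        finally show ?thesis .
      qed
      have S_lower: "S \<ge> (3 - 6 * e) * l"
      proof -
        have "prime_reciprocal_sum (z N) \<le> (\<Sum>p\<in>P \<union> {p. prime p \<and> p \<le> w N}. 1 / real p)"
          unfolding prime_reciprocal_sum_def by (rule sum_mono2) (use finP in \<open>auto simp: P_def\<close>)
        also have "\<dots> = (\<Sum>p\<in>P. 1 / real p) + prime_reciprocal_sum (w N)"
          unfolding prime_reciprocal_sum_def by (rule sum.union_disjoint) (use finP in \<open>auto simp: P_def\<close>)
        finally have "(1 - e) * l - e * l \<le> (\<Sum>p\<in>P. 1 / real p)"
          using elim by (simp add: L_def l_def)
        moreover have "S = 3 * (\<Sum>p\<in>P. 1 / real p)" by (simp add: S_def sum_distrib_left)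
        ultimately show ?thesis by (simp add: algebra_simps)
      qed
      have "b \<le> w N" using ab by (simp add: w_def le_nat_floor)
      then have "real (prime_triple_count a b N) \<le> real (z N)
          + real N * (exp (- S) + exp (3 * S - real r)) + (1 + 3 * real (z N)) ^ r"
        unfolding S_def P_def using ab by (intro prime_triple_count_le) (auto simp: r_def)
      also have "exp (- S) \<le> L powr (6 * e - 3)"
        using S_lower L by (simp add: powr_def l_def algebra_simps)
      also have "exp (3 * S - real r) \<le> L powr (- 4)"
        using S_upper r L by (simp add: powr_def l_def)
      also have "(1 + 3 * real (z N)) ^ r \<le> exp ((ln 4 + L / (60 * l)) * (16 * l + 2))"
      proof -
        have "(1 + 3 * real (z N)) ^ r \<le> (4 * Z) ^ r" using Z by (intro power_mono) auto
        also have "\<dots> = exp ((ln 4 + L / (60 * l)) * real r)"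
          by (simp add: exp_of_nat2_mult exp_add Z_def)
        also have "\<dots> \<le> exp ((ln 4 + L / (60 * l)) * (16 * l + 2))"
          using r L by (intro iffD2[OF exp_le_cancel_iff] mult_left_mono add_nonneg_nonneg) auto
        finally show ?thesis .
      qed
      also note Z(1)
      finally have "real (prime_triple_count a b N) \<le> Z + real N * (L powr (6 * e - 3) + L powr (- 4))
          + exp ((ln 4 + L / (60 * l)) * (16 * l + 2))" using N by simp
      also have "\<dots> \<le> real N * (L powr (6 * e - 3) + 2 * L powr (- 4))"
        using elim(4) by (simp add: Z_def L_def l_def algebra_simps)
      also have "\<dots> \<le> real N * (L powr (6 * e - 3) + 2 * L powr (6 * e - 3))"
        using N L e by (intro mult_left_mono add_left_mono powr_mono) auto
      also have "\<dots> = real N * (3 * L powr (6 * e - 3))" by simp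
      also have "\<dots> \<le> real N * (L powr (2 * e) * L powr (6 * e - 3))"
        using elim(5) N by (intro mult_left_mono mult_right_mono) (auto simp: L_def)
      also have "\<dots> = real N * L powr (8 * e - 3)" by (simp add: powr_add [symmetric])
      also have "\<dots> \<le> real N * L powr (\<eta> - 3)"
        using N L e by (intro mult_left_mono powr_mono) auto
      finally show "real (prime_triple_count a b N) \<le> real N * ln (real N) powr (\<eta> - 3)"
        by (simp add: L_def)
    qed
  qed
qed

section \<open>Prime gaps\<close>

lemma nth_prime_Suc: "nth_prime (Suc n) = enumerate {p. prime p} n"
  by (simp add: nth_prime_def)

lemma prime_nth_prime: "prime (nth_prime n)"
  using enumerate_in_set[OF primes_infinite, of "n - 1"] by (simp add: nth_prime_def)

lemma nth_prime_less:
  assumes "1 \<le> m" "m < n"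
  shows "nth_prime m < nth_prime n"
  unfolding nth_prime_def using assms by (intro enumerate_mono primes_infinite) auto

lemma nth_prime_le_iff:
  assumes "1 \<le> m" "1 \<le> n"
  shows "nth_prime m \<le> nth_prime n \<longleftrightarrow> m \<le> n"
  using nth_prime_less[of m n] nth_prime_less[of n m] assms by (cases m n rule: linorder_cases) auto

lemma nth_prime_surj:
  assumes "prime p"
  obtains k where "k \<ge> 1" "nth_prime k = p"
proof -
  obtain n where "enumerate {p::nat. prime p} n = p"
    using enumerate_Ex[of "{p::nat. prime p}" p] assms primes_infinite by auto
  then show ?thesis using that[of "Suc n"] by (simp add: nth_prime_Suc)
qed

lemma nth_prime_next_le:
  assumes "prime q" "nth_prime k < q" "k \<ge> 1"
  shows "nth_prime (k + 1) \<le> q"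
proof -
  obtain j where j: "j \<ge> 1" "nth_prime j = q" using nth_prime_surj[OF assms(1)] by blast
  then have "k < j" using assms nth_prime_le_iff[of j k] by auto
  then show ?thesis using j nth_prime_le_iff[of "k + 1" j] by auto
qed

lemma nth_prime_gap: "k \<ge> 1 \<Longrightarrow> nth_prime k + prime_gap k = nth_prime (k + 1)"
  using nth_prime_less[of k "k + 1"] by (simp add: prime_gap_def)

lemma prime_gap_pos: "k \<ge> 1 \<Longrightarrow> prime_gap k > 0"
  using nth_prime_less[of k "k + 1"] by (simp add: prime_gap_def)

lemma nth_prime_gt_2: "k \<ge> 2 \<Longrightarrow> nth_prime k > 2"
  using nth_prime_less[of 1 k] prime_ge_2_nat[OF prime_nth_prime[of 1]] by linarith

lemma prime_gap_even:
  assumes "k \<ge> 2"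
  shows "even (prime_gap k)" "prime_gap k \<ge> 2"
proof -
  have "odd (nth_prime k)" "odd (nth_prime (k + 1))"
    using prime_odd_nat[OF prime_nth_prime nth_prime_gt_2] assms by simp_all
  then show "even (prime_gap k)"
    using nth_prime_gap[of k] assms by (metis even_add le_trans one_le_numeral)
  then show "prime_gap k \<ge> 2"
    using prime_gap_pos[of k] assms by (cases "prime_gap k = 1") auto
qed

lemma prime_count_nth_prime:
  assumes "n \<ge> 1"
  shows "prime_count (nth_prime n) = n"
proof -
  have "{p. prime p \<and> p \<le> nth_prime n} = nth_prime ` {1..n}"
  proof (intro equalityI subsetI)
    fix p assume p: "p \<in> {p. prime p \<and> p \<le> nth_prime n}"
    then obtain k where "k \<ge> 1" "nth_prime k = p" using nth_prime_surj[of p] by blast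
    with p assms show "p \<in> nth_prime ` {1..n}" using nth_prime_le_iff[of k n] by auto
  next
    fix p assume "p \<in> nth_prime ` {1..n}"
    then show "p \<in> {p. prime p \<and> p \<le> nth_prime n}"
      using assms nth_prime_le_iff[of _ n] by (auto simp: prime_nth_prime)
  qed
  moreover have "inj_on nth_prime {1..n}"
  proof (rule inj_onI)
    fix j k assume "j \<in> {1..n}" "k \<in> {1..n}" "nth_prime j = nth_prime k"
    then show "j = k" using nth_prime_le_iff[of j k] nth_prime_le_iff[of k j] by auto
  qed
  ultimately show ?thesis by (simp add: prime_count_def card_image)
qed

lemma filterlim_nth_prime: "filterlim nth_prime at_top sequentially"
proof (rule filterlim_at_top_mono[OF filterlim_ident])
  show "\<forall>\<^sub>F n in sequentially. n \<le> nth_prime n"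
    using eventually_ge_at_top[of 1]
  proof eventually_elim
    case (elim n)
    have "prime_count (nth_prime n) \<le> card {1..nth_prime n}"
      unfolding prime_count_def using prime_gt_0_nat by (intro card_mono) (auto simp: Suc_le_eq)
    with elim show ?case by (simp add: prime_count_nth_prime)
  qed
qed

section \<open>Gaps of a given size\<close>

definition gap_count :: "nat \<Rightarrow> nat \<Rightarrow> nat" where
  "gap_count n d = card {k\<in>{2..n}. prime_gap k = d}"

text \<open>The index range starts at 2, which leaves out the only odd gap, from 2 to 3; so every
  gap counted falls under the conjecture's parity condition.\<close>

lemma gap_count_eq_0: "odd d \<or> d < 2 \<Longrightarrow> gap_count n d = 0"
proof -
  assume "odd d \<or> d < 2"
  then have "{k\<in>{2..n}. prime_gap k = d} = {}" using prime_gap_even by fastforce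
  then show ?thesis by (simp only: gap_count_def card.empty)
qed

lemma gap_count_le: "gap_count n d \<le> prime_pair_count d (real (nth_prime (n + 1)))"
proof -
  have "gap_count n d = card (nth_prime ` {k\<in>{2..n}. prime_gap k = d})"
    unfolding gap_count_def
  proof (rule card_image [symmetric], rule inj_onI)
    fix j k assume "j \<in> {k\<in>{2..n}. prime_gap k = d}" "k \<in> {k\<in>{2..n}. prime_gap k = d}"
      "nth_prime j = nth_prime k"
    then show "j = k" using nth_prime_le_iff[of j k] nth_prime_le_iff[of k j] by auto
  qed
  also have "\<dots> \<le> prime_pair_count d (real (nth_prime (n + 1)))"
    unfolding prime_pair_count_nat
  proof (rule card_mono)
    show "nth_prime ` {k\<in>{2..n}. prime_gap k = d} \<subseteq>
        {p\<in>{p. prime p \<and> p \<le> nth_prime (n + 1)}. p + d \<in> {p. prime p \<and> p \<le> nth_prime (n + 1)}}"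
    proof
      fix p assume "p \<in> nth_prime ` {k\<in>{2..n}. prime_gap k = d}"
      then obtain k where k: "2 \<le> k" "k \<le> n" "prime_gap k = d" "p = nth_prime k" by auto
      have "p + d = nth_prime (k + 1)" using nth_prime_gap[of k] k by simp
      then show "p \<in> {p\<in>{p. prime p \<and> p \<le> nth_prime (n + 1)}. p + d \<in> {p. prime p \<and> p \<le> nth_prime (n + 1)}}"
        using k nth_prime_le_iff[of k "n + 1"] nth_prime_le_iff[of "k + 1" "n + 1"]
        by (simp add: prime_nth_prime)
    qed
  qed (auto intro: finite_subset[OF _ finite_primes_upto])
  finally show ?thesis .
qed

text \<open>If p and p + d are primes but not consecutive, the prime after p is p + a with 0 < a <
  d, so p begins a triple.\<close>

lemma prime_pair_count_le_gap_count:
  assumes "even d" "2 \<le> d"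
  shows "prime_pair_count d (real (nth_prime (n + 1))) \<le>
           gap_count n d + (\<Sum>a\<in>{1..<d}. prime_triple_count a d (nth_prime (n + 1)))"
proof -
  let ?Y = "nth_prime (n + 1)"
  let ?T = "\<lambda>a. {p. prime p \<and> prime (p + a) \<and> prime (p + d) \<and> p + d \<le> ?Y}"
  let ?G = "{k\<in>{2..n}. prime_gap k = d}"
  have finT: "finite (?T a)" for a by (rule finite_subset[of _ "{..?Y}"]) auto
  have "{p\<in>{p. prime p \<and> p \<le> ?Y}. p + d \<in> {p. prime p \<and> p \<le> ?Y}} \<subseteq>
      nth_prime ` ?G \<union> (\<Union>a\<in>{1..<d}. ?T a)"
  proof
    fix p assume "p \<in> {p\<in>{p. prime p \<and> p \<le> ?Y}. p + d \<in> {p. prime p \<and> p \<le> ?Y}}"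
    then have p: "prime p" "prime (p + d)" "p + d \<le> ?Y" by auto
    obtain k where k: "k \<ge> 1" "nth_prime k = p" using nth_prime_surj[OF p(1)] by blast
    have next_le: "nth_prime (k + 1) \<le> p + d"
      using k assms p by (intro nth_prime_next_le) auto
    \<comment> \<open>Index 1 lies outside \<open>gap_count\<close>; it would mean p = 2, but then p
      + d is even and exceeds 2.\<close>
    have "k \<noteq> 1"
    proof
      assume "k = 1"
      obtain j where j: "j \<ge> 1" "nth_prime j = 2" using nth_prime_surj[OF two_is_prime_nat] by blast
      have "p \<le> 2" using nth_prime_le_iff[of 1 j] j k \<open>k = 1\<close> by simp
      then have "p = 2" using prime_ge_2_nat[OF p(1)] by simp
      then have "even (p + d)" "p + d > 2" using assms by auto
      then show False using prime_odd_nat[OF p(2)] by simp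
    qed
    then have k2: "k \<ge> 2" using k by simp
    have "nth_prime (k + 1) \<le> ?Y" using next_le p(3) by simp
    then have kn: "k \<le> n" using nth_prime_le_iff[of "k + 1" "n + 1"] by simp
    have gap: "p + prime_gap k = nth_prime (k + 1)" using nth_prime_gap[of k] k by simp
    show "p \<in> nth_prime ` ?G \<union> (\<Union>a\<in>{1..<d}. ?T a)"
    proof (cases "prime_gap k = d")
      case True
      then have "k \<in> ?G" using k2 kn by simp
      then show ?thesis using k(2) by blast
    next
      case False
      then have "prime_gap k \<in> {1..<d}"
        using gap next_le prime_gap_pos[OF k(1)] by auto
      moreover have "p \<in> ?T (prime_gap k)"
        using p gap prime_nth_prime[of "k + 1"] by simp
      ultimately show ?thesis by blast
    qed
  qed
  then have "prime_pair_count d (real ?Y) \<le> card (nth_prime ` ?G \<union> (\<Union>a\<in>{1..<d}. ?T a))"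
    unfolding prime_pair_count_nat using finT by (intro card_mono) auto
  also have "\<dots> \<le> card (nth_prime ` ?G) + card (\<Union>a\<in>{1..<d}. ?T a)" by (rule card_Un_le)
  also have "\<dots> \<le> card ?G + (\<Sum>a\<in>{1..<d}. card (?T a))"
    by (intro add_mono card_image_le card_UN_le) auto
  finally show ?thesis by (simp add: gap_count_def prime_triple_count_def)
qed

section \<open>The weight (log x)^\<alpha> / x and its primitive\<close>

definition gap_weight :: "real \<Rightarrow> real \<Rightarrow> real" where
  "gap_weight \<alpha> x = ln x powr \<alpha> / x"

text \<open>The second branch serves \<alpha> = -1. Evaluated at log X, the two branches give the
  power of log log X and the triple logarithm of the theorem.\<close>

definition gap_weight_primitive :: "real \<Rightarrow> real \<Rightarrow> real" where
  "gap_weight_primitive \<alpha> x = (if \<alpha> > -1 then ln x powr (1 + \<alpha>) / (1 + \<alpha>) else ln (ln x))"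

lemma gap_weight_nonneg: "x \<ge> 0 \<Longrightarrow> gap_weight \<alpha> x \<ge> 0"
  by (simp add: gap_weight_def)

text \<open>With t = ln y / ln x \<ge> 1 and 0 \<le> \<alpha> \<le> ln x one has \<alpha> ln t \<le>
  ln x (t - 1) = ln y - ln x; for negative \<alpha> the left side is at most 0. The 1 in the maximum
  keeps ln x positive.\<close>

lemma gap_weight_antimono:
  assumes "exp (max 1 \<alpha>) \<le> x" "x \<le> y"
  shows "gap_weight \<alpha> y \<le> gap_weight \<alpha> x"
proof -
  have x0: "x > 0" using assms(1) exp_gt_zero less_le_trans by blast
  have "ln (exp (max 1 \<alpha>)) \<le> ln x" using assms(1) x0 by (intro iffD2[OF ln_le_cancel_iff] exp_gt_zero)
  then have lnx: "max 1 \<alpha> \<le> ln x" by (simp only: ln_exp)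
  have lny: "ln x \<le> ln y" using x0 assms(2) by simp
  define t where "t = ln y / ln x"
  have t: "t \<ge> 1" "ln y = t * ln x" using lnx lny by (auto simp: t_def)
  have "\<alpha> * ln t \<le> ln y - ln x"
  proof (cases "\<alpha> \<ge> 0")
    case True
    have "\<alpha> * ln t \<le> ln x * (t - 1)"
      using True lnx t ln_le_minus_one[of t] by (intro mult_mono) auto
    then show ?thesis using t by (simp add: algebra_simps)
  next
    case False
    then have "\<alpha> * ln t \<le> 0" using t by (intro mult_nonpos_nonneg) auto
    then show ?thesis using lny by simp
  qed
  then have "exp (\<alpha> * ln t) \<le> exp (ln y - ln x)" by simp
  moreover have "exp (ln y - ln x) = y / x" using x0 assms(2) by (simp add: exp_diff)
  moreover have "exp (\<alpha> * ln t) = t powr \<alpha>" using t by (simp add: powr_def)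
  ultimately have "t powr \<alpha> \<le> y / x" by simp
  moreover have "ln y powr \<alpha> = t powr \<alpha> * ln x powr \<alpha>"
    using t lnx by (simp add: powr_mult)
  ultimately have "ln y powr \<alpha> \<le> y / x * ln x powr \<alpha>"
    by (simp only: mult_right_mono powr_ge_zero)
  then have "ln y powr \<alpha> / y \<le> y / x * ln x powr \<alpha> / y"
    using x0 assms(2) by (intro divide_right_mono) auto
  then show ?thesis using x0 assms(2) by (simp add: gap_weight_def)
qed

lemma gap_weight_primitive_has_derivative:
  assumes "\<alpha> \<ge> -1" "x > 1"
  shows "(gap_weight_primitive \<alpha> has_real_derivative gap_weight \<alpha> x) (at x)"
proof (cases "\<alpha> > -1")
  case True
  have "((\<lambda>x. ln x powr (1 + \<alpha>) / (1 + \<alpha>)) has_real_derivative gap_weight \<alpha> x) (at x)"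
  proof -
    have "((\<lambda>x. ln x powr (1 + \<alpha>) / (1 + \<alpha>)) has_real_derivative
        (1 + \<alpha>) * ln x powr (1 + \<alpha> - 1) * (1 / x) / (1 + \<alpha>)) (at x)"
      using assms by (intro DERIV_cdivide DERIV_chain2[OF has_real_derivative_powr DERIV_ln_divide]) auto
    then show ?thesis using True by (simp add: gap_weight_def)
  qed
  then show ?thesis using True by (simp add: gap_weight_primitive_def [abs_def])
next
  case False
  then have \<alpha>: "\<alpha> = -1" using assms by simp
  have "((\<lambda>x. ln (ln x)) has_real_derivative gap_weight \<alpha> x) (at x)"
    unfolding gap_weight_def \<alpha> using assms
    by (auto intro!: derivative_eq_intros simp: powr_minus field_simps)
  then show ?thesis using False by (simp add: gap_weight_primitive_def [abs_def])
qed

lemma gap_weight_primitive_at_top: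
  assumes "\<alpha> \<ge> -1"
  shows "filterlim (gap_weight_primitive \<alpha>) at_top at_top"
proof (cases "\<alpha> > -1")
  case True
  have "filterlim (\<lambda>x. ln x powr (1 + \<alpha>) / (1 + \<alpha>)) at_top at_top"
  proof -
    have *: "filterlim (\<lambda>x. ln x powr b / b) at_top at_top" if "b > 0" for b :: real
      using that by real_asymp
    show ?thesis using *[of "1 + \<alpha>"] True by simp
  qed
  then show ?thesis using True by (simp add: gap_weight_primitive_def [abs_def])
next
  case False
  have "filterlim (\<lambda>x::real. ln (ln x)) at_top at_top" by real_asymp
  then show ?thesis using False by (simp add: gap_weight_primitive_def [abs_def])
qed

text \<open>Gaps above L contribute at most of order (Y / L) * gap_weight \<alpha> L, that is (Y /
  L^2) (ln L) powr \<alpha>; this makes them negligible.\<close>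

lemma ln_powr_le_gap_weight_primitive:
  assumes "\<alpha> \<ge> -1" "e > 0"
  shows "\<forall>\<^sub>F x in at_top. ln x powr \<alpha> \<le> e * gap_weight_primitive \<alpha> x"
proof (cases "\<alpha> > -1")
  case True
  define b where "b = 1 + \<alpha>"
  have b: "b > 0" using True by (simp add: b_def)
  have "\<forall>\<^sub>F x::real in at_top. ln x \<ge> b / e" by real_asymp
  moreover have "\<forall>\<^sub>F x::real in at_top. ln x > 0" by real_asymp
  ultimately show ?thesis
  proof eventually_elim
    case (elim x)
    have "ln x powr \<alpha> = ln x powr b / ln x"
      using elim by (simp add: b_def powr_add)
    also have "\<dots> \<le> ln x powr b / (b / e)"
      using elim b assms by (intro divide_left_mono) auto
    finally show ?case using True assms by (simp add: gap_weight_primitive_def b_def mult.commute)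
  qed
next
  case False
  then have \<alpha>: "\<alpha> = -1" using assms by simp
  have "\<forall>\<^sub>F x in at_top. ln x powr -1 \<le> e * ln (ln x)" using assms by real_asymp
  then show ?thesis by (simp add: \<alpha> gap_weight_primitive_def)
qed

text \<open>This is the price of keeping only d \<le> L powr c. As ln (x powr c) = c ln x, the
  primitive is multiplied by c powr (1 + \<alpha>), close to 1 for c close to 1; for \<alpha> = -1
  only the constant ln c is added, so c = 1 / 2 will do.\<close>

lemma gap_weight_primitive_powr:
  assumes "\<alpha> \<ge> -1" "e > 0"
  shows "\<exists>c. 0 < c \<and> c < 1 \<and>
           (\<forall>\<^sub>F x in at_top. gap_weight_primitive \<alpha> (x powr c) \<ge> (1 - e) * gap_weight_primitive \<alpha> x)"
proof (cases "\<alpha> > -1")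
  case True
  define b where "b = 1 + \<alpha>"
  have b: "b > 0" using True by (simp add: b_def)
  \<comment> \<open>Chosen so that c powr b = max (1 / 2) (1 - e / 2); the maximum keeps this
    positive when e is large.\<close>
  define c where "c = (max (1 / 2) (1 - e / 2)) powr (1 / b)"
  have c: "c > 0" "c < 1" "c powr b \<ge> 1 - e"
    using b assms powr_less_mono2[of "1 / b" "max (1 / 2) (1 - e / 2)" 1]
    by (auto simp: c_def powr_powr)
  have "\<forall>\<^sub>F x::real in at_top. ln x > 0" by real_asymp
  then have "\<forall>\<^sub>F x in at_top. gap_weight_primitive \<alpha> (x powr c) \<ge> (1 - e) * gap_weight_primitive \<alpha> x"
  proof eventually_elim
    case (elim x)
    have "gap_weight_primitive \<alpha> (x powr c) = c powr b * (ln x powr b / b)"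
      using elim c True by (simp add: gap_weight_primitive_def b_def ln_powr powr_mult)
    also have "\<dots> \<ge> (1 - e) * (ln x powr b / b)"
      using c b by (intro mult_right_mono) auto
    finally show ?case using True by (simp add: gap_weight_primitive_def b_def)
  qed
  with c show ?thesis by blast
next
  case False
  have "\<forall>\<^sub>F x in at_top. ln (ln (x powr (1 / 2))) \<ge> (1 - e) * ln (ln x)"
    using assms by real_asymp
  then show ?thesis using False by (intro exI[of _ "1 / 2"]) (simp add: gap_weight_primitive_def)
qed

lemma asymp_equiv_ln:
  fixes f g :: "'a \<Rightarrow> real"
  assumes fg: "f \<sim>[F] g" and g: "filterlim g at_top F"
  shows "(\<lambda>x. ln (f x)) \<sim>[F] (\<lambda>x. ln (g x))"
proof -
  have g1: "\<forall>\<^sub>F x in F. g x > 1" using g by (simp add: filterlim_at_top_dense)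
  have lim: "((\<lambda>x. f x / g x) \<longlongrightarrow> 1) F"
    by (rule asymp_equivD_strong[OF fg]) (use g1 in \<open>auto elim: eventually_mono\<close>)
  have pos: "\<forall>\<^sub>F x in F. f x / g x > 0" using lim by (rule order_tendstoD(1)) simp
  have "((\<lambda>x. ln (f x / g x)) \<longlongrightarrow> ln 1) F" using lim by (rule tendsto_ln) simp
  moreover have lng: "filterlim (\<lambda>x. ln (g x)) at_top F"
    by (rule filterlim_compose[OF ln_at_top g])
  ultimately have "((\<lambda>x. 1 + ln (f x / g x) / ln (g x)) \<longlongrightarrow> 1 + 0) F"
    by (intro tendsto_add tendsto_const real_tendsto_divide_at_top)
  then have "((\<lambda>x. 1 + ln (f x / g x) / ln (g x)) \<longlongrightarrow> 1) F" by simp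
  then have "((\<lambda>x. ln (f x) / ln (g x)) \<longlongrightarrow> 1) F"
  proof (rule Lim_transform_eventually)
    show "\<forall>\<^sub>F x in F. 1 + ln (f x / g x) / ln (g x) = ln (f x) / ln (g x)"
      using g1 pos
    proof eventually_elim
      case (elim x)
      then have "f x > 0" by (simp add: zero_less_divide_iff)
      with elim show ?case by (simp add: ln_div field_simps)
    qed
  qed
  then show ?thesis by (rule asymp_equivI')
qed

text \<open>The primitive depends on its argument only through ln, so it is insensitive to a factor
  1 + o(1), for instance to rounding.\<close>

lemma asymp_equiv_gap_weight_primitive:
  fixes f g :: "'a \<Rightarrow> real"
  assumes "\<alpha> \<ge> -1" "f \<sim>[F] g" "filterlim g at_top F"
  shows "(\<lambda>x. gap_weight_primitive \<alpha> (f x)) \<sim>[F] (\<lambda>x. gap_weight_primitive \<alpha> (g x))"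
proof -
  have f: "filterlim f at_top F"
    using asymp_equiv_at_top_transfer asymp_equiv_symI assms by blast
  have ln: "(\<lambda>x. ln (f x)) \<sim>[F] (\<lambda>x. ln (g x))" using assms by (intro asymp_equiv_ln)
  have lng: "filterlim (\<lambda>x. ln (g x)) at_top F" and lnf: "filterlim (\<lambda>x. ln (f x)) at_top F"
    by (rule filterlim_compose[OF ln_at_top]; fact)+
  show ?thesis
  proof (cases "\<alpha> > -1")
    case True
    have "(\<lambda>x. ln (f x) powr (1 + \<alpha>)) \<sim>[F] (\<lambda>x. ln (g x) powr (1 + \<alpha>))"
      using ln lnf lng by (intro asymp_equiv_powr_real) (auto simp: filterlim_at_top)
    then have "(\<lambda>x. ln (f x) powr (1 + \<alpha>) / (1 + \<alpha>)) \<sim>[F] (\<lambda>x. ln (g x) powr (1 + \<alpha>) / (1 + \<alpha>))"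
      by (intro asymp_equiv_divide asymp_equiv_refl)
    then show ?thesis using True by (simp add: gap_weight_primitive_def)
  next
    case False
    then show ?thesis using asymp_equiv_ln[OF ln lng] by (simp add: gap_weight_primitive_def)
  qed
qed

lemma sum_even_singular_series_gap_weight:
  assumes "\<alpha> \<ge> -1"
  shows "(\<lambda>n. \<Sum>d\<le>n. even_singular_series d * gap_weight \<alpha> (real d))
           \<sim>[sequentially] (\<lambda>n. gap_weight_primitive \<alpha> (real n))"
proof (rule weighted_sum_asymp_equiv[OF even_singular_series_sum_asymp_equiv])
  fix x :: real assume x: "exp (max 1 \<alpha>) \<le> x"
  then have "exp 1 \<le> x" using order_trans[OF _ x, of "exp 1"] by simp
  then have "x > 1" using exp_gt_one[of "1::real"] by linarith
  then show "(gap_weight_primitive \<alpha> has_real_derivative gap_weight \<alpha> x) (at x)"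
    using assms by (intro gap_weight_primitive_has_derivative)
  show "gap_weight \<alpha> x \<ge> 0" using \<open>x > 1\<close> by (intro gap_weight_nonneg) simp
next
  fix x y :: real assume "exp (max 1 \<alpha>) \<le> x" "x \<le> y"
  then show "gap_weight \<alpha> y \<le> gap_weight \<alpha> x" by (rule gap_weight_antimono)
qed (rule gap_weight_primitive_at_top[OF assms])

section \<open>Splitting the gap sum by the size of the gaps\<close>

definition gap_sum :: "real \<Rightarrow> nat \<Rightarrow> real" where
  "gap_sum \<alpha> n = (\<Sum>k=2..n. gap_weight \<alpha> (real (prime_gap k)))"

lemma gap_sum_small_gaps:
  "(\<Sum>k | k \<in> {2..n} \<and> prime_gap k \<le> h. gap_weight \<alpha> (real (prime_gap k))) =
     (\<Sum>d\<le>h. gap_weight \<alpha> (real d) * real (gap_count n d))"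
proof -
  let ?S = "{k. k \<in> {2..n} \<and> prime_gap k \<le> h}"
  have "(\<Sum>k\<in>?S. gap_weight \<alpha> (real (prime_gap k))) =
      (\<Sum>d\<le>h. \<Sum>k | k \<in> ?S \<and> prime_gap k = d. gap_weight \<alpha> (real (prime_gap k)))"
    by (rule sum.group [symmetric]) auto
  also have "\<dots> = (\<Sum>d\<le>h. gap_weight \<alpha> (real d) * real (gap_count n d))"
  proof (intro sum.cong refl)
    fix d assume "d \<in> {..h}"
    then have "{k. k \<in> ?S \<and> prime_gap k = d} = {k\<in>{2..n}. prime_gap k = d}" by auto
    then show "(\<Sum>k | k \<in> ?S \<and> prime_gap k = d. gap_weight \<alpha> (real (prime_gap k))) =
        gap_weight \<alpha> (real d) * real (gap_count n d)"
      by (simp add: gap_count_def mult.commute)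
  qed
  finally show ?thesis .
qed

lemma gap_sum_lower_small_gaps:
  "(\<Sum>d\<le>h. gap_weight \<alpha> (real d) * real (gap_count n d)) \<le> gap_sum \<alpha> n"
  unfolding gap_sum_small_gaps [symmetric] gap_sum_def
  by (intro sum_mono2) (auto intro: gap_weight_nonneg)

text \<open>A gap exceeding h is at least h + 1 \<ge> L, and from L on the weight decreases; the
  number of such gaps is bounded by n.\<close>

lemma gap_sum_upper_small_gaps:
  assumes "exp (max 1 \<alpha>) \<le> L" "L \<le> real h + 1"
  shows "gap_sum \<alpha> n \<le> (\<Sum>d\<le>h. gap_weight \<alpha> (real d) * real (gap_count n d)) + real n * gap_weight \<alpha> L"
proof -
  let ?S = "{k. k \<in> {2..n} \<and> prime_gap k \<le> h}" and ?B = "{k. k \<in> {2..n} \<and> h < prime_gap k}"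
  have L0: "L > 0" using assms(1) exp_gt_zero less_le_trans by blast
  have "{2..n} = ?S \<union> ?B" by auto
  then have "gap_sum \<alpha> n = (\<Sum>k\<in>?S \<union> ?B. gap_weight \<alpha> (real (prime_gap k)))"
    by (simp only: gap_sum_def)
  also have "\<dots> = (\<Sum>k\<in>?S. gap_weight \<alpha> (real (prime_gap k))) + (\<Sum>k\<in>?B. gap_weight \<alpha> (real (prime_gap k)))"
    by (rule sum.union_disjoint) auto
  also have "(\<Sum>k\<in>?B. gap_weight \<alpha> (real (prime_gap k))) \<le> (\<Sum>k\<in>?B. gap_weight \<alpha> L)"
  proof (rule sum_mono)
    fix k assume "k \<in> ?B"
    then have "L \<le> real (prime_gap k)" using assms(2) by simp
    then show "gap_weight \<alpha> (real (prime_gap k)) \<le> gap_weight \<alpha> L"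
      using assms(1) by (intro gap_weight_antimono)
  qed
  also have "\<dots> = real (card ?B) * gap_weight \<alpha> L" by simp
  also have "\<dots> \<le> real n * gap_weight \<alpha> L"
  proof (intro mult_right_mono gap_weight_nonneg)
    have "card ?B \<le> card {2..n}" by (rule card_mono) auto
    then show "real (card ?B) \<le> real n" by simp
  qed (use L0 in auto)
  finally show ?thesis unfolding gap_sum_small_gaps [symmetric] by simp
qed

section \<open>The sum over all gaps\<close>

text \<open>The gaps with index 2 to n join consecutive odd primes, the last of which is p_(n+1).
  This fits the convention that \<open>prime_pair_count\<close> bounds the larger prime of a
  pair.\<close>

lemma gap_sum_asymp_equiv_nth_prime:
  assumes HL: "hardy_littlewood_prime_pairs" and \<alpha>: "\<alpha> \<ge> -1"
  defines "Y \<equiv> \<lambda>n. nth_prime (n + 1)"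
  shows "gap_sum \<alpha> \<sim>[sequentially]
    (\<lambda>n. real (Y n) / (ln (real (Y n)))\<^sup>2 * gap_weight_primitive \<alpha> (ln (real (Y n))))"
proof (subst asymp_equiv_at_top_iff)
  let ?F = "gap_weight_primitive \<alpha>"
  have Y: "filterlim Y at_top sequentially"
    unfolding Y_def by (rule filterlim_compose[OF filterlim_nth_prime filterlim_add_const_nat_at_top])
  have lnN: "filterlim (\<lambda>N. ln (real N)) at_top sequentially" by real_asymp
  have "filterlim (\<lambda>N. ?F (ln (real N))) at_top sequentially"
    by (rule filterlim_compose[OF gap_weight_primitive_at_top[OF \<alpha>] lnN])
  then have F1: "\<forall>\<^sub>F N in sequentially. ?F (ln (real N)) \<ge> 1" by (simp add: filterlim_at_top)
  have L1: "\<forall>\<^sub>F N in sequentially. ln (real N) > 1" by real_asymp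
  have "\<forall>\<^sub>F N in sequentially. real N / (ln (real N))\<^sup>2 * ?F (ln (real N)) > 0"
    using F1 L1 eventually_gt_at_top[of 0]
  proof eventually_elim
    case (elim N)
    then have "(ln (real N))\<^sup>2 > 0" by (intro zero_less_power) linarith
    with elim show ?case by (intro mult_pos_pos divide_pos_pos) auto
  qed
  then show "\<forall>\<^sub>F n in sequentially. real (Y n) / (ln (real (Y n)))\<^sup>2 * ?F (ln (real (Y n))) > 0"
    using Y by (rule eventually_compose_filterlim)
  show "\<forall>e>0. e < 1 \<longrightarrow> (\<forall>\<^sub>F n in sequentially.
      (1 - e) * (real (Y n) / (ln (real (Y n)))\<^sup>2 * ?F (ln (real (Y n)))) \<le> gap_sum \<alpha> n \<and>
      gap_sum \<alpha> n \<le> (1 + e) * (real (Y n) / (ln (real (Y n)))\<^sup>2 * ?F (ln (real (Y n)))))"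
  proof (intro allI impI)
    fix \<epsilon> :: real assume \<epsilon>: "\<epsilon> > 0" "\<epsilon> < 1"
    \<comment> \<open>The upper estimate accumulates (1 + e)^3 + e and the lower one (1 - e)^4 - e;
      both stay within 8 * e of 1.\<close>
    define e where "e = \<epsilon> / 8"
    have e: "0 < e" "e < 1" "8 * e = \<epsilon>" using \<epsilon> by (auto simp: e_def)
    obtain c where c: "0 < c" "c < 1"
      and Fc: "\<forall>\<^sub>F x in at_top. ?F (x powr c) \<ge> (1 - e) * ?F x"
      using gap_weight_primitive_powr[OF \<alpha> e(1)] by blast
    \<comment> \<open>Half of 1 - c is spent on the loss in the sieve and half remains as saving: c
      + (\<eta> - 3) = - 2 - \<eta>, so the total error is N / L^2 times L powr (- \<eta>), up to
      powers of ln L.\<close>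
    define \<eta> where "\<eta> = (1 - c) / 2"
    have \<eta>: "\<eta> > 0" using c by (simp add: \<eta>_def)
    define H where "H N = nat \<lfloor>ln (real N)\<rfloor>" for N :: nat
    define h where "h N = nat \<lfloor>ln (real N) powr c\<rfloor>" for N :: nat
    \<comment> \<open>Bounds (ln d) powr \<alpha> for 2 \<le> d \<le> L: the first term serves
      \<alpha> \<ge> 0, the second, attained at d = 2, serves \<alpha> < 0.\<close>
    define Q where "Q L = ln L powr \<bar>\<alpha>\<bar> + ln 2 powr \<alpha>" for L :: real
    let ?A = "\<lambda>n. \<Sum>d\<le>n. even_singular_series d * gap_weight \<alpha> (real d)"

    have F_pos: "\<forall>\<^sub>F n in sequentially. ?F (real n) > 0"
      using filterlim_compose[OF gap_weight_primitive_at_top[OF \<alpha>] filterlim_real_sequentially]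
      by (simp add: filterlim_at_top_dense)
    have A: "\<forall>\<^sub>F n in sequentially. (1 - e) * ?F (real n) \<le> ?A n \<and> ?A n \<le> (1 + e) * ?F (real n)"
      using sum_even_singular_series_gap_weight[OF \<alpha>] e
      unfolding asymp_equiv_at_top_iff[OF F_pos] by blast
    have H_top: "filterlim H at_top sequentially" unfolding H_def by real_asymp
    have h_top: "filterlim h at_top sequentially" unfolding h_def using c by real_asymp
    have AH: "\<forall>\<^sub>F N in sequentially. ?A (H N) \<le> (1 + e) * ?F (real (H N))"
      using eventually_compose_filterlim[OF A H_top] by eventually_elim simp
    have Ah: "\<forall>\<^sub>F N in sequentially. ?A (h N) \<ge> (1 - e) * ?F (real (h N))"
      using eventually_compose_filterlim[OF A h_top] by eventually_elim simp
    have FL_pos: "\<forall>\<^sub>F N in sequentially. ?F (ln (real N)) > 0"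
      using F1 by eventually_elim simp
    have FH: "\<forall>\<^sub>F N in sequentially. ?F (real (H N)) \<le> (1 + e) * ?F (ln (real N))"
    proof -
      have "(\<lambda>N. real (H N)) \<sim>[sequentially] (\<lambda>N. ln (real N))"
        unfolding H_def by real_asymp
      then have "(\<lambda>N. ?F (real (H N))) \<sim>[sequentially] (\<lambda>N. ?F (ln (real N)))"
        using \<alpha> lnN by (intro asymp_equiv_gap_weight_primitive)
      then have "\<forall>\<^sub>F N in sequentially. (1 - e) * ?F (ln (real N)) \<le> ?F (real (H N)) \<and>
          ?F (real (H N)) \<le> (1 + e) * ?F (ln (real N))"
        using e unfolding asymp_equiv_at_top_iff[OF FL_pos] by blast
      then show ?thesis by eventually_elim simp
    qed
    have Fh: "\<forall>\<^sub>F N in sequentially. ?F (real (h N)) \<ge> (1 - e) * ?F (ln (real N) powr c)"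
    proof -
      have top: "filterlim (\<lambda>N. ln (real N) powr c) at_top sequentially" using c by real_asymp
      have pos: "\<forall>\<^sub>F N in sequentially. ?F (ln (real N) powr c) > 0"
        using filterlim_compose[OF gap_weight_primitive_at_top[OF \<alpha>] top]
        by (simp add: filterlim_at_top_dense)
      have "(\<lambda>N. real (h N)) \<sim>[sequentially] (\<lambda>N. ln (real N) powr c)"
        unfolding h_def using c by real_asymp
      then have "(\<lambda>N. ?F (real (h N))) \<sim>[sequentially] (\<lambda>N. ?F (ln (real N) powr c))"
        using \<alpha> top by (intro asymp_equiv_gap_weight_primitive)
      then have "\<forall>\<^sub>F N in sequentially. (1 - e) * ?F (ln (real N) powr c) \<le> ?F (real (h N)) \<and>
          ?F (real (h N)) \<le> (1 + e) * ?F (ln (real N) powr c)"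
        using e unfolding asymp_equiv_at_top_iff[OF pos] by blast
      then show ?thesis by eventually_elim simp
    qed
    have FcN: "\<forall>\<^sub>F N in sequentially. ?F (ln (real N) powr c) \<ge> (1 - e) * ?F (ln (real N))"
      using Fc lnN by (rule eventually_compose_filterlim)
    have tail: "\<forall>\<^sub>F N in sequentially. ln (ln (real N)) powr \<alpha> \<le> e / 2 * ?F (ln (real N))"
    proof (rule eventually_compose_filterlim[OF _ lnN])
      show "\<forall>\<^sub>F x in at_top. ln x powr \<alpha> \<le> e / 2 * ?F x"
        using e by (intro ln_powr_le_gap_weight_primitive[OF \<alpha>]) simp
    qed
    have Lx0: "\<forall>\<^sub>F N in sequentially. ln (real N) \<ge> exp (max 1 \<alpha>)"
      using lnN by (simp add: filterlim_at_top)
    have count: "\<forall>\<^sub>F N in sequentially. real (prime_count N) \<le> (1 + 1) * (real N / ln (real N))"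
      by (rule prime_count_upper[OF HL]) simp
    have Qs: "\<forall>\<^sub>F N in sequentially. 2 * (ln (real N) powr (- \<eta>) * Q (ln (real N))) \<le> e"
    proof -
      define a where "a = \<bar>\<alpha>\<bar>"
      define k :: real where "k = ln 2 powr \<alpha>"
      have "a \<ge> 0" by (simp add: a_def)
      have "((\<lambda>N. 2 * (ln (real N) powr (- \<eta>) * (ln (ln (real N)) powr a + k))) \<longlongrightarrow> 0) sequentially"
        using \<eta> by real_asymp
      then have "\<forall>\<^sub>F N in sequentially. 2 * (ln (real N) powr (- \<eta>) * (ln (ln (real N)) powr a + k)) < e"
        using e(1) by (rule order_tendstoD(2))
      then show ?thesis unfolding Q_def a_def k_def by (rule eventually_mono) simp
    qed
    have HLN: "\<forall>\<^sub>F N in sequentially. \<forall>d. even d \<and> 2 \<le> d \<and> real d \<le> 1 * ln (real N) \<longrightarrow>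
           \<bar>real (prime_pair_count d (real N)) - singular_series d * (real N / (ln (real N))\<^sup>2)\<bar>
             \<le> e * (singular_series d * (real N / (ln (real N))\<^sup>2))"
      by (rule hardy_littlewood_uniform[OF HL _ e(1)]) simp

    \<comment> \<open>The estimates, so far in a free variable N, are all transported along N = Y
      n.\<close>
    note ev = eventually_compose_filterlim[OF _ Y]
    show "\<forall>\<^sub>F n in sequentially.
      (1 - \<epsilon>) * (real (Y n) / (ln (real (Y n)))\<^sup>2 * ?F (ln (real (Y n)))) \<le> gap_sum \<alpha> n \<and>
      gap_sum \<alpha> n \<le> (1 + \<epsilon>) * (real (Y n) / (ln (real (Y n)))\<^sup>2 * ?F (ln (real (Y n))))"
      using ev[OF F1] ev[OF L1] ev[OF AH] ev[OF Ah] ev[OF FH] ev[OF Fh] ev[OF FcN] ev[OF tail]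
        ev[OF Lx0] ev[OF count] ev[OF Qs] ev[OF HLN] ev[OF prime_triple_count_bound[OF HL \<eta>]]
    proof eventually_elim
      case (elim n)
      define N where "N = Y n"
      define L where "L = ln (real N)"
      define W where "W = real N / L\<^sup>2"
      have L: "L > 1" using elim by (simp add: L_def N_def)
      have N0: "real N > 0" using L by (cases "N = 0") (auto simp: L_def)
      have W0: "W > 0" using L N0 by (simp add: W_def)
      have FL: "?F L \<ge> 1" using elim by (simp add: L_def N_def)
      have w0: "gap_weight \<alpha> (real d) \<ge> 0" for d by (rule gap_weight_nonneg) simp
      have pairs: "(1 - e) * W * singular_series d \<le> real (prime_pair_count d (real N))"
          "real (prime_pair_count d (real N)) \<le> (1 + e) * W * singular_series d"
        if "even d" "2 \<le> d" "real d \<le> L" for d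
      proof -
        have "\<bar>real (prime_pair_count d (real N)) - singular_series d * W\<bar> \<le> e * (singular_series d * W)"
          using elim(12) that by (simp add: W_def L_def N_def)
        then show "(1 - e) * W * singular_series d \<le> real (prime_pair_count d (real N))"
          "real (prime_pair_count d (real N)) \<le> (1 + e) * W * singular_series d"
          by (simp_all add: algebra_simps abs_le_iff)
      qed

      have upper: "gap_sum \<alpha> n \<le> (1 + \<epsilon>) * (W * ?F L)"
      proof -
        \<comment> \<open>The first inequality places the gaps above H N at L or beyond, the second
          keeps d \<le> H N within the range of the conjecture with C = 1.\<close>
        have "L \<le> real (H N) + 1" "real (H N) \<le> L" using L unfolding H_def L_def by linarith+
        have gc: "real (gap_count n d) \<le> (1 + e) * W * even_singular_series d" if "d \<le> H N" for d
        proof (cases "even d \<and> 2 \<le> d")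
          case True
          have "real (gap_count n d) \<le> real (prime_pair_count d (real N))"
            using gap_count_le[of n d] by (simp add: N_def Y_def)
          also have "\<dots> \<le> (1 + e) * W * singular_series d"
            using True that \<open>real (H N) \<le> L\<close> by (intro pairs) auto
          finally show ?thesis using True by (simp add: even_singular_series_def)
        next
          case False
          then have "gap_count n d = 0" by (intro gap_count_eq_0) auto
          then show ?thesis using e W0 even_singular_series_nonneg[of d] by simp
        qed
        \<comment> \<open>A crude count is enough, since the large gaps only enter an error term; n
          + 1 equals \<open>prime_count N\<close>.\<close>
        have "real n \<le> 2 * W * L"
        proof -
          have "prime_count N = n + 1" by (simp add: N_def Y_def prime_count_nth_prime)
          then have "real n \<le> 2 * (real N / L)" using elim(10) by (simp add: L_def N_def)
          also have "\<dots> = 2 * W * L" using L by (simp add: W_def power2_eq_square)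
          finally show ?thesis .
        qed
        then have "real n * gap_weight \<alpha> L \<le> 2 * W * L * gap_weight \<alpha> L"
          using L by (intro mult_right_mono gap_weight_nonneg) auto
        also have "\<dots> = 2 * W * ln L powr \<alpha>" using L by (simp add: gap_weight_def)
        also have "\<dots> \<le> 2 * W * (e / 2 * ?F L)"
          using W0 elim(8) by (intro mult_left_mono) (auto simp: L_def N_def)
        finally have large: "real n * gap_weight \<alpha> L \<le> e * (W * ?F L)"
          by (simp add: mult_ac)
        have "gap_sum \<alpha> n \<le> (\<Sum>d\<le>H N. gap_weight \<alpha> (real d) * real (gap_count n d)) + real n * gap_weight \<alpha> L"
          using elim(9) \<open>L \<le> real (H N) + 1\<close> by (intro gap_sum_upper_small_gaps) (auto simp: L_def N_def)
        also have "\<dots> \<le> (\<Sum>d\<le>H N. gap_weight \<alpha> (real d) * ((1 + e) * W * even_singular_series d)) + e * (W * ?F L)"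
          by (intro add_mono sum_mono mult_left_mono gc w0 large) auto
        also have "(\<Sum>d\<le>H N. gap_weight \<alpha> (real d) * ((1 + e) * W * even_singular_series d)) = (1 + e) * W * ?A (H N)"
          by (simp add: sum_distrib_left mult_ac)
        also have "\<dots> \<le> (1 + e) * W * ((1 + e) * ((1 + e) * ?F L))"
        proof (intro mult_left_mono)
          have "?A (H N) \<le> (1 + e) * ?F (real (H N))" using elim(3) by (simp add: N_def)
          also have "\<dots> \<le> (1 + e) * ((1 + e) * ?F L)"
            using elim(5) e by (intro mult_left_mono) (auto simp: N_def L_def)
          finally show "?A (H N) \<le> (1 + e) * ((1 + e) * ?F L)" .
        qed (use e W0 in auto)
        finally have "gap_sum \<alpha> n \<le> ((1 + e) * ((1 + e) * (1 + e)) + e) * (W * ?F L)"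
          by (simp add: algebra_simps)
        also have "\<dots> \<le> (1 + \<epsilon>) * (W * ?F L)"
        proof (intro mult_right_mono)
          have "e * e \<le> e * 1" "e * (e * e) \<le> e * (1 * 1)" using e by (intro mult_mono; simp)+
          moreover have "(1 + e) * ((1 + e) * (1 + e)) + e = 1 + 4 * e + 3 * (e * e) + e * (e * e)"
            by (simp add: algebra_simps)
          ultimately show "(1 + e) * ((1 + e) * (1 + e)) + e \<le> 1 + \<epsilon>" using e by linarith
        qed (use W0 FL in auto)
        finally show ?thesis .
      qed

      have lower: "gap_sum \<alpha> n \<ge> (1 - \<epsilon>) * (W * ?F L)"
      proof -
        have Lc: "1 \<le> L powr c" using L c by (intro ge_one_powr_ge_zero) auto
        have Lc': "L powr c \<le> L" using L c powr_mono[of c 1 L] by simp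
        have h: "real (h N) \<le> L powr c" using Lc by (simp add: h_def L_def)
        define B where "B = real N * L powr (\<eta> - 3)"
        have B0: "B \<ge> 0" by (simp add: B_def)
        have Q0: "Q L \<ge> 0" by (simp add: Q_def)
        have each: "gap_weight \<alpha> (real d) * real (gap_count n d) \<ge>
            (1 - e) * W * (even_singular_series d * gap_weight \<alpha> (real d)) - Q L * B"
          if d: "d \<le> h N" for d
        proof (cases "even d \<and> 2 \<le> d")
          case False
          then have "even_singular_series d = 0" by (auto simp: even_singular_series_def)
          moreover have "0 \<le> Q L * B" "0 \<le> gap_weight \<alpha> (real d) * real (gap_count n d)"
            using Q0 B0 w0[of d] by (simp_all only: mult_nonneg_nonneg of_nat_0_le_iff)
          ultimately show ?thesis by (simp only: mult_zero_left mult_zero_right)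
        next
          case True
          have dL: "real d \<le> L" using d h Lc' by linarith
          \<comment> \<open>The choice of the intermediate prime costs a factor d, which the
            denominator of the weight cancels.\<close>
          have "(\<Sum>a\<in>{1..<d}. real (prime_triple_count a d N)) \<le> (\<Sum>a\<in>{1..<d}. B)"
          proof (rule sum_mono)
            fix a assume "a \<in> {1..<d}"
            then show "real (prime_triple_count a d N) \<le> B"
              using elim(13) dL by (auto simp: B_def L_def N_def)
          qed
          also have "\<dots> \<le> real d * B" using B0 by (simp add: mult_right_mono)
          finally have "real (prime_pair_count d (real N)) \<le> real (gap_count n d) + real d * B"
            using prime_pair_count_le_gap_count[of d n] True
            by (simp add: N_def Y_def flip: of_nat_sum)
          then have "(1 - e) * W * singular_series d - real d * B \<le> real (gap_count n d)"
            using pairs(1)[of d] True dL by simp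
          then have "gap_weight \<alpha> (real d) * ((1 - e) * W * singular_series d - real d * B)
              \<le> gap_weight \<alpha> (real d) * real (gap_count n d)"
            by (intro mult_left_mono w0)
          moreover have "gap_weight \<alpha> (real d) * (real d * B) \<le> Q L * B"
          proof -
            have "ln (real d) powr \<alpha> \<le> Q L"
            proof (cases "\<alpha> \<ge> 0")
              case \<alpha>0: True
              have "ln (real d) powr \<alpha> \<le> ln L powr \<alpha>"
                using True dL \<alpha>0 by (intro powr_mono2) auto
              also have "\<dots> \<le> Q L" using \<alpha>0 by (simp add: Q_def)
              finally show ?thesis .
            next
              case \<alpha>0: False
              have "ln (real d) powr \<alpha> \<le> ln 2 powr \<alpha>"
                using True \<alpha>0 by (intro powr_mono2') auto
              also have "\<dots> \<le> Q L" by (simp add: Q_def)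
              finally show ?thesis .
            qed
            then have "ln (real d) powr \<alpha> * B \<le> Q L * B" using B0 by (rule mult_right_mono)
            then show ?thesis using True by (simp add: gap_weight_def)
          qed
          ultimately show ?thesis using True
            by (simp add: even_singular_series_def algebra_simps)
        qed
        have "(1 - e) * W * ?A (h N) - real (h N + 1) * (Q L * B) =
            (\<Sum>d\<le>h N. (1 - e) * W * (even_singular_series d * gap_weight \<alpha> (real d)) - Q L * B)"
          by (simp add: sum_subtractf sum_distrib_left)
        also have "\<dots> \<le> (\<Sum>d\<le>h N. gap_weight \<alpha> (real d) * real (gap_count n d))"
          by (intro sum_mono each) auto
        also have "\<dots> \<le> gap_sum \<alpha> n" by (rule gap_sum_lower_small_gaps)
        finally have main: "(1 - e) * W * ?A (h N) - real (h N + 1) * (Q L * B) \<le> gap_sum \<alpha> n" .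
        \<comment> \<open>The factor 2 covers the extra index d = 0, since L powr c \<ge> 1.\<close>
        have "real (h N + 1) * (Q L * B) \<le> (2 * L powr c) * (Q L * B)"
          using h Lc Q0 B0 by (intro mult_right_mono) auto
        also have "\<dots> = W * (2 * (L powr (- \<eta>) * Q L))"
        proof -
          have "L powr c * L powr (\<eta> - 3) = L powr (- \<eta>) / L\<^sup>2"
          proof -
            have "c + (\<eta> - 3) = - \<eta> - 2" by (simp add: \<eta>_def field_simps)
            then have "L powr c * L powr (\<eta> - 3) = L powr (- \<eta> - 2)"
              by (simp only: powr_add [symmetric])
            also have "\<dots> = L powr (- \<eta>) / L powr 2" by (rule powr_diff)
            finally show ?thesis using L by simp
          qed
          moreover have "(2 * L powr c) * (Q L * B) = 2 * real N * Q L * (L powr c * L powr (\<eta> - 3))"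
            by (simp add: B_def)
          ultimately show ?thesis by (simp add: W_def)
        qed
        also have "\<dots> \<le> W * e" using elim(11) W0 by (intro mult_left_mono) (auto simp: L_def N_def)
        also have "\<dots> \<le> W * (e * ?F L)" using e W0 FL by (intro mult_left_mono) auto
        finally have err: "real (h N + 1) * (Q L * B) \<le> e * (W * ?F L)" by (simp add: mult_ac)
        have "?A (h N) \<ge> (1 - e) * ((1 - e) * ((1 - e) * ?F L))"
        proof -
          have "(1 - e) * ((1 - e) * ((1 - e) * ?F L)) \<le> (1 - e) * ((1 - e) * ?F (L powr c))"
            using elim(7) e by (intro mult_left_mono) (auto simp: L_def N_def)
          also have "\<dots> \<le> (1 - e) * ?F (real (h N))"
            using elim(6) e by (intro mult_left_mono) (auto simp: L_def N_def)
          also have "\<dots> \<le> ?A (h N)" using elim(4) by (simp add: N_def)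
          finally show ?thesis .
        qed
        then have "(1 - e) * W * ((1 - e) * ((1 - e) * ((1 - e) * ?F L))) \<le> (1 - e) * W * ?A (h N)"
          using e W0 by (intro mult_left_mono) auto
        then have "((1 - e) ^ 4 - e) * (W * ?F L) \<le> gap_sum \<alpha> n"
          using main err by (simp add: power4_eq_xxxx algebra_simps)
        moreover have "(1 - \<epsilon>) * (W * ?F L) \<le> ((1 - e) ^ 4 - e) * (W * ?F L)"
        proof (intro mult_right_mono)
          have "1 + of_nat 4 * (- e) \<le> (1 + (- e)) ^ 4" by (rule Bernoulli_inequality) (use e in simp)
          then show "1 - \<epsilon> \<le> (1 - e) ^ 4 - e" using e by simp
        qed (use W0 FL in auto)
        ultimately show ?thesis by linarith
      qed
      show ?case using upper lower by (simp add: W_def L_def N_def)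
    qed
  qed
qed

lemma asymp_equiv_gap_main_term:
  fixes f g :: "'a \<Rightarrow> real"
  assumes "\<alpha> \<ge> -1" "f \<sim>[F] g" "filterlim g at_top F"
  shows "(\<lambda>x. f x / ln (f x) * gap_weight_primitive \<alpha> (ln (f x)))
           \<sim>[F] (\<lambda>x. g x / ln (g x) * gap_weight_primitive \<alpha> (ln (g x)))"
  using assms
  by (intro asymp_equiv_mult asymp_equiv_divide asymp_equiv_gap_weight_primitive asymp_equiv_ln
      filterlim_compose[OF ln_at_top])

text \<open>By the prime number theorem n is asymptotic to u = Y / ln Y, and ln u to ln Y, so Y /
  (ln Y)^2 = u / ln Y may be replaced by n / ln n; the primitive does not feel the change.\<close>

lemma gap_sum_asymp_equiv:
  assumes HL: "hardy_littlewood_prime_pairs" and \<alpha>: "\<alpha> \<ge> -1"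
  shows "gap_sum \<alpha> \<sim>[sequentially] (\<lambda>n. real n / ln (real n) * gap_weight_primitive \<alpha> (ln (real n)))"
proof -
  define Y where "Y n = nth_prime (n + 1)" for n
  define u where "u n = real (Y n) / ln (real (Y n))" for n
  have Y: "filterlim Y at_top sequentially"
    unfolding Y_def by (rule filterlim_compose[OF filterlim_nth_prime filterlim_add_const_nat_at_top])
  \<comment> \<open>There are exactly n + 1 primes up to p_(n+1); the shift by 1 is
    harmless.\<close>
  have "(\<lambda>n. real n) \<sim>[sequentially] (\<lambda>n. real (n + 1))" by real_asymp
  also have "(\<lambda>n. real (n + 1)) = (\<lambda>n. real (prime_count (Y n)))"
    by (simp add: Y_def prime_count_nth_prime)
  also have "\<dots> \<sim>[sequentially] u"
    unfolding u_def by (rule asymp_equiv_compose'[OF prime_count_asymp_equiv[OF HL] Y])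
  finally have u: "real \<sim>[sequentially] u" .
  then have u_top: "filterlim u at_top sequentially"
    using asymp_equiv_at_top_transfer filterlim_real_sequentially by blast
  have "(\<lambda>n. ln (u n)) \<sim>[sequentially] (\<lambda>n. ln (real (Y n)))"
    unfolding u_def
  proof (rule asymp_equiv_compose'[OF _ Y])
    show "(\<lambda>y. ln (real y / ln (real y))) \<sim>[sequentially] (\<lambda>y. ln (real y))" by real_asymp
  qed
  moreover have lnY: "filterlim (\<lambda>n. ln (real (Y n))) at_top sequentially"
    by (rule filterlim_compose[OF ln_at_top filterlim_compose[OF filterlim_real_sequentially Y]])
  ultimately have "(\<lambda>n. u n / ln (u n) * gap_weight_primitive \<alpha> (ln (u n))) \<sim>[sequentially]
      (\<lambda>n. u n / ln (real (Y n)) * gap_weight_primitive \<alpha> (ln (real (Y n))))"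
    using \<alpha> by (intro asymp_equiv_mult asymp_equiv_divide asymp_equiv_refl asymp_equiv_gap_weight_primitive)
  moreover have "u n / ln (real (Y n)) = real (Y n) / (ln (real (Y n)))\<^sup>2" for n
    by (simp add: u_def power2_eq_square)
  ultimately have main: "(\<lambda>n. real (Y n) / (ln (real (Y n)))\<^sup>2 * gap_weight_primitive \<alpha> (ln (real (Y n))))
      \<sim>[sequentially] (\<lambda>n. u n / ln (u n) * gap_weight_primitive \<alpha> (ln (u n)))"
    by (simp only: asymp_equiv_sym)
  have "gap_sum \<alpha> \<sim>[sequentially]
      (\<lambda>n. real (Y n) / (ln (real (Y n)))\<^sup>2 * gap_weight_primitive \<alpha> (ln (real (Y n))))"
    unfolding Y_def by (rule gap_sum_asymp_equiv_nth_prime[OF HL \<alpha>])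
  also note main
  also have "(\<lambda>n. u n / ln (u n) * gap_weight_primitive \<alpha> (ln (u n)))
      \<sim>[sequentially] (\<lambda>n. real n / ln (real n) * gap_weight_primitive \<alpha> (ln (real n)))"
    by (rule asymp_equiv_symI, rule asymp_equiv_gap_main_term[OF \<alpha> u u_top])
  finally show ?thesis .
qed

theorem theorem1p1:
  fixes \<alpha> :: real
  assumes "hardy_littlewood_prime_pairs"
    and "\<alpha> \<ge> -1"
  shows "(\<lambda>X::real. \<Sum>n\<in>{n::nat. 2 \<le> n \<and> real n \<le> X}.
            ln (real (prime_gap n)) powr \<alpha> / real (prime_gap n))
         \<sim>[at_top]
         (\<lambda>X. if \<alpha> > -1 then X / ln X * (ln (ln X) powr (1 + \<alpha>) / (1 + \<alpha>))
              else X * ln (ln (ln X)) / ln X)"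
proof -
  have floor_top: "filterlim (\<lambda>X::real. nat \<lfloor>X\<rfloor>) at_top at_top" by real_asymp
  have lhs: "(\<lambda>X::real. \<Sum>n\<in>{n::nat. 2 \<le> n \<and> real n \<le> X}.
            ln (real (prime_gap n)) powr \<alpha> / real (prime_gap n)) = (\<lambda>X. gap_sum \<alpha> (nat \<lfloor>X\<rfloor>))"
  proof
    fix X :: real
    have "{n::nat. 2 \<le> n \<and> real n \<le> X} = {2..nat \<lfloor>X\<rfloor>}"
    proof -
      have "n \<le> nat \<lfloor>X\<rfloor> \<longleftrightarrow> real n \<le> X" if "2 \<le> n" for n
        using that by linarith
      then show ?thesis by auto
    qed
    then show "(\<Sum>n\<in>{n::nat. 2 \<le> n \<and> real n \<le> X}.
            ln (real (prime_gap n)) powr \<alpha> / real (prime_gap n)) = gap_sum \<alpha> (nat \<lfloor>X\<rfloor>)"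
      by (simp add: gap_sum_def gap_weight_def)
  qed
  have "(\<lambda>X::real. gap_sum \<alpha> (nat \<lfloor>X\<rfloor>)) \<sim>[at_top] (\<lambda>X. real (nat \<lfloor>X\<rfloor>) / ln (real (nat \<lfloor>X\<rfloor>))
      * gap_weight_primitive \<alpha> (ln (real (nat \<lfloor>X\<rfloor>))))"
    by (rule asymp_equiv_compose'[OF gap_sum_asymp_equiv[OF assms] floor_top])
  also have "\<dots> \<sim>[at_top] (\<lambda>X. X / ln X * gap_weight_primitive \<alpha> (ln X))"
  proof (rule asymp_equiv_gap_main_term[OF assms(2) _ filterlim_ident])
    show "(\<lambda>X::real. real (nat \<lfloor>X\<rfloor>)) \<sim>[at_top] (\<lambda>X. X)" by real_asymp
  qed
  finally have "(\<lambda>X::real. gap_sum \<alpha> (nat \<lfloor>X\<rfloor>)) \<sim>[at_top] (\<lambda>X. X / ln X * gap_weight_primitive \<alpha> (ln X))" .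
  moreover have "(\<lambda>X. X / ln X * gap_weight_primitive \<alpha> (ln X)) =
      (\<lambda>X. if \<alpha> > -1 then X / ln X * (ln (ln X) powr (1 + \<alpha>) / (1 + \<alpha>))
              else X * ln (ln (ln X)) / ln X)"
    by (auto simp: gap_weight_primitive_def)
  ultimately show ?thesis by (simp only: lhs)
qed

end
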